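(* Let $d\ge2$ and let $B\subset\mathbb{R}^d$ be a bounded symmetric convex body. Suppose that $\partial B$ is of class $C^{\lfloor d/2\rfloor+1}$ and has everywhere non-vanishing Gaussian curvature. Then $$\#\{k\in\mathbb{Z}^d:\ R\le\|k\|_B\le R+\delta\}\lesssim\max\{R^{d-2+\frac{2}{d+1}},\,R^{d-1}\delta\}.$$
   Context: For a symmetric convex body $B$, $\|x\|_B=\inf\{t>0:x\in tB\}$. The notation $X\lesssim Y$ means $X\le KY$ with a constant $K$ that does not depend on $R$ or $\delta$ (it may depend on $B$ and $d$).
   Formalization: The range of R and δ, left implicit, is taken as R > 0 and 0 ≤ δ ≤ R; without such a restriction the bound fails (Euclidean disc, d = 2, R = 1, δ → ∞: the count is about πδ², the bound is max{1, δ}). *)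

theory Defs
  imports "HOL-Analysis.Analysis"
begin

definition symmetric_convex_body :: "'a::euclidean_space set \<Rightarrow> bool" where
  "symmetric_convex_body B \<longleftrightarrow> convex B \<and> interior B \<noteq> {} \<and> (\<forall>x\<in>B. - x \<in> B)"

definition body_norm :: "'a::real_vector set \<Rightarrow> 'a \<Rightarrow> real" where
  "body_norm B x = Inf {t. t > 0 \<and> x \<in> (\<lambda>y. t *\<^sub>R y) ` B}"

definition integer_lattice :: "(real ^ 'n) set" where
  "integer_lattice = {k. \<forall>i. k $ i \<in> \<int>}"

primrec C_class :: "nat \<Rightarrow> ('a::euclidean_space \<Rightarrow> real) \<Rightarrow> bool" where
  "C_class 0 f \<longleftrightarrow> continuous_on UNIV f"
| "C_class (Suc m) f \<longleftrightarrow>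
     (\<forall>x. f differentiable (at x)) \<and>
     (\<forall>b\<in>Basis. C_class m (\<lambda>x. frechet_derivative f (at x) b))"

definition orth_proj :: "'a::real_inner \<Rightarrow> 'a \<Rightarrow> 'a" where
  "orth_proj e x = x - (x \<bullet> e) *\<^sub>R e"

(* Near each of its points, M is the graph of a C^m function over the hyperplane orthogonal
   to some unit vector e. The function g is declared on the whole space, but only its values
   on that hyperplane are used; a C^m function on the hyperplane extends to the whole space
   by composing it with the projection. *)
definition C_hypersurface :: "nat \<Rightarrow> 'a::euclidean_space set \<Rightarrow> bool" where
  "C_hypersurface m M \<longleftrightarrow>
     (\<forall>p\<in>M. \<exists>r>0. \<exists>e g. norm e = 1 \<and> C_class m g \<and>
        M \<inter> ball p r = {x \<in> ball p r. x \<bullet> e = g (orth_proj e x)})"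

(* The Gauss map of the boundary: where the boundary is C^1, the supporting hyperplane of the
   convex set B at p is unique, so the description below determines the vector. *)
definition outer_normal :: "'a::euclidean_space set \<Rightarrow> 'a \<Rightarrow> 'a" where
  "outer_normal B p = (THE \<nu>. norm \<nu> = 1 \<and> (\<forall>x\<in>B. x \<bullet> \<nu> \<le> p \<bullet> \<nu>))"

(* The Gaussian (Gauss-Kronecker) curvature: the determinant of the Weingarten map, i.e. of the
   differential W of the Gauss map, acting on the tangent space, which is the orthogonal
   complement of the outer normal \<nu>. Differentiating along the boundary determines W only on the
   tangent space, hence the projection; adding (x \<bullet> \<nu>) *\<^sub>R \<nu> extends the Weingarten map by the
   identity on the normal line, which leaves its determinant unchanged. *)
definition gaussian_curvature :: "(real ^ 'n) set \<Rightarrow> real ^ 'n \<Rightarrow> real" where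
  "gaussian_curvature B p =
     (let \<nu> = outer_normal B p;
          W = frechet_derivative (outer_normal B) (at p within frontier B)
      in det (matrix (\<lambda>x. W (orth_proj \<nu> x) + (x \<bullet> \<nu>) *\<^sub>R \<nu>)))"

end

(* The caps of width r and height r^(1-d) of the shell of radius R = r^(d+1) have volume of
   order one. By a transference principle of the geometry of numbers, the number of lattice points
   in such a cap is at most a constant times the number of lattice points in the dual box, which has
   length r^(d-1) in the direction of the normal and width 1/r in the tangential directions. The
   curvature does not vanish, so the Gauss map is bi-Lipschitz; hence a lattice point k <> 0 lies in
   at most of order (r^(d-1)/|k|)^(d-1) of the dual boxes of the r^(d(d-1)) caps. Summing over
   |k| <= 2 r^(d-1) gives r^(d(d-1)) = R^(d-2+2/(d+1)). A thicker shell is a union of shells of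
   thickness r^(1-d). *)

theory Submission
  imports Defs
begin

section \<open>Geometry of numbers for dual boxes\<close>

text \<open>The scales come from the cell size. Normals within r^(-d) of each other belong, by the
  lower Lipschitz bound of the Gauss map, to boundary points at distance O(r^(-d)). Dilation by R =
  r^(d+1) turns this into r, and the deviation from the tangent plane, quadratic in the distance,
  into R r^(-2d) = r^(1-d), the thickness of the shell; so flatness and thickness match. The
  transference is obtained by pigeonholing alone, without volumes or reduced bases: the layer
  heights that bound the primal count also measure how strongly dual points are forced into common
  fibres. The geometric obstacle is that the counting needs two-point bounds for the Gauss map,
  uniform over the boundary, while the curvature controls a derivative at one point and only along
  the surface. Strict differentiability of a chart normal, which compares two arbitrary points near
  p, gives local bounds; convexity (equal normals force a flat segment) and compactness make them
  global.\<close>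

lemma pigeonhole_int:
  fixes f :: "'b \<Rightarrow> int" and a b m :: real
  assumes fin: "finite Y" and rng: "\<And>y. y \<in> Y \<Longrightarrow> a \<le> f y \<and> f y \<le> b" and m: "b - a + 1 \<le> m" "0 \<le> m"
  shows "\<exists>Y'\<subseteq>Y. (\<forall>y\<in>Y'. \<forall>y'\<in>Y'. f y = f y') \<and> real (card Y) \<le> m * real (card Y')"
proof (cases "Y = {}")
  case True
  then show ?thesis by auto
next
  case False
  define Z where "Z = {\<lceil>a\<rceil>..\<lfloor>b\<rfloor>}"
  have sub: "f ` Y \<subseteq> Z" using rng by (auto simp: Z_def ceiling_le_iff le_floor_iff)
  have "real (card Z) \<le> m"
  proof -
    have "Z \<noteq> {}" using sub False by auto
    then have "real (card Z) = real_of_int (\<lfloor>b\<rfloor> - \<lceil>a\<rceil> + 1)" by (auto simp: Z_def)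
    also have "\<dots> \<le> b - a + 1" by (simp; linarith)
    finally show ?thesis using m by simp
  qed
  have fY: "finite (f ` Y)" "f ` Y \<noteq> {}" using fin False by auto
  define N where "N z = card {y\<in>Y. f y = z}" for z
  obtain z where z: "z \<in> f ` Y" "\<And>z'. z' \<in> f ` Y \<Longrightarrow> N z' \<le> N z"
    using arg_min_if_finite[OF fY, of "\<lambda>z. - int (N z)"] by (metis not_less neg_less_iff_less of_nat_less_iff)
  have "card Y = (\<Sum>z\<in>f ` Y. N z)"
    using sum.image_gen[OF fin, of "\<lambda>_. 1::nat" f] by (simp add: N_def)
  also have "\<dots> \<le> card (f ` Y) * N z" using sum_bounded_above[of "f ` Y" N "N z"] z by simp
  also have "\<dots> \<le> card Z * N z"
    by (intro mult_right_mono card_mono sub) (auto simp: Z_def)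
  finally have "real (card Y) \<le> real (card Z) * real (N z)" by (metis of_nat_le_iff of_nat_mult)
  also have "\<dots> \<le> m * real (N z)" by (intro mult_right_mono \<open>real (card Z) \<le> m\<close>) auto
  finally show ?thesis by (intro exI[of _ "{y\<in>Y. f y = z}"]) (auto simp: N_def)
qed

text \<open>The number \<open>h\<close> is the product of the inverse heights of the lattice over the successive
  subspaces of a flag. It bounds the lattice points from above and, since the products of
  lattice and dual vectors are integers, forces the dual points to cluster.\<close>

lemma flag_heights:
  fixes \<Lambda> \<Gamma> :: "'a::euclidean_space set"
  assumes diff: "\<And>x y. x \<in> \<Lambda> \<Longrightarrow> y \<in> \<Lambda> \<Longrightarrow> x - y \<in> \<Lambda>"
    and fin: "\<And>\<rho>. finite (\<Lambda> \<inter> cball 0 \<rho>)"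
    and int: "\<And>x y. x \<in> \<Lambda> \<Longrightarrow> y \<in> \<Gamma> \<Longrightarrow> y \<bullet> x \<in> \<int>"
  shows "finite T \<Longrightarrow> independent T \<Longrightarrow> T \<subseteq> \<Lambda> \<inter> cball 0 1 \<Longrightarrow> 1 \<le> \<rho> \<Longrightarrow>
    \<exists>h>0. real (card (\<Lambda> \<inter> span T \<inter> cball 0 \<rho>)) \<le> (4 * \<rho> * 2 ^ card T) ^ card T * h \<and>
      (\<exists>M0\<ge>1. \<forall>M\<ge>M0. \<forall>Y. finite Y \<longrightarrow> Y \<subseteq> \<Gamma> \<inter> cball 0 M \<longrightarrow>
        (\<exists>Y'\<subseteq>Y. (\<forall>y\<in>Y'. \<forall>y'\<in>Y'. \<forall>v\<in>T. (y - y') \<bullet> v = 0) \<and>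
          h * real (card Y) \<le> (5 * M) ^ card T * real (card Y')))"
proof (induction T arbitrary: \<rho> rule: finite_induct)
  case empty
  have "card (\<Lambda> \<inter> span {} \<inter> cball 0 \<rho>) \<le> card {0::'a}" by (intro card_mono) auto
  then show ?case by (intro exI[of _ 1] conjI exI[of _ "1::real"] allI impI) auto
next
  case (insert t T)
  let ?j = "card T"
  have ind: "independent T" "t \<notin> span T"
    using insert.prems(1) insert.hyps independent_insert by metis+
  have T: "T \<subseteq> \<Lambda> \<inter> cball 0 1" and t: "t \<in> \<Lambda>" "norm t \<le> 1" using insert.prems by auto
  have \<rho>: "1 \<le> \<rho>" "1 \<le> 2 * \<rho>" using insert.prems by auto
  \<comment> \<open>The hypothesis is used at radius \<open>2 * \<rho>\<close> because differences
    of two lattice points of the ball of radius \<open>\<rho>\<close> will be counted; this doubling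
    along the flag is the source of \<open>2 ^ card T\<close>.\<close>
  obtain h M0 where h: "h > 0"
    and ha: "real (card (\<Lambda> \<inter> span T \<inter> cball 0 (2*\<rho>))) \<le> (4 * (2*\<rho>) * 2 ^ ?j) ^ ?j * h"
    and M0: "M0 \<ge> 1"
    and hb: "\<And>M Y. M \<ge> M0 \<Longrightarrow> finite Y \<Longrightarrow> Y \<subseteq> \<Gamma> \<inter> cball 0 M \<Longrightarrow>
        (\<exists>Y'\<subseteq>Y. (\<forall>y\<in>Y'. \<forall>y'\<in>Y'. \<forall>v\<in>T. (y - y') \<bullet> v = 0) \<and>
          h * real (card Y) \<le> (5 * M) ^ ?j * real (card Y'))"
    using insert.IH[OF ind(1) T \<rho>(2)] by metis
  obtain y z where yz: "y \<in> span T" "\<And>w. w \<in> span T \<Longrightarrow> orthogonal z w" "t = y + z"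
    using orthogonal_subspace_decomp_exists[of T t] by metis
  have z0: "z \<noteq> 0" using yz ind by auto
  \<comment> \<open>\<open>e\<close> spans the orthogonal complement of \<open>span T\<close> in
    \<open>span (insert t T)\<close>, so \<open>s \<bullet> e\<close> is the signed height of
    \<open>s\<close> over \<open>span T\<close>.\<close>
  define e where "e = z /\<^sub>R norm z"
  have e1: "norm e = 1" using z0 by (simp add: e_def)
  have ee: "e \<bullet> e = 1" using e1 by (simp add: dot_square_norm)
  have eT: "w \<bullet> e = 0" if "w \<in> span T" for w
    using yz(2)[OF that] by (simp add: e_def orthogonal_def inner_commute)
  have zz: "z = norm z *\<^sub>R e" using z0 by (simp add: e_def)
  have dec: "s - (s \<bullet> e) *\<^sub>R e \<in> span T" if sp: "s \<in> span (insert t T)" for s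
  proof -
    obtain k where k: "s - k *\<^sub>R t \<in> span T" using sp unfolding span_breakdown_eq by blast
    have "(s - k *\<^sub>R t) \<bullet> e = 0" by (rule eT[OF k])
    moreover have "t \<bullet> e = norm z" using yz(3) zz eT[OF yz(1)] ee
      by (metis inner_add_left inner_scaleR_left add_0 mult.right_neutral)
    ultimately have "s \<bullet> e = k * norm z" by (simp add: inner_diff_left)
    then have eq: "s - (s \<bullet> e) *\<^sub>R e = (s - k *\<^sub>R t) + k *\<^sub>R y"
      using yz(3) zz by (metis (no_types, lifting) add_diff_cancel_left' diff_add_eq diff_diff_eq2 scaleR_right_diff_distrib scaleR_scaleR)
    show ?thesis unfolding eq by (intro span_add span_scale k yz(1))
  qed
  \<comment> \<open>The height is minimised within radius \<open>2 * \<rho>\<close>, where the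
    lattice is finite; \<open>t\<close> itself shows that the minimum \<open>\<eta>\<close> is at
    most 1.\<close>
  define S where "S = {s \<in> \<Lambda> \<inter> span (insert t T) \<inter> cball 0 (2*\<rho>). s \<bullet> e \<noteq> 0}"
  have fS: "finite S" using fin[of "2*\<rho>"] by (rule rev_finite_subset) (auto simp: S_def)
  have te: "t \<bullet> e \<noteq> 0" using dec[of t] ind(2) by (auto simp: span_base)
  have tS: "t \<in> S" using t \<rho> te by (auto simp: S_def span_base)
  define \<eta> where "\<eta> = Min ((\<lambda>s. \<bar>s \<bullet> e\<bar>) ` S)"
  have "\<eta> \<in> (\<lambda>s. \<bar>s \<bullet> e\<bar>) ` S" unfolding \<eta>_def using fS tS by (intro Min_in) auto
  then obtain s where s: "s \<in> S" "\<eta> = \<bar>s \<bullet> e\<bar>" by auto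
  have \<eta>0: "\<eta> > 0" using s by (auto simp: S_def)
  have \<eta>min: "\<eta> \<le> \<bar>s' \<bullet> e\<bar>" if "s' \<in> S" for s' unfolding \<eta>_def using fS that by (intro Min_le) auto
  have \<eta>1: "\<eta> \<le> 1"
    using \<eta>min[OF tS] Cauchy_Schwarz_ineq2[of t e] e1 t(2) by simp
  let ?A = "\<Lambda> \<inter> span (insert t T) \<inter> cball 0 \<rho>"
  have fA: "finite ?A" using fin[of \<rho>] by (rule rev_finite_subset) auto
  have se: "\<bar>s' \<bullet> e\<bar> \<le> \<rho>" if "s' \<in> ?A" for s'
    using Cauchy_Schwarz_ineq2[of s' e] e1 that by simp
  \<comment> \<open>Slabs of thickness \<open>\<eta>\<close>: two points of one slab differ by a
    lattice vector of height less than \<open>\<eta>\<close>, which minimality forces into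
    \<open>span T\<close>. The floors take at most \<open>2 * \<rho> / \<eta> + 2\<close> values,
    and \<open>1 \<le> \<rho> / \<eta>\<close> absorbs the 2.\<close>
  have "\<exists>Y'\<subseteq>?A. (\<forall>y\<in>Y'. \<forall>y'\<in>Y'. \<lfloor>y \<bullet> e / \<eta>\<rfloor> = \<lfloor>y' \<bullet> e / \<eta>\<rfloor>) \<and> real (card ?A) \<le> (4*\<rho>/\<eta>) * real (card Y')"
  proof (rule pigeonhole_int[OF fA, where a = "- \<rho>/\<eta> - 1" and b = "\<rho>/\<eta>"])
    fix y assume "y \<in> ?A"
    from se[OF this] have "- \<rho> / \<eta> \<le> y \<bullet> e / \<eta>" "y \<bullet> e / \<eta> \<le> \<rho> / \<eta>"
      using \<eta>0 by (auto simp: field_simps)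
    then show "- \<rho>/\<eta> - 1 \<le> real_of_int \<lfloor>y \<bullet> e / \<eta>\<rfloor> \<and> real_of_int \<lfloor>y \<bullet> e / \<eta>\<rfloor> \<le> \<rho>/\<eta>"
      by linarith
  next
    have "1 \<le> \<rho> / \<eta>" using \<rho> \<eta>0 \<eta>1 by (simp add: field_simps)
    moreover have "- \<rho> / \<eta> = - (\<rho> / \<eta>)" "4 * \<rho> / \<eta> = 4 * (\<rho> / \<eta>)" by simp_all
    ultimately show "\<rho> / \<eta> - (- \<rho> / \<eta> - 1) + 1 \<le> 4 * \<rho> / \<eta>" by linarith
    show "0 \<le> 4 * \<rho> / \<eta>" using \<rho> \<eta>0 by simp
  qed
  then obtain Y' where Y': "Y' \<subseteq> ?A" "\<And>y y'. y \<in> Y' \<Longrightarrow> y' \<in> Y' \<Longrightarrow> \<lfloor>y \<bullet> e / \<eta>\<rfloor> = \<lfloor>y' \<bullet> e / \<eta>\<rfloor>"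
    "real (card ?A) \<le> (4*\<rho>/\<eta>) * real (card Y')" by blast
  have cY': "card Y' \<le> card (\<Lambda> \<inter> span T \<inter> cball 0 (2*\<rho>))"
  proof (cases "Y' = {}")
    case False
    then obtain y0 where y0: "y0 \<in> Y'" by blast
    have "(\<lambda>y. y - y0) ` Y' \<subseteq> \<Lambda> \<inter> span T \<inter> cball 0 (2*\<rho>)"
    proof
      fix x assume "x \<in> (\<lambda>y. y - y0) ` Y'"
      then obtain y where y: "y \<in> Y'" "x = y - y0" by blast
      have x1: "x \<in> \<Lambda>" "x \<in> span (insert t T)" "norm x \<le> 2 * \<rho>"
      proof -
        have m: "y \<in> ?A" "y0 \<in> ?A" using y(1) y0 Y'(1) by blast+
        then show "x \<in> \<Lambda>" "x \<in> span (insert t T)" using y(2) diff by (simp_all add: span_diff)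
        show "norm x \<le> 2 * \<rho>" using m y(2) norm_triangle_ineq4[of y y0] by simp
      qed
      have "\<bar>y \<bullet> e / \<eta> - y0 \<bullet> e / \<eta>\<bar> < 1" using Y'(2)[OF y(1) y0] by linarith
      then have "\<bar>x \<bullet> e\<bar> < \<eta>" using \<eta>0 by (simp add: y(2) inner_diff_left flip: diff_divide_distrib)
      then have "x \<bullet> e = 0" using \<eta>min[of x] x1 by (fastforce simp: S_def)
      then show "x \<in> \<Lambda> \<inter> span T \<inter> cball 0 (2*\<rho>)" using dec[OF x1(2)] x1 by simp
    qed
    moreover have "finite (\<Lambda> \<inter> span T \<inter> cball 0 (2*\<rho>))" using fin[of "2*\<rho>"] by (rule rev_finite_subset) auto
    moreover have "inj_on (\<lambda>y. y - y0) Y'" by (auto simp: inj_on_def)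
    ultimately show ?thesis by (metis card_image card_mono)
  qed simp
  \<comment> \<open>The new vector costs a factor of order \<open>1 / \<eta>\<close> in the primal
    count and only \<open>5 * M * \<eta>\<close> in the dual count, so division by
    \<open>\<eta>\<close> serves both estimates.\<close>
  let ?h = "h / \<eta>"
  have cT: "card (insert t T) = Suc ?j" using insert.hyps by simp
  show ?case
  proof (rule exI[of _ ?h], intro conjI)
    show "?h > 0" using h \<eta>0 by simp
    have "real (card ?A) \<le> (4*\<rho>/\<eta>) * ((4 * (2*\<rho>) * 2 ^ ?j) ^ ?j * h)"
      by (rule order_trans[OF Y'(3)]) (use cY' ha \<rho> \<eta>0 in \<open>intro mult_left_mono; simp; linarith\<close>)
    also have "\<dots> = (4 * \<rho>) * (4 * \<rho> * 2 ^ Suc ?j) ^ ?j * ?h" by (simp add: algebra_simps)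
    also have "\<dots> \<le> (4 * \<rho> * 2 ^ Suc ?j) * (4 * \<rho> * 2 ^ Suc ?j) ^ ?j * ?h"
    proof -
      have "(1::real) \<le> 2 ^ Suc ?j" by (rule one_le_power) simp
      then have "4 * \<rho> * 1 \<le> 4 * \<rho> * 2 ^ Suc ?j" using \<rho> by (intro mult_left_mono) auto
      then show ?thesis using h \<eta>0 \<rho> by (intro mult_right_mono) (auto simp del: power_Suc)
    qed
    finally show "real (card ?A) \<le> (4 * \<rho> * 2 ^ card (insert t T)) ^ card (insert t T) * ?h"
      unfolding cT power_Suc[of "4 * \<rho> * 2 ^ Suc ?j"] .
    show "\<exists>M0\<ge>1. \<forall>M\<ge>M0. \<forall>Y. finite Y \<longrightarrow> Y \<subseteq> \<Gamma> \<inter> cball 0 M \<longrightarrow>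
        (\<exists>Y'\<subseteq>Y. (\<forall>y\<in>Y'. \<forall>y'\<in>Y'. \<forall>v\<in>insert t T. (y - y') \<bullet> v = 0) \<and>
          ?h * real (card Y) \<le> (5 * M) ^ card (insert t T) * real (card Y'))"
    proof (intro exI[of _ "max M0 (1/\<eta>)"] conjI allI impI)
      show "1 \<le> max M0 (1/\<eta>)" using M0 by simp
      fix M Y assume M: "max M0 (1/\<eta>) \<le> M" and Y: "finite Y" "Y \<subseteq> \<Gamma> \<inter> cball 0 M"
      have M1: "M \<ge> M0" "1 \<le> M * \<eta>" "M \<ge> 1" using M M0 \<eta>0 by (auto simp: field_simps)
      obtain Y1 where Y1: "Y1 \<subseteq> Y" "\<And>y y' v. y \<in> Y1 \<Longrightarrow> y' \<in> Y1 \<Longrightarrow> v \<in> T \<Longrightarrow> (y - y') \<bullet> v = 0"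
          "h * real (card Y) \<le> (5 * M) ^ ?j * real (card Y1)"
        using hb[OF M1(1) Y] by metis
      have orth: "(y - y') \<bullet> v = 0" if "y \<in> Y1" "y' \<in> Y1" "v \<in> span T" for y y' v
        using that(3) by (induction rule: span_induct_alt) (use Y1(2) that in \<open>auto simp: inner_add_right\<close>)
      have s': "s \<in> \<Lambda>" "s \<in> span (insert t T)" using s by (auto simp: S_def)
      have sd: "(y - y') \<bullet> s = (s \<bullet> e) * ((y - y') \<bullet> e)" if "y \<in> Y1" "y' \<in> Y1" for y y'
        using orth[OF that dec[OF s'(2)]] by (simp add: inner_diff_right inner_diff_left)
      have iy: "real_of_int \<lfloor>y \<bullet> s\<rfloor> = y \<bullet> s" if "y \<in> Y1" for y
        using int[of s y] that Y1(1) Y(2) s' by (auto simp: in_mono elim!: Ints_cases)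
      \<comment> \<open>On \<open>Y1\<close> the integer \<open>y \<bullet> s\<close> stays in an
        interval of length \<open>4 * M * \<eta>\<close>, since differences are orthogonal to
        \<open>span T\<close> and \<open>s\<close> has the minimal height;
        \<open>1 \<le> M * \<eta>\<close> absorbs the extra value. Equal integers make the
        difference orthogonal to \<open>e\<close> as well.\<close>
      have "\<exists>Y2\<subseteq>Y1. (\<forall>y\<in>Y2. \<forall>y'\<in>Y2. \<lfloor>y \<bullet> s\<rfloor> = \<lfloor>y' \<bullet> s\<rfloor>) \<and> real (card Y1) \<le> (5 * M * \<eta>) * real (card Y2)"
      proof (cases "Y1 = {}")
        case False
        then obtain y0 where y0: "y0 \<in> Y1" by blast
        show ?thesis
        proof (rule pigeonhole_int[where a = "y0 \<bullet> s - 2 * M * \<eta>" and b = "y0 \<bullet> s + 2 * M * \<eta>"])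
          show "finite Y1" using Y Y1 finite_subset by blast
          fix y assume y: "y \<in> Y1"
          have n: "norm (y - y0) \<le> 2 * M" using y y0 Y1(1) Y(2) norm_triangle_ineq4[of y y0] 
            by (smt (verit) IntD2 mem_cball_0 subsetD)
          have "\<bar>(y - y0) \<bullet> s\<bar> = \<eta> * \<bar>(y - y0) \<bullet> e\<bar>" by (simp add: sd[OF y y0] s(2) abs_mult)
          also have "\<dots> \<le> \<eta> * (2 * M)"
            using Cauchy_Schwarz_ineq2[of "y - y0" e] e1 n \<eta>0 by (intro mult_left_mono) auto
          finally show "y0 \<bullet> s - 2 * M * \<eta> \<le> real_of_int \<lfloor>y \<bullet> s\<rfloor> \<and> real_of_int \<lfloor>y \<bullet> s\<rfloor> \<le> y0 \<bullet> s + 2 * M * \<eta>"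
            unfolding iy[OF y] by (auto simp: inner_diff_left abs_le_iff algebra_simps)
        qed (use M1 in auto)
      qed auto
      then obtain Y2 where Y2: "Y2 \<subseteq> Y1" "\<And>y y'. y \<in> Y2 \<Longrightarrow> y' \<in> Y2 \<Longrightarrow> \<lfloor>y \<bullet> s\<rfloor> = \<lfloor>y' \<bullet> s\<rfloor>"
         "real (card Y1) \<le> (5 * M * \<eta>) * real (card Y2)" by blast
      show "\<exists>Y'\<subseteq>Y. (\<forall>y\<in>Y'. \<forall>y'\<in>Y'. \<forall>v\<in>insert t T. (y - y') \<bullet> v = 0) \<and>
          ?h * real (card Y) \<le> (5 * M) ^ card (insert t T) * real (card Y')"
      proof (intro exI[of _ Y2] conjI ballI)
        show "Y2 \<subseteq> Y" using Y2 Y1 by blast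
        have "h * real (card Y) \<le> (5 * M) ^ ?j * ((5 * M * \<eta>) * real (card Y2))"
          by (rule order_trans[OF Y1(3)]) (use Y2(3) M1 in \<open>intro mult_left_mono, auto\<close>)
        then show "?h * real (card Y) \<le> (5 * M) ^ card (insert t T) * real (card Y2)"
          unfolding cT using \<eta>0 by (simp add: field_simps)
        fix y y' v assume yy: "y \<in> Y2" "y' \<in> Y2" and v: "v \<in> insert t T"
        have yy1: "y \<in> Y1" "y' \<in> Y1" using yy Y2 by auto
        have "(y - y') \<bullet> s = 0" using Y2(2)[OF yy] iy yy1 by (metis inner_diff_left right_minus_eq)
        then have "(y - y') \<bullet> e = 0" using sd[OF yy1] \<eta>0 s(2) by auto
        moreover have "v \<in> span (insert t T)" using v by (simp add: span_base)
        ultimately show "(y - y') \<bullet> v = 0"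
          using orth[OF yy1 dec, of v] by (simp add: inner_diff_right)
      qed
    qed
  qed
qed

text \<open>The floors of \<open>n b * (y \<bullet> b)\<close> are equalised one direction at a
  time. Each takes at most \<open>2 * n b * M + 2\<close> values, which
  \<open>1 \<le> n b * M\<close> turns into the factor \<open>4 * n b * M\<close>. This serves the
  dual side of the transference and the density of a stretched lattice.\<close>

lemma cluster_directions:
  fixes Y :: "'a::euclidean_space set"
  assumes "finite D" "\<And>b. b \<in> D \<Longrightarrow> norm b = 1" "finite Y" "Y \<subseteq> cball 0 M" "0 < M"
    "\<And>b. b \<in> D \<Longrightarrow> 1 \<le> n b * M"
  shows "\<exists>Y'\<subseteq>Y. (\<forall>y\<in>Y'. \<forall>y'\<in>Y'. \<forall>b\<in>D. \<bar>(y - y') \<bullet> b\<bar> \<le> 1 / n b) \<and>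
     real (card Y) \<le> (\<Prod>b\<in>D. 4 * n b * M) * real (card Y')"
  using assms(1,2,6)
proof (induction D rule: finite_induct)
  case empty
  then show ?case by auto
next
  case (insert b D)
  then obtain Y1 where Y1: "Y1 \<subseteq> Y" "\<And>y y' b. y \<in> Y1 \<Longrightarrow> y' \<in> Y1 \<Longrightarrow> b \<in> D \<Longrightarrow> \<bar>(y - y') \<bullet> b\<bar> \<le> 1 / n b"
     "real (card Y) \<le> (\<Prod>b\<in>D. 4 * n b * M) * real (card Y1)"
    by (metis insertI2)
  have b: "norm b = 1" using insert by simp
  have nM: "1 \<le> n b * M" using insert.prems by simp
  have n0: "0 < n b" using nM assms(5) by (metis less_le_trans zero_less_mult_pos2 zero_less_one)
  have "\<exists>Y2\<subseteq>Y1. (\<forall>y\<in>Y2. \<forall>y'\<in>Y2. \<lfloor>n b * (y \<bullet> b)\<rfloor> = \<lfloor>n b * (y' \<bullet> b)\<rfloor>) \<and> real (card Y1) \<le> (4 * (n b * M)) * real (card Y2)"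
  proof (rule pigeonhole_int[where a = "- (n b * M) - 1" and b = "n b * M"])
    show "finite Y1" using assms Y1 finite_subset by blast
    fix y assume "y \<in> Y1"
    then have "norm y \<le> M" using Y1(1) assms(4) by auto
    then have "\<bar>y \<bullet> b\<bar> \<le> M" using Cauchy_Schwarz_ineq2[of y b] b by simp
    then have "\<bar>n b * (y \<bullet> b)\<bar> \<le> n b * M" using n0 by (simp add: abs_mult)
    then show "- (n b * M) - 1 \<le> real_of_int \<lfloor>n b * (y \<bullet> b)\<rfloor> \<and> real_of_int \<lfloor>n b * (y \<bullet> b)\<rfloor> \<le> n b * M"
      by linarith
  qed (use nM in linarith)+
  then obtain Y2 where Y2: "Y2 \<subseteq> Y1" "\<And>y y'. y \<in> Y2 \<Longrightarrow> y' \<in> Y2 \<Longrightarrow> \<lfloor>n b * (y \<bullet> b)\<rfloor> = \<lfloor>n b * (y' \<bullet> b)\<rfloor>"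
     "real (card Y1) \<le> (4 * n b * M) * real (card Y2)" by (metis mult.assoc)
  show ?case
  proof (intro exI[of _ Y2] conjI ballI)
    show "Y2 \<subseteq> Y" using Y1 Y2 by blast
    have "0 \<le> 4 * n b' * M" if "b' \<in> D" for b'
      using insert.prems(2)[of b'] that by (simp add: mult.assoc)
    then have "real (card Y) \<le> (\<Prod>b\<in>D. 4 * n b * M) * ((4 * n b * M) * real (card Y2))"
      by (intro order_trans[OF Y1(3)] mult_left_mono[OF Y2(3)] prod_nonneg) auto
    then show "real (card Y) \<le> (\<Prod>b\<in>insert b D. 4 * n b * M) * real (card Y2)"
      using insert.hyps by (simp add: algebra_simps)
    fix y y' b' assume yy: "y \<in> Y2" "y' \<in> Y2" "b' \<in> insert b D"
    have "\<bar>n b * (y \<bullet> b) - n b * (y' \<bullet> b)\<bar> < 1" using Y2(2)[OF yy(1,2)] by linarith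
    then have "n b * \<bar>(y - y') \<bullet> b\<bar> < 1" using n0
      by (simp add: inner_diff_left abs_mult flip: right_diff_distrib)
    then have "\<bar>(y - y') \<bullet> b\<bar> \<le> 1 / n b" using n0 by (simp add: field_simps)
    then show "\<bar>(y - y') \<bullet> b'\<bar> \<le> 1 / n b'" using yy Y1(2) Y2(1) by blast
  qed
qed

text \<open>\<open>\<kappa>\<close> stands for the density of \<open>\<Gamma>\<close>. The points of
  \<open>\<Gamma>\<close> in a large ball of radius \<open>M\<close> are clustered first along the
  span of the lattice points in the unit ball, by \<open>flag_heights\<close>, then along its
  orthogonal complement. The powers of \<open>M\<close> lost add up to \<open>M ^ d\<close> and
  cancel against the density; subtracting one point of the cluster gives dual points in the unit
  ball. The unknown \<open>h\<close> bounds the primal count and is bounded by the dual count, so it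
  drops out.\<close>

lemma transference:
  fixes \<Lambda> \<Gamma> :: "'a::euclidean_space set"
  defines "d \<equiv> DIM('a)"
  assumes diff: "\<And>x y. x \<in> \<Lambda> \<Longrightarrow> y \<in> \<Lambda> \<Longrightarrow> x - y \<in> \<Lambda>" "\<And>x y. x \<in> \<Gamma> \<Longrightarrow> y \<in> \<Gamma> \<Longrightarrow> x - y \<in> \<Gamma>"
    and fin: "\<And>\<rho>. finite (\<Lambda> \<inter> cball 0 \<rho>)" "\<And>\<rho>. finite (\<Gamma> \<inter> cball 0 \<rho>)"
    and int: "\<And>x y. x \<in> \<Lambda> \<Longrightarrow> y \<in> \<Gamma> \<Longrightarrow> y \<bullet> x \<in> \<int>"
    and dens: "\<And>M. M \<ge> M1 \<Longrightarrow> \<kappa> * M ^ d \<le> real (card (\<Gamma> \<inter> cball 0 M))" and \<kappa>: "\<kappa> > 0"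
  shows "\<kappa> * real (card (\<Lambda> \<inter> cball 0 1)) \<le> (4 * 2 ^ d) ^ d * (5 * real d) ^ d * real (card (\<Gamma> \<inter> cball 0 1))"
proof -
  have d1: "1 \<le> real d" using DIM_positive[where 'a='a] by (simp add: d_def)
  obtain T where T: "T \<subseteq> \<Lambda> \<inter> cball 0 1" "independent T" "\<Lambda> \<inter> cball 0 1 \<subseteq> span T"
    by (metis maximal_independent_subset)
  have fT: "finite T" using T fin finite_subset by blast
  let ?j = "card T"
  have jd: "?j \<le> d" unfolding d_def using independent_bound[OF T(2)] by simp
  obtain h M0 where h: "h > 0"
    and ha: "real (card (\<Lambda> \<inter> span T \<inter> cball 0 1)) \<le> (4 * 1 * 2 ^ ?j) ^ ?j * h"
    and M0: "M0 \<ge> 1"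
    and hb: "\<And>M Y. M \<ge> M0 \<Longrightarrow> finite Y \<Longrightarrow> Y \<subseteq> \<Gamma> \<inter> cball 0 M \<Longrightarrow>
        (\<exists>Y'\<subseteq>Y. (\<forall>y\<in>Y'. \<forall>y'\<in>Y'. \<forall>v\<in>T. (y - y') \<bullet> v = 0) \<and>
          h * real (card Y) \<le> (5 * M) ^ ?j * real (card Y'))"
    using flag_heights[of \<Lambda> \<Gamma>, OF diff(1) fin(1) int fT T(2,1) order_refl] by metis
  define M where "M = max M0 M1"
  have M: "M \<ge> M0" "M \<ge> M1" "M \<ge> 1" using M0 by (auto simp: M_def)
  let ?Y = "\<Gamma> \<inter> cball 0 M"
  obtain Y1 where Y1: "Y1 \<subseteq> ?Y" "\<And>y y' v. y \<in> Y1 \<Longrightarrow> y' \<in> Y1 \<Longrightarrow> v \<in> T \<Longrightarrow> (y - y') \<bullet> v = 0"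
      "h * real (card ?Y) \<le> (5 * M) ^ ?j * real (card Y1)"
    using hb[OF M(1) fin(2) order_refl] by metis
  \<comment> \<open>Differences of points of \<open>Y1\<close> lie in \<open>W\<close>, so only its
    \<open>d - card T\<close> directions remain to be controlled.\<close>
  define W where "W = {y. \<forall>v\<in>T. orthogonal v y}"
  have sW: "subspace W" unfolding W_def by (rule subspace_orthogonal_to_vectors)
  have dW: "dim W + ?j = d"
  proof -
    have "W = {y \<in> UNIV. \<forall>x\<in>span T. orthogonal x y}"
      using orthogonal_to_span[of _ T] by (auto simp: W_def span_base) (metis orthogonal_commute)
    then show ?thesis
      using dim_subspace_orthogonal_to_vectors[of "span T" UNIV] dim_eq_card_independent[OF T(2)]
      by (simp add: d_def)
  qed
  obtain D where D: "D \<subseteq> W" "pairwise orthogonal D" "\<And>x. x \<in> D \<Longrightarrow> norm x = 1"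
     "independent D" "card D = dim W" "span D = W"
    by (rule orthonormal_basis_subspace[OF sW]) blast
  have fD: "finite D" using D(4) independent_imp_finite by blast
  have fY1: "finite Y1" using Y1(1) fin finite_subset by blast
  have "Y1 \<subseteq> cball 0 M" using Y1 by blast
  \<comment> \<open>Side \<open>1 / d\<close> in at most \<open>d\<close> orthonormal directions
    gives norm at most 1.\<close>
  from cluster_directions[OF fD D(3) fY1 this, of "\<lambda>_. real d"] M(3) mult_mono[OF d1 M(3)]
  obtain Y2 where Y2: "Y2 \<subseteq> Y1" "\<And>y y' b. y \<in> Y2 \<Longrightarrow> y' \<in> Y2 \<Longrightarrow> b \<in> D \<Longrightarrow> \<bar>(y - y') \<bullet> b\<bar> \<le> 1 / real d"
    "real (card Y1) \<le> (4 * real d * M) ^ card D * real (card Y2)" by (auto simp: less_le_trans[OF zero_less_one])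
  have "card Y2 \<le> card (\<Gamma> \<inter> cball 0 1)"
  proof (cases "Y2 = {}")
    case False
    then obtain y0 where y0: "y0 \<in> Y2" by blast
    have "(\<lambda>y. y - y0) ` Y2 \<subseteq> \<Gamma> \<inter> cball 0 1"
    proof
      fix x assume "x \<in> (\<lambda>y. y - y0) ` Y2"
      then obtain y where y: "y \<in> Y2" "x = y - y0" by blast
      have "x \<in> W" unfolding W_def using Y1(2)[of y y0] y y0 Y2(1)
        by (auto simp: orthogonal_def inner_commute)
      then have "x \<in> span D" using D(6) by simp
      from orthonormal_basis_expand[OF D(2,3) this fD]
      have "x = (\<Sum>b\<in>D. (b \<bullet> x) *\<^sub>R b)" by (simp add: inner_commute)
      then have "norm x \<le> (\<Sum>b\<in>D. \<bar>b \<bullet> x\<bar>)"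
        using sum_norm_le[of D "\<lambda>b. (b \<bullet> x) *\<^sub>R b" "\<lambda>b. \<bar>b \<bullet> x\<bar>"] D(3) by simp
      also have "\<dots> \<le> (\<Sum>b\<in>D. 1 / real d)"
        using Y2(2)[OF y(1) y0] y(2) by (intro sum_mono) (simp add: inner_commute)
      also have "\<dots> \<le> 1" using d1 dW D(5) by simp
      finally have "norm x \<le> 1" .
      moreover have "y \<in> \<Gamma>" "y0 \<in> \<Gamma>" using y(1) y0 Y2(1) Y1(1) by blast+
      ultimately show "x \<in> \<Gamma> \<inter> cball 0 1" using y(2) diff(2) by simp
    qed
    moreover have "inj_on (\<lambda>y. y - y0) Y2" by (auto simp: inj_on_def)
    ultimately show ?thesis by (metis card_image card_mono fin(2))
  qed simp
  note c2 = this
  have MM: "5 * M \<le> 5 * real d * M" "4 * real d * M \<le> 5 * real d * M" using M(3) d1 by auto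
  have "h * (\<kappa> * M ^ d) \<le> h * real (card ?Y)" using dens[OF M(2)] h by simp
  also have "\<dots> \<le> (5 * M) ^ ?j * ((4 * real d * M) ^ card D * real (card (\<Gamma> \<inter> cball 0 1)))"
    by (rule order_trans[OF Y1(3)], intro mult_left_mono order_trans[OF Y2(3)])
       (use c2 M(3) in auto)
  also have "\<dots> \<le> (5 * real d * M) ^ ?j * ((5 * real d * M) ^ card D * real (card (\<Gamma> \<inter> cball 0 1)))"
    by (intro mult_mono power_mono order_refl) (use MM M(3) d1 in auto)
  also have "\<dots> = (5 * real d * M) ^ d * real (card (\<Gamma> \<inter> cball 0 1))"
    using dW D(5) by (simp add: add.commute flip: power_add mult.assoc)
  finally have hk: "h * \<kappa> \<le> (5 * real d) ^ d * real (card (\<Gamma> \<inter> cball 0 1))"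
    using M(3) by (simp add: power_mult_distrib mult.commute mult.left_commute)
  have "real (card (\<Lambda> \<inter> cball 0 1)) \<le> (4 * 2 ^ ?j) ^ ?j * h"
  proof -
    have "\<Lambda> \<inter> span T \<inter> cball 0 1 = \<Lambda> \<inter> cball 0 1" using T(3) by blast
    then show ?thesis using ha by (simp only:) simp
  qed
  also have "\<dots> \<le> (4 * 2 ^ d) ^ d * h"
  proof -
    have "(4 * 2 ^ ?j) ^ ?j \<le> (4 * 2 ^ d :: real) ^ ?j" using jd by (intro power_mono) auto
    also have "\<dots> \<le> (4 * 2 ^ d) ^ d"
    proof (rule power_increasing[OF jd])
      have "(1::real) \<le> 2 ^ d" by (rule one_le_power) simp
      then show "1 \<le> 4 * (2::real) ^ d" by linarith
    qed
    finally show ?thesis using h by simp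
  qed
  finally have "\<kappa> * real (card (\<Lambda> \<inter> cball 0 1)) \<le> (4 * 2 ^ d) ^ d * (h * \<kappa>)"
    using \<kappa> by (simp add: mult.commute mult.left_commute)
  also have "\<dots> \<le> (4 * 2 ^ d) ^ d * ((5 * real d) ^ d * real (card (\<Gamma> \<inter> cball 0 1)))"
    by (intro mult_left_mono hk) auto
  finally show ?thesis by (simp add: mult.assoc)
qed

text \<open>For a unit vector \<open>u\<close>, the inequality
  \<open>norm (stretch u a b x) \<le> 1\<close> describes an ellipsoid of width of order
  \<open>1 / a\<close> across \<open>u\<close> and \<open>1 / b\<close> along \<open>u\<close>; it
  plays the role of a box. Stretching the lattice turns it into the unit ball, the body for which
  \<open>transference\<close> is stated.\<close>

definition stretch :: "'a::real_inner \<Rightarrow> real \<Rightarrow> real \<Rightarrow> 'a \<Rightarrow> 'a" where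
  "stretch u a b x = a *\<^sub>R orth_proj u x + (b * (x \<bullet> u)) *\<^sub>R u"

lemma linear_orth_proj: "linear (orth_proj u)"
  by (rule linearI) (auto simp: orth_proj_def algebra_simps)

lemma linear_stretch: "linear (stretch u a b)"
  by (rule linearI) (auto simp: stretch_def orth_proj_def algebra_simps)

lemma orth_proj_orth: "norm u = 1 \<Longrightarrow> orth_proj u x \<bullet> u = 0"
  by (simp add: orth_proj_def inner_diff_left dot_square_norm)

lemma orth_proj_decomp: "x = orth_proj u x + (x \<bullet> u) *\<^sub>R u"
  by (simp add: orth_proj_def)

lemma norm_orth_proj_le:
  assumes "norm u = 1"
  shows "norm (orth_proj u x) \<le> norm x"
proof -
  have "(norm x)\<^sup>2 = (norm (orth_proj u x))\<^sup>2 + (norm ((x \<bullet> u) *\<^sub>R u))\<^sup>2"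
    using norm_add_Pythagorean[of "orth_proj u x" "(x \<bullet> u) *\<^sub>R u"] orth_proj_orth[OF assms, of x]
    by (simp add: orthogonal_def flip: orth_proj_decomp)
  then have "(norm (orth_proj u x))\<^sup>2 \<le> (norm x)\<^sup>2" by simp
  then show ?thesis by (rule power2_le_imp_le) simp
qed

lemma norm_stretch_ge:
  assumes "norm u = 1" "0 < a" "0 < b"
  shows "a * norm (orth_proj u x) \<le> norm (stretch u a b x)" "b * \<bar>x \<bullet> u\<bar> \<le> norm (stretch u a b x)"
proof -
  have "(norm (stretch u a b x))\<^sup>2 = (a * norm (orth_proj u x))\<^sup>2 + (b * \<bar>x \<bullet> u\<bar>)\<^sup>2"
    using norm_add_Pythagorean[of "a *\<^sub>R orth_proj u x" "(b * (x \<bullet> u)) *\<^sub>R u"] orth_proj_orth[OF assms(1), of x] assms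
    by (simp add: orthogonal_def stretch_def power_mult_distrib)
  then have "(a * norm (orth_proj u x))\<^sup>2 \<le> (norm (stretch u a b x))\<^sup>2"
     "(b * \<bar>x \<bullet> u\<bar>)\<^sup>2 \<le> (norm (stretch u a b x))\<^sup>2" by simp_all
  then show "a * norm (orth_proj u x) \<le> norm (stretch u a b x)" "b * \<bar>x \<bullet> u\<bar> \<le> norm (stretch u a b x)"
    by (auto intro: power2_le_imp_le)
qed

lemma norm_stretch_le:
  assumes "norm u = 1" "0 < a" "0 < b"
  shows "norm (stretch u a b x) \<le> a * norm x + b * \<bar>x \<bullet> u\<bar>"
proof -
  have "norm (stretch u a b x) \<le> norm (a *\<^sub>R orth_proj u x) + norm ((b * (x \<bullet> u)) *\<^sub>R u)"
    unfolding stretch_def by (rule norm_triangle_ineq)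
  also have "\<dots> \<le> a * norm x + b * \<bar>x \<bullet> u\<bar>"
    using norm_orth_proj_le[OF assms(1), of x] assms by (simp add: abs_mult)
  finally show ?thesis .
qed

lemma stretch_inverse:
  assumes "norm u = 1" "a \<noteq> 0" "b \<noteq> 0"
  shows "stretch u (1/a) (1/b) (stretch u a b x) = x"
proof -
  have uu: "u \<bullet> u = 1" using assms by (simp add: dot_square_norm)
  have 1: "stretch u a b x \<bullet> u = b * (x \<bullet> u)"
    by (simp add: stretch_def inner_add_left orth_proj_orth[OF assms(1)] uu)
  have "orth_proj u (stretch u a b x) = a *\<^sub>R orth_proj u x"
    unfolding orth_proj_def[of u "stretch u a b x"] 1 by (simp add: stretch_def)
  then have "stretch u (1/a) (1/b) (stretch u a b x) = orth_proj u x + (x \<bullet> u) *\<^sub>R u"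
    using assms by (simp add: stretch_def[of u "1/a"] 1)
  then show ?thesis by (simp flip: orth_proj_decomp)
qed

text \<open>Stretches with reciprocal factors are inverse transposes of each other, so the stretched
  integer lattices keep integral pairings.\<close>

lemma stretch_dual_inner:
  assumes "norm u = 1" "a \<noteq> 0" "b \<noteq> 0"
  shows "stretch u a b x \<bullet> stretch u (1/a) (1/b) y = x \<bullet> y"
proof -
  have uu: "u \<bullet> u = 1" using assms by (simp add: dot_square_norm)
  have o: "u \<bullet> orth_proj u z = 0" for z using orth_proj_orth[OF assms(1), of z] by (simp add: inner_commute)
  have "x \<bullet> y = (orth_proj u x + (x \<bullet> u) *\<^sub>R u) \<bullet> (orth_proj u y + (y \<bullet> u) *\<^sub>R u)"
    by (simp flip: orth_proj_decomp)
  also have "\<dots> = orth_proj u x \<bullet> orth_proj u y + (x \<bullet> u) * (y \<bullet> u)"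
    by (simp add: inner_add_left inner_add_right orth_proj_orth[OF assms(1)] o uu)
  finally show ?thesis using assms
    by (simp add: stretch_def inner_add_left inner_add_right orth_proj_orth[OF assms(1)] o uu)
qed

section \<open>Points of the integer lattice and density of its stretched copies\<close>

lemma card_lattice_box:
  fixes S :: "'n::finite \<Rightarrow> int set"
  assumes "\<And>i. finite (S i)"
  shows "finite {k::real^'n. \<forall>i. k $ i \<in> real_of_int ` S i}"
    and "card {k::real^'n. \<forall>i. k $ i \<in> real_of_int ` S i} \<le> (\<Prod>i\<in>UNIV. card (S i))"
proof -
  let ?f = "\<lambda>f. (\<chi> i. real_of_int (f i)) :: real^'n"
  have eq: "{k::real^'n. \<forall>i. k $ i \<in> real_of_int ` S i} \<subseteq> ?f ` PiE UNIV S"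
  proof
    fix k :: "real^'n" assume "k \<in> {k. \<forall>i. k $ i \<in> real_of_int ` S i}"
    then have "\<forall>i. \<exists>z. z \<in> S i \<and> k $ i = real_of_int z" by auto
    then obtain f where "\<And>i. f i \<in> S i \<and> k $ i = real_of_int (f i)" by metis
    then show "k \<in> ?f ` PiE UNIV S" by (intro image_eqI[of _ _ f]) (auto simp: vec_eq_iff)
  qed
  have fin: "finite (PiE UNIV S)" using assms by (intro finite_PiE) auto
  then show "finite {k::real^'n. \<forall>i. k $ i \<in> real_of_int ` S i}"
    using eq finite_surj by blast
  have "card {k::real^'n. \<forall>i. k $ i \<in> real_of_int ` S i} \<le> card (PiE UNIV S)"
    by (rule surj_card_le[OF fin eq])
  then show "card {k::real^'n. \<forall>i. k $ i \<in> real_of_int ` S i} \<le> (\<Prod>i\<in>UNIV. card (S i))"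
    by (simp add: card_PiE)
qed

lemma integer_lattice_diff: "x \<in> integer_lattice \<Longrightarrow> y \<in> integer_lattice \<Longrightarrow> x - y \<in> integer_lattice"
  by (auto simp: integer_lattice_def)

lemma integer_lattice_inner: "x \<in> integer_lattice \<Longrightarrow> y \<in> integer_lattice \<Longrightarrow> x \<bullet> y \<in> \<int>"
  by (auto simp: integer_lattice_def inner_vec_def intro: Ints_sum Ints_mult)

lemma finite_integer_lattice_bounded: "finite {k\<in>integer_lattice. norm (k::real^'n) \<le> \<rho>}"
proof (rule finite_subset)
  show "finite {k::real^'n. \<forall>i. k $ i \<in> real_of_int ` {-\<lceil>\<rho>\<rceil>..\<lceil>\<rho>\<rceil>}}"
    by (rule card_lattice_box) simp
  show "{k\<in>integer_lattice. norm k \<le> \<rho>} \<subseteq> {k::real^'n. \<forall>i. k $ i \<in> real_of_int ` {-\<lceil>\<rho>\<rceil>..\<lceil>\<rho>\<rceil>}}"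
  proof (intro subsetI CollectI allI)
    fix k :: "real^'n" and i assume k: "k \<in> {k\<in>integer_lattice. norm k \<le> \<rho>}"
    then obtain z where z: "k $ i = real_of_int z" by (auto simp: integer_lattice_def elim!: Ints_cases)
    have "\<bar>k $ i\<bar> \<le> \<rho>" using k component_le_norm_cart[of k i] by auto
    then have "z \<in> {-\<lceil>\<rho>\<rceil>..\<lceil>\<rho>\<rceil>}" unfolding z by (simp; linarith)
    then show "k $ i \<in> real_of_int ` {-\<lceil>\<rho>\<rceil>..\<lceil>\<rho>\<rceil>}" using z by blast
  qed
qed

lemma finite_stretch_lattice:
  fixes u :: "real^'n"
  assumes "norm u = 1" "0 < a" "0 < b"
  shows "finite (stretch u a b ` integer_lattice \<inter> cball 0 \<rho>)"
proof (rule finite_subset)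
  show "finite (stretch u a b ` {k\<in>integer_lattice. norm k \<le> (1/a + 1/b) * \<rho>})"
    by (intro finite_imageI finite_integer_lattice_bounded)
  show "stretch u a b ` integer_lattice \<inter> cball 0 \<rho> \<subseteq>
    stretch u a b ` {k\<in>integer_lattice. norm k \<le> (1/a + 1/b) * \<rho>}"
  proof
    fix y assume "y \<in> stretch u a b ` integer_lattice \<inter> cball 0 \<rho>"
    then obtain k where k: "k \<in> integer_lattice" "y = stretch u a b k" "norm y \<le> \<rho>" by auto
    have y: "\<bar>y \<bullet> u\<bar> \<le> norm y" using Cauchy_Schwarz_ineq2[of y u] assms by simp
    have "norm k \<le> 1/a * norm y + 1/b * \<bar>y \<bullet> u\<bar>"
      using norm_stretch_le[of u "1/a" "1/b" y] stretch_inverse[of u a b k] assms k by simp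
    also have "\<dots> \<le> 1/a * \<rho> + 1/b * \<rho>"
      using assms k y by (intro add_mono mult_left_mono) auto
    finally show "y \<in> stretch u a b ` {k\<in>integer_lattice. norm k \<le> (1/a + 1/b) * \<rho>}"
      using k by (auto simp: algebra_simps)
  qed
qed

lemma norm_le_card_mult:
  fixes x :: "real^'n"
  assumes "\<And>i. \<bar>x $ i\<bar> \<le> c"
  shows "norm x \<le> real CARD('n) * c"
proof -
  have "norm x \<le> (\<Sum>i\<in>UNIV. \<bar>x $ i\<bar>)" by (rule norm_le_l1_cart)
  also have "\<dots> \<le> (\<Sum>i\<in>(UNIV::'n set). c)" by (intro sum_mono assms)
  finally show ?thesis by simp
qed

lemma card_lattice_cube:
  "finite {k\<in>integer_lattice. \<forall>i. 0 \<le> k $ i \<and> (k::real^'n) $ i < real N}"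
  "N ^ CARD('n) \<le> card {k\<in>integer_lattice. \<forall>i. 0 \<le> k $ i \<and> (k::real^'n) $ i < real N}"
proof -
  let ?f = "\<lambda>f. (\<chi> i. real (f i)) :: real^'n"
  let ?Y = "{k\<in>integer_lattice. \<forall>i. 0 \<le> k $ i \<and> (k::real^'n) $ i < real N}"
  show fin: "finite ?Y"
  proof (rule finite_subset[OF _ finite_integer_lattice_bounded])
    show "?Y \<subseteq> {k\<in>integer_lattice. norm k \<le> real CARD('n) * real N}"
      by (auto intro!: norm_le_card_mult simp: less_imp_le)
  qed
  have "inj_on ?f (PiE UNIV (\<lambda>_. {..<N}))" by (auto simp: inj_on_def vec_eq_iff)
  then have "N ^ CARD('n) = card (?f ` PiE UNIV (\<lambda>_. {..<N}))"
    by (simp add: card_image card_PiE)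
  also have "\<dots> \<le> card ?Y"
    by (rule card_mono[OF fin]) (auto simp: integer_lattice_def)
  finally show "N ^ CARD('n) \<le> card ?Y" .
qed

text \<open>The factor in front of \<open>M ^ d\<close> is, up to a constant depending on
  \<open>d\<close>, the reciprocal of the determinant \<open>a ^ (d - 1) * b\<close> of the stretch.
  The points of a cube with \<open>N ^ d\<close> lattice points are clustered in the directions of
  an orthonormal basis containing \<open>u\<close>; differences within a cluster are short after
  stretching, and \<open>N\<close> cancels.\<close>

lemma lattice_density:
  fixes u :: "real^'n"
  assumes u: "norm u = 1" and ab: "0 < a" "0 < b"
  defines "d \<equiv> CARD('n)"
  assumes M: "0 < M"
  shows "1 / ((4 * (real d)\<^sup>2) ^ d * a ^ (d - 1) * b) * M ^ d
    \<le> real (card (stretch u a b ` integer_lattice \<inter> cball 0 M))"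
proof -
  let ?A = "stretch u a b" let ?G = "?A ` integer_lattice \<inter> cball 0 M"
  have d1: "real d \<ge> 1" by (simp add: d_def Suc_le_eq)
  define W where "W = {y. \<forall>x\<in>span {u}. orthogonal x y}"
  have sW: "subspace W" unfolding W_def by (rule subspace_orthogonal_to_vectors)
  have u0: "u \<noteq> 0" using u by auto
  have "W = {y \<in> UNIV. \<forall>x\<in>span {u}. orthogonal x y}" by (simp add: W_def)
  then have dW: "dim W + 1 = d"
    using dim_subspace_orthogonal_to_vectors[of "span {u}" UNIV] u0 dim_eq_card_independent[of "{u}"]
    by (simp add: d_def)
  have Wu: "y \<in> W \<longleftrightarrow> y \<bullet> u = 0" for y
    unfolding W_def by (auto simp: orthogonal_def span_singleton inner_commute)
  obtain D where D: "D \<subseteq> W" "pairwise orthogonal D" "\<And>x. x \<in> D \<Longrightarrow> norm x = 1"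
     "independent D" "card D = dim W" "span D = W"
    by (rule orthonormal_basis_subspace[OF sW]) blast
  have fD: "finite D" using D(4) independent_imp_finite by blast
  have uD: "u \<notin> D" using D(1) Wu u by (force simp: dot_square_norm)
  \<comment> \<open>The sides \<open>1 / n e\<close> are \<open>M / (d * b)\<close> along
    \<open>u\<close> and \<open>M / (d * a)\<close> across it; after stretching each coordinate is
    at most \<open>M / d\<close>, so the norm is at most \<open>M\<close>.\<close>
  define n where "n e = real d * (if e = u then b else a) / M" for e
  have n0: "n e > 0" for e using d1 ab M by (simp add: n_def)
  \<comment> \<open>The second term is the value of \<open>1 / n e\<close> for every
    \<open>e\<close> other than \<open>u\<close>; \<open>N\<close> only has to be large enough for
    \<open>cluster_directions\<close>.\<close>
  define N where "N = nat \<lceil>max (1 / n u) (1 / (real d * a / M))\<rceil> + 1"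
  have N1: "real N \<ge> 1 / n e" for e
  proof -
    have "1 / n e \<le> max (1 / n u) (1 / (real d * a / M))" by (auto simp: n_def)
    also have "\<dots> \<le> real N" unfolding N_def by linarith
    finally show ?thesis .
  qed
  have N0: "real N \<ge> 1" by (simp add: N_def)
  define Y where "Y = {k\<in>integer_lattice. \<forall>i. 0 \<le> k $ i \<and> (k::real^'n) $ i < real N}"
  have Y: "finite Y" "N ^ d \<le> card Y" unfolding Y_def d_def by (rule card_lattice_cube)+
  have "Y \<subseteq> cball 0 (real d * real N)"
    by (auto simp: Y_def d_def less_imp_le intro!: norm_le_card_mult)
  moreover have "1 \<le> n e * (real d * real N)" for e
  proof -
    have "1 \<le> n e * real N" using N1[of e] n0[of e] by (simp add: field_simps)
    also have "\<dots> \<le> n e * (real d * real N)" using d1 N0 n0[of e] by (intro mult_left_mono) auto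
    finally show ?thesis .
  qed
  ultimately have "\<exists>Y'\<subseteq>Y. (\<forall>y\<in>Y'. \<forall>y'\<in>Y'. \<forall>b\<in>insert u D. \<bar>(y - y') \<bullet> b\<bar> \<le> 1 / n b) \<and>
     real (card Y) \<le> (\<Prod>b\<in>insert u D. 4 * n b * (real d * real N)) * real (card Y')"
    by (intro cluster_directions) (use fD D(3) u d1 N0 Y in auto)
  then obtain Y' where Y': "Y' \<subseteq> Y"
     "\<And>y y' b. y \<in> Y' \<Longrightarrow> y' \<in> Y' \<Longrightarrow> b \<in> insert u D \<Longrightarrow> \<bar>(y - y') \<bullet> b\<bar> \<le> 1 / n b"
     "real (card Y) \<le> (\<Prod>b\<in>insert u D. 4 * n b * (real d * real N)) * real (card Y')" by metis
  have "card Y' \<le> card ?G"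
  proof (cases "Y' = {}")
    case False
    then obtain y0 where y0: "y0 \<in> Y'" by blast
    have "(\<lambda>y. ?A (y - y0)) ` Y' \<subseteq> ?G"
    proof clarify
      fix y assume y: "y \<in> Y'"
      define x where "x = orth_proj u (y - y0)"
      have xe: "x \<bullet> e = (y - y0) \<bullet> e" if "e \<in> D" for e
        using that D(1) Wu by (auto simp: x_def orth_proj_def inner_diff_left inner_commute[of u])
      have "x \<in> W" by (simp add: Wu x_def orth_proj_orth[OF u])
      then have "x \<in> span D" using D(6) by simp
      from orthonormal_basis_expand[OF D(2,3) this fD]
      have "norm x \<le> (\<Sum>e\<in>D. \<bar>x \<bullet> e\<bar>)"
        using sum_norm_le[of D "\<lambda>e. (x \<bullet> e) *\<^sub>R e" "\<lambda>e. \<bar>x \<bullet> e\<bar>"] D(3) by simp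
      also have "\<dots> \<le> (\<Sum>e\<in>D. M / (real d * a))"
      proof (rule sum_mono)
        fix e assume e: "e \<in> D"
        then have "e \<noteq> u" using uD by auto
        then show "\<bar>x \<bullet> e\<bar> \<le> M / (real d * a)"
          using Y'(2)[OF y y0, of e] e xe[OF e] by (simp add: n_def)
      qed
      also have "\<dots> = real (d - 1) * M / (real d * a)" using dW D(5) by (simp add: d_def)
      finally have "a * norm x \<le> real (d - 1) * M / real d" using ab d1 by (simp add: field_simps)
      moreover have "b * \<bar>(y - y0) \<bullet> u\<bar> \<le> M / real d"
        using Y'(2)[OF y y0, of u] ab d1 by (simp add: n_def field_simps)
      moreover have "norm (?A (y - y0)) \<le> a * norm x + b * \<bar>(y - y0) \<bullet> u\<bar>"
        unfolding stretch_def x_def[symmetric]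
        by (rule order_trans[OF norm_triangle_ineq]) (use ab u in \<open>simp add: abs_mult\<close>)
      moreover have "real (d - 1) * M / real d + M / real d = M"
        using d1 by (simp add: field_simps of_nat_diff)
      ultimately have "norm (?A (y - y0)) \<le> M" by linarith
      moreover have "y - y0 \<in> integer_lattice"
        using y y0 Y'(1) integer_lattice_diff by (auto simp: Y_def)
      ultimately show "?A (y - y0) \<in> ?G" by simp
    qed
    moreover have "inj_on (\<lambda>y. ?A (y - y0)) Y'"
    proof (rule inj_onI)
      fix y y' assume "?A (y - y0) = ?A (y' - y0)"
      then have "y - y0 = y' - y0" using stretch_inverse[OF u, of a b] ab by (metis less_irrefl)
      then show "y = y'" by simp
    qed
    ultimately show ?thesis by (metis card_image card_mono finite_stretch_lattice[OF u ab])
  qed simp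
  have "real N ^ d \<le> real (card Y)" using Y(2) by (metis of_nat_le_iff of_nat_power)
  also have "\<dots> \<le> (\<Prod>b\<in>insert u D. 4 * n b * (real d * real N)) * real (card ?G)"
    by (rule order_trans[OF Y'(3)], intro mult_left_mono prod_nonneg)
       (use \<open>card Y' \<le> card ?G\<close> n0 d1 in \<open>auto simp: less_imp_le\<close>)
  also have "(\<Prod>b\<in>insert u D. 4 * n b * (real d * real N)) =
      (4 * (real d)\<^sup>2 * real N / M * b) * (\<Prod>e\<in>D. 4 * (real d)\<^sup>2 * real N / M * a)"
  proof -
    have "(\<Prod>e\<in>D. 4 * n e * (real d * real N)) = (\<Prod>e\<in>D. 4 * (real d)\<^sup>2 * real N / M * a)"
      by (rule prod.cong) (use uD in \<open>auto simp: n_def power2_eq_square\<close>)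
    then show ?thesis using fD uD by (simp add: n_def power2_eq_square)
  qed
  also have "\<dots> = (4 * (real d)\<^sup>2 * real N / M) ^ Suc (d - 1) * (a ^ (d - 1) * b)"
  proof -
    have "card D = d - 1" using dW D(5) by simp
    then show ?thesis by (simp only: prod_constant power_mult_distrib power_Suc) (simp only: mult_ac)
  qed
  also have "Suc (d - 1) = d" using d1 by simp
  also have "(4 * (real d)\<^sup>2 * real N / M) ^ d = real N ^ d * (4 * (real d)\<^sup>2) ^ d / M ^ d"
    by (simp add: power_mult_distrib power_divide)
  finally have "real N ^ d * 1 \<le> real N ^ d * ((4 * (real d)\<^sup>2) ^ d / M ^ d * (a ^ (d - 1) * b) * real (card ?G))"
    by (simp only: mult_1_right mult.assoc times_divide_eq_right times_divide_eq_left)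
  then have "1 \<le> (4 * (real d)\<^sup>2) ^ d / M ^ d * (a ^ (d - 1) * b) * real (card ?G)"
    using N0 by (subst (asm) mult_le_cancel_left_pos) auto
  then show ?thesis using ab d1 M by (simp add: field_simps)
qed

section \<open>Cells on the sphere of normals\<close>

text \<open>The label consists of an index of a coordinate of size at least \<open>1 / d\<close> (it
  exists for unit vectors), its sign, and the other coordinates rounded. Slot \<open>j\<close> holds
  the default 0, so a label has only \<open>d - 1\<close> free integers, the dimension of the
  sphere.\<close>

definition sphere_cell :: "real \<Rightarrow> real^'n \<Rightarrow> 'n \<times> bool \<times> ('n \<Rightarrow> int)" where
  "sphere_cell s v = (let j = SOME j. 1 \<le> real CARD('n) * \<bar>v $ j\<bar>
     in (j, 0 \<le> v $ j, \<lambda>i. if i = j then 0 else \<lfloor>v $ i / s\<rfloor>))"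

lemma unit_vector_large_component:
  fixes v :: "real^'n"
  assumes "norm v = 1"
  shows "\<exists>j. 1 \<le> real CARD('n) * \<bar>v $ j\<bar>"
proof (rule ccontr)
  assume "\<not> ?thesis"
  then have "\<bar>v $ j\<bar> < 1 / real CARD('n)" for j
    by (simp add: not_le field_simps)
  then have "(\<Sum>i\<in>UNIV. \<bar>v $ i\<bar>) < (\<Sum>i\<in>(UNIV::'n set). 1 / real CARD('n))"
    by (intro sum_strict_mono) auto
  then show False using norm_le_l1_cart[of v] assms by simp
qed

text \<open>On the part of the sphere where the \<open>j\<close>-th coordinate is large and has a fixed sign,
  that coordinate is a Lipschitz function of the others, so only the others are discretised.\<close>

lemma sphere_cell_diameter:
  fixes v w :: "real^'n"
  assumes "norm v = 1" "norm w = 1" "0 < s" and eq: "sphere_cell s v = sphere_cell s w"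
  shows "norm (v - w) \<le> 2 * (real CARD('n))\<^sup>2 * s"
proof -
  let ?d = "real CARD('n)"
  have d1: "?d \<ge> 1" by (simp add: Suc_le_eq)
  define j where "j = (SOME j. 1 \<le> ?d * \<bar>v $ j\<bar>)"
  have jw: "j = (SOME j. 1 \<le> ?d * \<bar>w $ j\<bar>)"
    using eq by (simp add: sphere_cell_def Let_def j_def)
  have jv: "1 \<le> ?d * \<bar>v $ j\<bar>"
    unfolding j_def by (rule someI_ex[OF unit_vector_large_component[OF assms(1)]])
  have jw': "1 \<le> ?d * \<bar>w $ j\<bar>"
    unfolding jw by (rule someI_ex[OF unit_vector_large_component[OF assms(2)]])
  have sg: "0 \<le> v $ j \<longleftrightarrow> 0 \<le> w $ j"
    and fl: "(\<lambda>i. if i = j then 0 else \<lfloor>v $ i / s\<rfloor>) = (\<lambda>i. if i = j then 0 else \<lfloor>w $ i / s\<rfloor>)"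
    using eq by (simp_all add: sphere_cell_def Let_def j_def[symmetric] jw[symmetric])
  have ne: "\<bar>v $ i - w $ i\<bar> \<le> s" if "i \<noteq> j" for i
  proof -
    have "\<lfloor>v $ i / s\<rfloor> = \<lfloor>w $ i / s\<rfloor>" using fun_cong[OF fl, of i] that by simp
    then have "\<bar>v $ i / s - w $ i / s\<bar> < 1" by linarith
    then show ?thesis using assms(3) by (simp add: abs_div flip: diff_divide_distrib)
  qed
  have sq: "(\<Sum>i\<in>UNIV. (v $ i)\<^sup>2) = 1" "(\<Sum>i\<in>UNIV. (w $ i)\<^sup>2) = 1"
    using assms(1,2) by (simp_all add: norm_vec_def L2_set_def)
  have le1: "\<bar>v $ i\<bar> \<le> 1" "\<bar>w $ i\<bar> \<le> 1" for i
    using component_le_norm_cart[of v i] component_le_norm_cart[of w i] assms by auto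
  \<comment> \<open>Both vectors are unit, so a change in the square of the large coordinate is
    compensated by the others, each of which varies by at most \<open>s\<close>.\<close>
  have "(v $ j)\<^sup>2 - (w $ j)\<^sup>2 = (\<Sum>i\<in>UNIV - {j}. (w $ i)\<^sup>2 - (v $ i)\<^sup>2)"
    using sq by (simp add: sum_subtractf sum.remove[of UNIV j])
  also have "\<bar>\<dots>\<bar> \<le> (\<Sum>i\<in>UNIV - {j}. 2 * s)"
  proof (rule order_trans[OF sum_abs sum_mono])
    fix i assume i: "i \<in> UNIV - {j}"
    have "\<bar>(w $ i)\<^sup>2 - (v $ i)\<^sup>2\<bar> = \<bar>v $ i - w $ i\<bar> * \<bar>v $ i + w $ i\<bar>"
      by (simp add: power2_eq_square algebra_simps flip: abs_mult)
    also have "\<dots> \<le> s * 2"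
      using ne[of i] i le1[of i] assms(3) by (intro mult_mono) auto
    finally show "\<bar>(w $ i)\<^sup>2 - (v $ i)\<^sup>2\<bar> \<le> 2 * s" by simp
  qed
  also have "\<dots> \<le> ?d * (2 * s)" using assms(3) by (simp add: card_Diff_subset)
  finally have 1: "\<bar>(v $ j)\<^sup>2 - (w $ j)\<^sup>2\<bar> \<le> ?d * (2 * s)" .
  \<comment> \<open>Equal signs exclude cancellation in the sum, so the difference of squares can be
    divided by it.\<close>
  have "2 \<le> ?d * \<bar>v $ j + w $ j\<bar>"
  proof -
    have "\<bar>v $ j + w $ j\<bar> = \<bar>v $ j\<bar> + \<bar>w $ j\<bar>" using sg by linarith
    then show ?thesis using jv jw' by (simp add: distrib_left)
  qed
  then have "2 * \<bar>v $ j - w $ j\<bar> \<le> ?d * \<bar>v $ j + w $ j\<bar> * \<bar>v $ j - w $ j\<bar>"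
    by (intro mult_right_mono) auto
  also have "\<dots> = ?d * \<bar>(v $ j)\<^sup>2 - (w $ j)\<^sup>2\<bar>"
    by (simp add: power2_eq_square algebra_simps flip: abs_mult)
  also have "\<dots> \<le> ?d * (?d * (2 * s))" using 1 by (intro mult_left_mono) auto
  finally have J: "\<bar>v $ j - w $ j\<bar> \<le> ?d\<^sup>2 * s" by (simp add: power2_eq_square)
  have "norm (v - w) \<le> (\<Sum>i\<in>UNIV. \<bar>(v - w) $ i\<bar>)" by (rule norm_le_l1_cart)
  also have "\<dots> = \<bar>v $ j - w $ j\<bar> + (\<Sum>i\<in>UNIV - {j}. \<bar>v $ i - w $ i\<bar>)"
    by (subst sum.remove[of _ j]) auto
  also have "(\<Sum>i\<in>UNIV - {j}. \<bar>v $ i - w $ i\<bar>) \<le> (\<Sum>i\<in>UNIV - {j}. s)"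
    by (intro sum_mono ne) auto
  also have "(\<Sum>i\<in>UNIV - {j}. s) \<le> ?d * s" using assms(3) by (simp add: card_Diff_subset)
  also have "?d * s \<le> ?d\<^sup>2 * s" using d1 assms(3) by (simp add: power2_eq_square)
  finally show ?thesis using J by simp
qed

text \<open>Each rounded coordinate lies in an interval with at most
  \<open>2 * \<theta> / s + 2\<close> integers, and one of them is pinned to 0, whence the exponent.
  The factors \<open>d\<close> and 2 count the index and the sign.\<close>

lemma card_sphere_cells:
  fixes w :: "real^'n"
  assumes "0 \<le> \<theta>" "0 < s"
  shows "finite (sphere_cell s ` {v. norm (v - w) \<le> \<theta>})"
    and "real (card (sphere_cell s ` {v. norm (v - w) \<le> \<theta>}))
      \<le> 2 * real CARD('n) * (2 * \<theta> / s + 2) ^ (CARD('n) - 1)"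
proof -
  define J where "J i = {\<lfloor>(w $ i - \<theta>) / s\<rfloor>..\<lfloor>(w $ i + \<theta>) / s\<rfloor>}" for i
  define S where "S j = PiE UNIV (\<lambda>i. if i = j then {0} else J i)" for j :: 'n
  let ?U = "SIGMA j:UNIV. (UNIV :: bool set) \<times> S j"
  have sub: "sphere_cell s ` {v. norm (v - w) \<le> \<theta>} \<subseteq> ?U"
  proof
    fix q assume "q \<in> sphere_cell s ` {v. norm (v - w) \<le> \<theta>}"
    then obtain v where v: "norm (v - w) \<le> \<theta>" and q: "q = sphere_cell s v" by blast
    obtain j b f where jbf: "q = (j, b, f)" by (cases q)
    then have c: "(j, b, f) = sphere_cell s v" using q by simp
    have f: "f = (\<lambda>i. if i = j then 0 else \<lfloor>v $ i / s\<rfloor>)"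
      using c by (simp add: sphere_cell_def Let_def)
    have "\<lfloor>v $ i / s\<rfloor> \<in> J i" for i
    proof -
      have "\<bar>v $ i - w $ i\<bar> \<le> \<theta>" using component_le_norm_cart[of "v - w" i] v by simp
      then have "(w $ i - \<theta>) / s \<le> v $ i / s" "v $ i / s \<le> (w $ i + \<theta>) / s"
        using assms by (auto intro!: divide_right_mono)
      then show ?thesis by (auto simp: J_def intro: floor_mono)
    qed
    then show "q \<in> ?U" by (auto simp: S_def f jbf)
  qed
  have finS: "finite (S j)" for j unfolding S_def by (intro finite_PiE) (auto simp: J_def)
  then have fin: "finite ?U" by (intro finite_SigmaI finite_cartesian_product) auto
  then show "finite (sphere_cell s ` {v. norm (v - w) \<le> \<theta>})" using sub finite_subset by blast
  have cJ: "real (card (J i)) \<le> 2 * \<theta> / s + 2" for i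
  proof -
    have "(w $ i - \<theta>) / s \<le> (w $ i + \<theta>) / s" using assms by (intro divide_right_mono) auto
    then have "real (card (J i)) = real_of_int (\<lfloor>(w $ i + \<theta>) / s\<rfloor> - \<lfloor>(w $ i - \<theta>) / s\<rfloor> + 1)"
      using floor_mono[of "(w $ i - \<theta>) / s" "(w $ i + \<theta>) / s"] by (simp add: J_def)
    also have "\<dots> \<le> (w $ i + \<theta>) / s - (w $ i - \<theta>) / s + 2" by (simp; linarith)
    also have "\<dots> = 2 * \<theta> / s + 2" by (simp add: add_divide_distrib diff_divide_distrib)
    finally show ?thesis .
  qed
  have "real (card (S j)) \<le> (2 * \<theta> / s + 2) ^ (CARD('n) - 1)" for j
  proof -
    have "real (card (S j)) = (\<Prod>i\<in>UNIV. real (card (if i = j then {0} else J i)))"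
      by (simp add: S_def card_PiE)
    also have "\<dots> = (\<Prod>i\<in>UNIV - {j}. real (card (J i)))"
      by (subst prod.remove[of _ j]) (auto intro: prod.cong)
    also have "\<dots> \<le> (\<Prod>i\<in>UNIV - {j}. 2 * \<theta> / s + 2)"
      by (intro prod_mono) (use cJ in auto)
    finally show ?thesis by (simp add: card_Diff_subset)
  qed
  note cS = this
  have "card (sphere_cell s ` {v. norm (v - w) \<le> \<theta>}) \<le> card ?U" by (rule card_mono[OF fin sub])
  also have "\<dots> = (\<Sum>j\<in>UNIV. 2 * card (S j))"
    using finS by (subst card_SigmaI) (auto simp: card_cartesian_product)
  finally have "real (card (sphere_cell s ` {v. norm (v - w) \<le> \<theta>})) \<le> (\<Sum>j\<in>UNIV. 2 * real (card (S j)))"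
    by (metis (mono_tags, lifting) of_nat_le_iff of_nat_mult of_nat_numeral of_nat_sum sum.cong)
  also have "\<dots> \<le> (\<Sum>j\<in>(UNIV::'n set). 2 * (2 * \<theta> / s + 2) ^ (CARD('n) - 1))"
    by (intro sum_mono mult_left_mono cS) auto
  finally show "real (card (sphere_cell s ` {v. norm (v - w) \<le> \<theta>}))
      \<le> 2 * real CARD('n) * (2 * \<theta> / s + 2) ^ (CARD('n) - 1)" by simp
qed

text \<open>Lattice points are grouped by an index \<open>j\<close> of a coordinate of largest
  absolute value and by that value \<open>m\<close>. A group has O(m^(d-1)) points, each
  contributing at most \<open>(l / m) ^ (d - 1)\<close>; so every group contributes O(l^(d-1))
  whatever \<open>m\<close> is, and there are at most \<open>d * l\<close> groups.\<close>

lemma lattice_power_sum: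
  fixes l :: real
  defines "d \<equiv> CARD('n)"
  assumes l: "0 \<le> l"
  shows "(\<Sum>k\<in>{k::real^'n. k \<in> integer_lattice \<and> k \<noteq> 0 \<and> norm k \<le> l}. (l / norm k) ^ (d - 1))
    \<le> 2 * real d * 3 ^ (d - 1) * l ^ d"
proof -
  let ?S = "{k::real^'n. k \<in> integer_lattice \<and> k \<noteq> 0 \<and> norm k \<le> l}"
  define E where "E = (\<lambda>(j, m). {k::real^'n. \<forall>i. k $ i \<in> real_of_int ` (if i = j then {int m, - int m} else {- int m..int m})})"
  let ?I = "UNIV \<times> {1..nat \<lfloor>l\<rfloor>}"
  have d1: "d \<ge> 1" by (simp add: d_def Suc_le_eq)
  have "\<exists>p\<in>?I. k \<in> E p" if k: "k \<in> ?S" for k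
  proof -
    obtain j where j: "\<And>i. \<bar>k $ i\<bar> \<le> \<bar>k $ j\<bar>"
    proof -
      let ?V = "range (\<lambda>i. \<bar>k $ i\<bar>)"
      have "Max ?V \<in> ?V" by (rule Max_in) auto
      then obtain j where j: "Max ?V = \<bar>k $ j\<bar>" by (rule imageE)
      have le: "\<bar>k $ i\<bar> \<le> Max ?V" for i by (rule Max_ge) auto
      show thesis by (rule that[of j]) (use le j in simp)
    qed
    obtain g where g: "\<And>i. k $ i = real_of_int (g i)"
    proof -
      have "\<forall>i. \<exists>z. k $ i = real_of_int z" using k by (auto simp: integer_lattice_def Ints_def)
      then obtain g where "\<forall>i. k $ i = real_of_int (g i)" by (rule choice[THEN exE])
      then show thesis using that by blast
    qed
    define m where "m = nat \<bar>g j\<bar>"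
    have "k $ j \<noteq> 0"
    proof
      assume "k $ j = 0"
      then have "k = 0" using j by (simp add: vec_eq_iff)
      then show False using k by simp
    qed
    then have m1: "m \<ge> 1" using g[of j] by (simp add: m_def)
    have "real m = \<bar>k $ j\<bar>" by (simp add: m_def g)
    also have "\<dots> \<le> l" using component_le_norm_cart[of k j] k by simp
    finally have "m \<le> nat \<lfloor>l\<rfloor>" by (simp add: le_nat_floor)
    moreover have "k \<in> E (j, m)"
    proof -
      have "g i \<in> {- int m..int m}" for i using j[of i] by (auto simp: g m_def)
      moreover have "g j \<in> {int m, - int m}" by (auto simp: m_def)
      ultimately show ?thesis by (auto simp: E_def g)
    qed
    ultimately show ?thesis using m1 by (intro bexI[of _ "(j, m)"]) auto
  qed
  then have "\<forall>k\<in>?S. \<exists>p. p \<in> ?I \<and> k \<in> E p" by blast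
  then obtain p where "\<forall>k\<in>?S. p k \<in> ?I \<and> k \<in> E (p k)" by (rule bchoice[THEN exE])
  then have p: "\<And>k. k \<in> ?S \<Longrightarrow> p k \<in> ?I \<and> k \<in> E (p k)" by blast
  have finS: "finite ?S"
    by (rule finite_subset[OF _ finite_integer_lattice_bounded[of l]]) auto
  have main: "(\<Sum>k\<in>{k\<in>?S. p k = q}. (l / norm k) ^ (d - 1)) \<le> 2 * 3 ^ (d - 1) * l ^ (d - 1)"
    if q: "q \<in> ?I" for q
  proof -
    obtain j m where jm: "q = (j, m)" "m \<ge> 1" using q by auto
    have cE: "finite (E q)" "card (E q) \<le> (\<Prod>i\<in>UNIV. card (if i = j then {int m, - int m} else {- int m..int m}))"
      unfolding E_def jm prod.case by (rule card_lattice_box; simp)+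
    have "card (E q) \<le> 2 * (2 * m + 1) ^ (d - 1)"
    proof (rule order_trans[OF cE(2)])
      have "(\<Prod>i\<in>UNIV. card (if i = j then {int m, - int m} else {- int m..int m}))
        = 2 * (\<Prod>i\<in>UNIV - {j}. card {- int m..int m})"
        using jm(2) by (subst prod.remove[of _ j]) (auto intro!: prod.cong simp: card_insert_if)
      also have "card {- int m..int m} = 2 * m + 1" by simp
      also have "2 * (\<Prod>i\<in>UNIV - {j}. 2 * m + 1) = 2 * (2 * m + 1) ^ (d - 1)"
        by (simp add: d_def card_Diff_subset)
      finally show "(\<Prod>i\<in>UNIV. card (if i = j then {int m, - int m} else {- int m..int m})) \<le> 2 * (2 * m + 1) ^ (d - 1)" by simp
    qed
    then have "real (card (E q)) \<le> real (2 * (2 * m + 1) ^ (d - 1))" by (rule of_nat_mono)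
    also have "\<dots> = 2 * real (2 * m + 1) ^ (d - 1)" by simp
    also have "\<dots> \<le> 2 * (3 * real m) ^ (d - 1)"
      using jm by (intro mult_left_mono power_mono) auto
    finally have cE2: "real (card (E q)) \<le> 2 * (3 * real m) ^ (d - 1)" .
    have "(\<Sum>k\<in>{k\<in>?S. p k = q}. (l / norm k) ^ (d - 1)) \<le> (\<Sum>k\<in>{k\<in>?S. p k = q}. (l / real m) ^ (d - 1))"
    proof (rule sum_mono)
      fix k assume "k \<in> {k\<in>?S. p k = q}"
      then have "k \<in> E q" using p by auto
      then have "k $ j \<in> real_of_int ` {int m, - int m}" by (auto simp: E_def jm split: if_splits)
      then have "real m \<le> norm k" using component_le_norm_cart[of k j] by auto
      then show "(l / norm k) ^ (d - 1) \<le> (l / real m) ^ (d - 1)"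
        using l jm by (intro power_mono frac_le) auto
    qed
    also have "\<dots> \<le> real (card (E q)) * (l / real m) ^ (d - 1)"
    proof -
      have "card {k\<in>?S. p k = q} \<le> card (E q)" using p by (intro card_mono cE) auto
      then show ?thesis using l by (simp add: mult_right_mono)
    qed
    also have "\<dots> \<le> 2 * (3 * real m) ^ (d - 1) * (l / real m) ^ (d - 1)"
      using l by (intro mult_right_mono cE2) auto
    also have "\<dots> = 2 * 3 ^ (d - 1) * l ^ (d - 1)"
      using jm by (simp add: power_mult_distrib power_divide)
    finally show ?thesis .
  qed
  have "(\<Sum>k\<in>?S. (l / norm k) ^ (d - 1)) = (\<Sum>q\<in>?I. \<Sum>k\<in>{k\<in>?S. p k = q}. (l / norm k) ^ (d - 1))"
  proof (rule sum.group[symmetric])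
    show "p ` ?S \<subseteq> ?I" using p by blast
  qed (use finS in auto)
  also have "\<dots> \<le> (\<Sum>q\<in>(UNIV :: 'n set) \<times> {1..nat \<lfloor>l\<rfloor>}. 2 * 3 ^ (d - 1) * l ^ (d - 1))"
    by (intro sum_mono main)
  also have "\<dots> = real d * real (nat \<lfloor>l\<rfloor>) * (2 * 3 ^ (d - 1) * l ^ (d - 1))"
    by (simp add: d_def card_cartesian_product)
  also have "\<dots> \<le> real d * l * (2 * 3 ^ (d - 1) * l ^ (d - 1))"
    using l by (intro mult_right_mono mult_left_mono) auto
  also have "\<dots> = 2 * real d * 3 ^ (d - 1) * l ^ Suc (d - 1)" by simp
  finally show ?thesis using d1 by simp
qed


text \<open>Up to constants, \<open>a ^ (d - 1) * b\<close> is the volume of the box on the left, of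
  width \<open>a\<close> and height \<open>b\<close>; it enters as the reciprocal of the density of
  the dual lattice. For volume of order one the dual count alone controls the count.\<close>

lemma box_duality:
  fixes u :: "real^'n"
  assumes u: "norm u = 1" and ab: "0 < a" "0 < b"
  defines "d \<equiv> CARD('n)"
  shows "real (card {z\<in>integer_lattice. norm (stretch u (1/a) (1/b) z) \<le> 1})
    \<le> (4 * 2 ^ d) ^ d * (5 * real d) ^ d * (4 * (real d)\<^sup>2) ^ d * (a ^ (d - 1) * b) *
      real (card {k\<in>integer_lattice. norm (stretch u a b k) \<le> 1})"
proof -
  let ?\<Lambda> = "stretch u (1/a) (1/b) ` integer_lattice" and ?\<Gamma> = "stretch u a b ` integer_lattice"
  have cardeq: "card {z\<in>integer_lattice. norm (stretch u \<alpha> \<beta> z) \<le> 1} = card (stretch u \<alpha> \<beta> ` integer_lattice \<inter> cball 0 1)"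
    if "0 < \<alpha>" "0 < \<beta>" for \<alpha> \<beta>
  proof (rule bij_betw_same_card[of "stretch u \<alpha> \<beta>"], unfold bij_betw_def, intro conjI)
    show "inj_on (stretch u \<alpha> \<beta>) {z\<in>integer_lattice. norm (stretch u \<alpha> \<beta> z) \<le> 1}"
      by (rule inj_on_inverseI[of _ "stretch u (1/\<alpha>) (1/\<beta>)"]) (use stretch_inverse[OF u] that in auto)
    show "stretch u \<alpha> \<beta> ` {z\<in>integer_lattice. norm (stretch u \<alpha> \<beta> z) \<le> 1} = stretch u \<alpha> \<beta> ` integer_lattice \<inter> cball 0 1"
      by auto
  qed
  define \<kappa> where "\<kappa> = 1 / ((4 * (real d)\<^sup>2) ^ d * a ^ (d - 1) * b)"
  have d1: "d \<ge> 1" by (simp add: d_def Suc_le_eq)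
  have \<kappa>: "\<kappa> > 0" using ab d1 by (simp add: \<kappa>_def)
  have sub: "x - y \<in> stretch u \<alpha> \<beta> ` integer_lattice"
    if xy: "x \<in> stretch u \<alpha> \<beta> ` integer_lattice" "y \<in> stretch u \<alpha> \<beta> ` integer_lattice" for x y :: "real^'n" and \<alpha> \<beta>
  proof -
    obtain x' y' where "x' \<in> integer_lattice" "x = stretch u \<alpha> \<beta> x'" "y' \<in> integer_lattice" "y = stretch u \<alpha> \<beta> y'"
      using xy by blast
    then show ?thesis
      by (intro image_eqI[of _ _ "x' - y'"]) (simp_all add: linear_diff[OF linear_stretch] integer_lattice_diff)
  qed
  have "\<kappa> * real (card (?\<Lambda> \<inter> cball 0 1)) \<le> (4 * 2 ^ DIM(real^'n)) ^ DIM(real^'n) * (5 * real DIM(real^'n)) ^ DIM(real^'n) * real (card (?\<Gamma> \<inter> cball 0 1))"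
  proof (rule transference[where ?M1.0 = 1])
    show "finite (?\<Lambda> \<inter> cball 0 \<rho>)" "finite (?\<Gamma> \<inter> cball 0 \<rho>)" for \<rho>
      using finite_stretch_lattice[OF u, of "1/a" "1/b"] finite_stretch_lattice[OF u ab] ab by auto
    show "y \<bullet> x \<in> \<int>" if "x \<in> ?\<Lambda>" "y \<in> ?\<Gamma>" for x y
      using that stretch_dual_inner[OF u, of a b] ab integer_lattice_inner by auto
    show "\<kappa> * M ^ DIM(real^'n) \<le> real (card (?\<Gamma> \<inter> cball 0 M))" if "1 \<le> M" for M
      using lattice_density[OF u ab, of M] that by (simp add: \<kappa>_def d_def)
  qed (use \<kappa> sub in blast)+
  then show ?thesis
    using ab d1 by (simp add: cardeq \<kappa>_def d_def[symmetric] pos_divide_le_eq mult.commute mult.left_commute mult.assoc)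
qed

text \<open>A lattice point of a dual box is nearly parallel to its axis \<open>u\<close>, which
  confines \<open>u\<close> to a neighbourhood of one of the two unit vectors on the line of
  \<open>k\<close>. With \<open>c\<close> the cosine of the angle, the claim is
  \<open>2 - 2 * c \<le> 4 * (1 - c\<^sup>2)\<close> for \<open>0 \<le> c \<le> 1\<close>; the sign
  of the unit vector is chosen to make \<open>c\<close> nonnegative.\<close>

lemma small_orth_proj_imp_near_direction:
  fixes u k :: "'a::real_inner"
  assumes u: "norm u = 1" and k: "k \<noteq> 0"
  shows "norm (u - k /\<^sub>R norm k) \<le> 2 * norm (orth_proj u k) / norm k \<or>
    norm (u - - (k /\<^sub>R norm k)) \<le> 2 * norm (orth_proj u k) / norm k"
proof -
  have *: "norm (u - w) \<le> 2 * norm (orth_proj u w)" if w: "norm w = 1" "0 \<le> u \<bullet> w" for w :: 'a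
  proof (rule power2_le_imp_le)
    define c where "c = u \<bullet> w"
    have c: "0 \<le> c" "c \<le> 1" using w(2) norm_cauchy_schwarz[of u w] u w(1) by (auto simp: c_def)
    have 1: "(norm (u - w))\<^sup>2 = 2 - 2 * c"
      using dot_square_norm[of u] dot_square_norm[of w] u w(1)
      by (simp add: power2_norm_eq_inner inner_diff_left inner_diff_right inner_commute c_def)
    have "orth_proj u w = w - c *\<^sub>R u" by (simp add: orth_proj_def c_def inner_commute)
    then have "(norm (orth_proj u w))\<^sup>2 = 1 - c * c"
      using dot_square_norm[of u] dot_square_norm[of w] u w(1)
      by (simp add: power2_norm_eq_inner inner_diff_left inner_diff_right inner_commute c_def)
    then have 2: "(norm (orth_proj u w))\<^sup>2 = 1 - c\<^sup>2" by (simp add: power2_eq_square)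
    have "c\<^sup>2 \<le> c" using c by (simp add: power2_eq_square mult_left_le)
    have "2 - 2 * c \<le> 4 * (1 - e)" if "e \<le> c" for e using that c by simp
    from this[OF \<open>c\<^sup>2 \<le> c\<close>] have "2 - 2 * c \<le> 4 * (1 - c\<^sup>2)" .
    then show "(norm (u - w))\<^sup>2 \<le> (2 * norm (orth_proj u w))\<^sup>2" using 1 2 by (simp add: power_mult_distrib)
  qed simp
  have n: "norm (k /\<^sub>R norm k) = 1" "norm (- (k /\<^sub>R norm k)) = 1" using k by simp_all
  have o: "orth_proj u (k /\<^sub>R norm k) = orth_proj u k /\<^sub>R norm k"
     "orth_proj u (- (k /\<^sub>R norm k)) = - (orth_proj u k /\<^sub>R norm k)"
    by (simp_all add: linear_scale[OF linear_orth_proj] linear_neg[OF linear_orth_proj])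
  show ?thesis
  proof (cases "0 \<le> u \<bullet> (k /\<^sub>R norm k)")
    case True
    from *[OF n(1) this] show ?thesis by (simp add: o divide_inverse_commute mult.left_commute)
  next
    case False
    then have "0 \<le> u \<bullet> (- (k /\<^sub>R norm k))" by simp
    from *[OF n(2) this] show ?thesis by (simp only: o norm_minus_cancel) (simp add: divide_inverse_commute mult.left_commute)
  qed
qed

section \<open>Double counting over the caps of one thin shell\<close>

lemma sum_card_swap:
  assumes "finite A" "finite B"
  shows "(\<Sum>x\<in>A. card {y\<in>B. P x y}) = (\<Sum>y\<in>B. card {x\<in>A. P x y})"
proof -
  have "(\<Sum>x\<in>A. card {y\<in>B. P x y}) = (\<Sum>x\<in>A. \<Sum>y\<in>B. if P x y then 1 else 0)"
    using assms by (simp add: sum.If_cases Int_def)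
  also have "\<dots> = (\<Sum>y\<in>B. \<Sum>x\<in>A. if P x y then 1 else 0)" by (rule sum.swap)
  also have "\<dots> = (\<Sum>y\<in>B. card {x\<in>A. P x y})" using assms by (simp add: sum.If_cases Int_def)
  finally show ?thesis .
qed

text \<open>Below, \<open>r\<^sup>d\<^sup>+\<^sup>1\<close> is the radius \<open>R\<close>; the caps have width \<open>r\<close> and height \<open>r\<^sup>1\<^sup>-\<^sup>d\<close>,
  hence volume of order one, and are indexed by cells of diameter \<open>r\<^sup>-\<^sup>d\<close> on the sphere of normals.\<close>

lemma sum_dual_boxes_le:
  fixes Q :: "('n::finite \<times> bool \<times> ('n \<Rightarrow> int)) set" and u :: "_ \<Rightarrow> real^'n" and r C :: real
  defines "d \<equiv> CARD('n)"
  assumes r: "1 \<le> r" and C: "1 \<le> C" and Q: "finite Q"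
    and u: "\<And>q. q \<in> Q \<Longrightarrow> norm (u q) = 1 \<and> sphere_cell (1 / r ^ d) (u q) = q"
  shows "(\<Sum>q\<in>Q. real (card {k\<in>integer_lattice. norm (stretch (u q) (C * r) (C / r ^ (d - 1)) k) \<le> 1}))
     \<le> 2 * real d * 4 ^ (d - 1) * (1 + 4 * real d * 3 ^ (d - 1) * 2 ^ d) * r ^ (d * (d - 1))"
proof -
  \<comment> \<open>A dual box has width \<open>1 / a \<le> 1\<close> and length
    \<open>1 / b \<le> M\<close> up to constants, so its lattice points lie in the ball of radius
    \<open>2 * M\<close>.\<close>
  define a b M where "a = C * r" and "b = C / r ^ (d - 1)" and "M = r ^ (d - 1)"
  have d1: "1 \<le> d" by (simp add: d_def Suc_le_eq)
  have rp: "1 \<le> r ^ m" for m using r by (rule one_le_power)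
  have M1: "1 \<le> M" unfolding M_def by (rule rp)
  have ab: "0 < a" "0 < b" "1 \<le> a" "1 / b \<le> M"
    using r C rp[of "d - 1"] mult_mono[OF C r] by (auto simp: a_def b_def M_def field_simps)
  define S where "S = {k::real^'n. k \<in> integer_lattice \<and> k \<noteq> 0 \<and> norm k \<le> 2 * M}"
  let ?P = "\<lambda>q k. norm (stretch (u q) a b k) \<le> 1"
  have finS: "finite (insert 0 S)" unfolding S_def
    by (rule finite.insertI, rule finite_subset[OF _ finite_integer_lattice_bounded[of "2 * M"]]) auto
  have bounds: "norm (orth_proj (u q) k) \<le> 1 / a" "norm k \<le> 2 * M" if q: "q \<in> Q" and P: "?P q k" for q k
  proof -
    have uq: "norm (u q) = 1" using u q by blast
    show 1: "norm (orth_proj (u q) k) \<le> 1 / a"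
      using norm_stretch_ge(1)[OF uq ab(1,2), of k] P ab by (simp add: field_simps)
    have 2: "\<bar>k \<bullet> u q\<bar> \<le> 1 / b"
      using norm_stretch_ge(2)[OF uq ab(1,2), of k] P ab by (simp add: field_simps)
    have "norm k \<le> norm (orth_proj (u q) k) + norm ((k \<bullet> u q) *\<^sub>R u q)"
      by (metis norm_triangle_ineq orth_proj_decomp)
    also have "\<dots> \<le> 1 / a + 1 / b" using 1 2 uq by simp
    also have "\<dots> \<le> 2 * M"
    proof -
      have "1 / a \<le> 1" using ab by simp
      then show ?thesis using ab(4) M1 by linarith
    qed
    finally show "norm k \<le> 2 * M" .
  qed
  have eq: "{k\<in>integer_lattice. ?P q k} = {k\<in>insert 0 S. ?P q k}" if "q \<in> Q" for q
    using bounds(2)[OF that] by (auto simp: S_def integer_lattice_def)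
  \<comment> \<open>The origin lies in every dual box, so its contribution is the number of cells in
    use, already of the order of the final bound.\<close>
  have zero: "real (card {q\<in>Q. ?P q 0}) \<le> 2 * real d * 4 ^ (d - 1) * r ^ (d * (d - 1))"
  proof -
    have "{q\<in>Q. ?P q 0} \<subseteq> sphere_cell (1 / r ^ d) ` {v. norm (v - 0) \<le> 1}"
    proof
      fix q assume "q \<in> {q\<in>Q. ?P q 0}"
      then have "sphere_cell (1 / r ^ d) (u q) = q" "norm (u q - 0) \<le> 1" using u by auto
      then show "q \<in> sphere_cell (1 / r ^ d) ` {v. norm (v - 0) \<le> 1}"
        by (intro image_eqI[of _ _ "u q"]) auto
    qed
    then have "card {q\<in>Q. ?P q 0} \<le> card (sphere_cell (1 / r ^ d) ` {v::real^'n. norm (v - 0) \<le> 1})"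
      using r by (intro card_mono card_sphere_cells(1)) auto
    also have "real \<dots> \<le> 2 * real d * (2 * 1 / (1 / r ^ d) + 2) ^ (d - 1)"
      unfolding d_def by (rule card_sphere_cells) (use r in auto)
    also have "\<dots> \<le> 2 * real d * (4 * r ^ d) ^ (d - 1)"
      using rp[of d] by (intro mult_left_mono power_mono) auto
    also have "\<dots> = 2 * real d * 4 ^ (d - 1) * r ^ (d * (d - 1))"
      by (simp add: power_mult_distrib power_mult)
    finally show ?thesis by simp
  qed
  \<comment> \<open>An angle of order at most \<open>1 / (r * norm k)\<close>, measured in cells of
    size \<open>1 / r ^ d\<close>, is of order at most \<open>M / norm k\<close>. Since
    \<open>norm k \<le> 2 * M\<close>, this last ratio is bounded below and absorbs the rounding
    term 2.\<close>
  have nonzero: "real (card {q\<in>Q. ?P q k}) \<le> 4 * real d * 4 ^ (d - 1) * (2 * M / norm k) ^ (d - 1)"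
    if k: "k \<in> S" for k
  proof -
    define \<theta> where "\<theta> = 2 * (1 / a) / norm k"
    let ?w = "k /\<^sub>R norm k"
    have k0: "norm k > 0" "norm k \<le> 2 * M" using k by (auto simp: S_def)
    have \<theta>0: "0 \<le> \<theta>" using ab by (simp add: \<theta>_def)
    let ?N = "\<lambda>w. sphere_cell (1 / r ^ d) ` {v::real^'n. norm (v - w) \<le> \<theta>}"
    have "{q\<in>Q. ?P q k} \<subseteq> ?N ?w \<union> ?N (- ?w)"
    proof
      fix q assume q: "q \<in> {q\<in>Q. ?P q k}"
      have "2 * norm (orth_proj (u q) k) / norm k \<le> \<theta>"
        unfolding \<theta>_def using bounds(1)[of q k] q by (intro divide_right_mono mult_left_mono) auto
      then have "norm (u q - ?w) \<le> \<theta> \<or> norm (u q - - ?w) \<le> \<theta>"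
        using small_orth_proj_imp_near_direction[of "u q" k] u[of q] q k0 by fastforce
      then have "sphere_cell (1 / r ^ d) (u q) \<in> ?N ?w \<union> ?N (- ?w)" by blast
      then show "q \<in> ?N ?w \<union> ?N (- ?w)" using u q by simp
    qed
    then have "card {q\<in>Q. ?P q k} \<le> card (?N ?w \<union> ?N (- ?w))"
      using r \<theta>0 by (intro card_mono finite_UnI card_sphere_cells(1)) auto
    also have "\<dots> \<le> card (?N ?w) + card (?N (- ?w))" by (rule card_Un_le)
    also have "real \<dots> \<le> 2 * real d * (2 * \<theta> / (1 / r ^ d) + 2) ^ (d - 1) + 2 * real d * (2 * \<theta> / (1 / r ^ d) + 2) ^ (d - 1)"
      unfolding of_nat_add d_def by (intro add_mono card_sphere_cells) (use r \<theta>0 in auto)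
    also have "\<dots> = 4 * real d * (2 * \<theta> / (1 / r ^ d) + 2) ^ (d - 1)" by simp
    also have "\<dots> \<le> 4 * real d * (4 * (2 * M / norm k)) ^ (d - 1)"
    proof (intro mult_left_mono power_mono)
      have "r ^ d = r * M" using d1 unfolding M_def by (metis Suc_diff_le diff_Suc_1 power_Suc Suc_le_D)
      then have "2 * \<theta> / (1 / r ^ d) = 4 * M / (C * norm k)"
        using r by (simp add: \<theta>_def a_def)
      also have "\<dots> \<le> 4 * M / norm k"
        using C k0 M1 by (intro divide_left_mono) auto
      finally have "2 * \<theta> / (1 / r ^ d) \<le> 4 * M / norm k" .
      moreover have "2 \<le> 4 * M / norm k" using k0 by (simp add: field_simps)
      ultimately show "2 * \<theta> / (1 / r ^ d) + 2 \<le> 4 * (2 * M / norm k)" by simp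
    qed (use \<theta>0 r in auto)
    finally show ?thesis by (simp only: power_mult_distrib[of 4] mult.assoc)
  qed
  have "(\<Sum>q\<in>Q. real (card {k\<in>integer_lattice. ?P q k})) = (\<Sum>q\<in>Q. real (card {k\<in>insert 0 S. ?P q k}))"
    by (rule sum.cong) (simp_all add: eq)
  also have "\<dots> = (\<Sum>k\<in>insert 0 S. real (card {q\<in>Q. ?P q k}))"
    using sum_card_swap[OF Q finS, of ?P] by (metis (mono_tags, lifting) of_nat_sum sum.cong)
  also have "\<dots> = real (card {q\<in>Q. ?P q 0}) + (\<Sum>k\<in>S. real (card {q\<in>Q. ?P q k}))"
    by (rule sum.insert) (use finS in \<open>auto simp: S_def\<close>)
  also have "\<dots> \<le> 2 * real d * 4 ^ (d - 1) * r ^ (d * (d - 1)) + (\<Sum>k\<in>S. 4 * real d * 4 ^ (d - 1) * (2 * M / norm k) ^ (d - 1))"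
    by (intro add_mono zero sum_mono nonzero)
  also have "(\<Sum>k\<in>S. 4 * real d * 4 ^ (d - 1) * (2 * M / norm k) ^ (d - 1)) = 4 * real d * 4 ^ (d - 1) * (\<Sum>k\<in>S. (2 * M / norm k) ^ (d - 1))"
    by (simp add: sum_distrib_left)
  also have "\<dots> \<le> 4 * real d * 4 ^ (d - 1) * (2 * real d * 3 ^ (d - 1) * (2 * M) ^ d)"
    unfolding S_def d_def using M1 by (intro mult_left_mono lattice_power_sum) auto
  also have "(2 * M) ^ d = 2 ^ d * r ^ (d * (d - 1))"
    by (simp add: M_def power_mult_distrib mult.commute[of d] flip: power_mult)
  finally show ?thesis unfolding a_def b_def by (simp add: algebra_simps)
qed

text \<open>Two bounds on the surface carry the argument: \<open>c\<close> turns nearby normals into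
  nearby points, and \<open>L\<close> makes the surface quadratically flat. Points of the shell with
  normals in one cell then differ by a vector of a box of width O(r) and height O(r^(1-d)), to which
  \<open>box_duality\<close> applies; the dual boxes are summed over the cells.\<close>

lemma card_shell_core:
  fixes F :: "(real^'n) set" and \<nu> :: "real^'n \<Rightarrow> real^'n" and D c L :: real
  defines "d \<equiv> CARD('n)"
  assumes unit: "\<And>p. p \<in> F \<Longrightarrow> norm (\<nu> p) = 1" and D: "\<And>p. p \<in> F \<Longrightarrow> norm p \<le> D" and D0: "0 \<le> D"
    and c: "0 < c" "\<And>p q. p \<in> F \<Longrightarrow> q \<in> F \<Longrightarrow> c * norm (p - q) \<le> norm (\<nu> p - \<nu> q)"
    and L: "0 \<le> L" "\<And>p q. p \<in> F \<Longrightarrow> q \<in> F \<Longrightarrow> \<bar>(p - q) \<bullet> \<nu> q\<bar> \<le> L * (norm (p - q))\<^sup>2"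
  shows "\<exists>K\<ge>0. \<forall>r\<ge>1. \<forall>T X. r ^ (d + 1) \<le> T \<longrightarrow> T \<le> 2 * r ^ (d + 1) \<longrightarrow> finite X \<longrightarrow> X \<subseteq> integer_lattice \<longrightarrow>
     (\<forall>x\<in>X. \<exists>p\<in>F. \<exists>t. x = t *\<^sub>R p \<and> T \<le> t \<and> t \<le> T + 1 / r ^ (d - 1)) \<longrightarrow>
     real (card X) \<le> K * r ^ (d * (d - 1))"
proof -
  have d1: "1 \<le> d" by (simp add: d_def Suc_le_eq)
  define e where "e = 2 * (real d)\<^sup>2 / c"
  have e0: "0 \<le> e" using c by (simp add: e_def)
  \<comment> \<open>Large enough that the tangential and the normal part of a stretched difference
    are each at most 1/2.\<close>
  define C where "C = 1 + 2 * (D + 3 * e) + 2 * (D + 6 * L * e\<^sup>2)"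
  have C: "1 \<le> C" "D + 3 * e \<le> C / 2" "D + 6 * L * e\<^sup>2 \<le> C / 2" using D0 e0 L(1) by (auto simp: C_def)
  define K1 where "K1 = (4 * 2 ^ d) ^ d * (5 * real d) ^ d * (4 * (real d)\<^sup>2) ^ d * C ^ d"
  define K2 where "K2 = 2 * real d * 4 ^ (d - 1) * (1 + 4 * real d * 3 ^ (d - 1) * 2 ^ d)"
  have K1: "0 \<le> K1" "0 \<le> K2" using C by (auto simp: K1_def K2_def)
  show ?thesis
  proof (intro exI[of _ "K1 * K2"] conjI allI impI)
    show "0 \<le> K1 * K2" using K1 by simp
    fix r T :: real and X :: "(real^'n) set"
    assume r: "1 \<le> r" and T: "r ^ (d + 1) \<le> T" "T \<le> 2 * r ^ (d + 1)" and X: "finite X" "X \<subseteq> integer_lattice"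
      and shell: "\<forall>x\<in>X. \<exists>p\<in>F. \<exists>t. x = t *\<^sub>R p \<and> T \<le> t \<and> t \<le> T + 1 / r ^ (d - 1)"
    define \<delta> where "\<delta> = 1 / r ^ (d - 1)"
    \<comment> \<open>With this cell size \<open>r ^ (d + 1) * s\<close> is the width
      \<open>r\<close> of a cap and \<open>r ^ (d + 1) * s\<^sup>2\<close> its height
      \<open>\<delta>\<close>.\<close>
    define s where "s = 1 / r ^ d"
    have rp: "1 \<le> r ^ m" for m using r by (rule one_le_power)
    have rp0: "0 < r ^ m" for m using r by simp
    have \<delta>: "0 < \<delta>" "\<delta> \<le> 1" "\<delta> \<le> r" using rp[of "d - 1"] r by (auto simp: \<delta>_def field_simps intro: order_trans)
    have s0: "0 < s" using r by (simp add: s_def)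
    have rs: "r ^ (d + 1) * s = r" using r by (simp add: s_def)
    have rs2: "r ^ (d + 1) * s\<^sup>2 = \<delta>"
    proof -
      have "r ^ d = r * r ^ (d - 1)" using d1 by (metis power_minus_mult mult.commute zero_less_one less_le_trans)
      then show ?thesis using r rs by (simp add: s_def \<delta>_def power2_eq_square)
    qed
    have "\<forall>x\<in>X. \<exists>p t. p \<in> F \<and> x = t *\<^sub>R p \<and> T \<le> t \<and> t \<le> T + \<delta>" using shell unfolding \<delta>_def by blast
    then obtain p where "\<forall>x\<in>X. \<exists>t. p x \<in> F \<and> x = t *\<^sub>R p x \<and> T \<le> t \<and> t \<le> T + \<delta>"
      by (rule bchoice[THEN exE])
    then obtain t where pt0: "\<forall>x\<in>X. p x \<in> F \<and> x = t x *\<^sub>R p x \<and> T \<le> t x \<and> t x \<le> T + \<delta>"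
      by (rule bchoice[THEN exE])
    then have pt: "\<And>x. x \<in> X \<Longrightarrow> p x \<in> F" "\<And>x. x \<in> X \<Longrightarrow> x = t x *\<^sub>R p x"
       "\<And>x. x \<in> X \<Longrightarrow> T \<le> t x" "\<And>x. x \<in> X \<Longrightarrow> t x \<le> T + \<delta>" by blast+
    define g where "g x = sphere_cell s (\<nu> (p x))" for x
    define Q where "Q = g ` X"
    have finQ: "finite Q" using X by (simp add: Q_def)
    have "\<forall>q\<in>Q. \<exists>x. x \<in> X \<and> g x = q" by (auto simp: Q_def)
    then obtain rep where rep0: "\<forall>q\<in>Q. rep q \<in> X \<and> g (rep q) = q" by (rule bchoice[THEN exE])
    define u where "u q = \<nu> (p (rep q))" for q
    have u: "norm (u q) = 1 \<and> sphere_cell (1 / r ^ d) (u q) = q" if "q \<in> Q" for q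
      using rep0 that unit pt(1) by (auto simp: u_def g_def s_def)
    let ?a = "C * r" and ?b = "C * \<delta>"
    have ab: "0 < ?a" "0 < ?b" using C r \<delta> by auto
    have near: "norm (p x - p y) \<le> e * s" if "x \<in> X" "y \<in> X" "g x = g y" for x y
    proof -
      have "c * norm (p x - p y) \<le> norm (\<nu> (p x) - \<nu> (p y))" using c(2) pt(1) that by blast
      also have "\<dots> \<le> 2 * (real d)\<^sup>2 * s" unfolding d_def
        by (rule sphere_cell_diameter) (use unit pt(1) that s0 in \<open>auto simp: g_def\<close>)
      finally show ?thesis using c(1) by (simp add: e_def field_simps)
    qed
    have fibre: "real (card {x\<in>X. g x = q}) \<le> K1 * real (card {k\<in>integer_lattice. norm (stretch (u q) ?a (C / r ^ (d - 1)) k) \<le> 1})"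
      if q: "q \<in> Q" for q
    proof -
      define x0 where "x0 = rep q"
      have x0: "x0 \<in> X" "g x0 = q" using rep0 q by (auto simp: x0_def)
      have nu: "norm (u q) = 1" using u q by blast
      have uq: "u q = \<nu> (p x0)" by (simp add: u_def x0_def)
      have "norm (stretch (u q) (1 / ?a) (1 / ?b) (x - x0)) \<le> 1" if x: "x \<in> X" "g x = q" for x
      proof -
        have ps: "norm (p x - p x0) \<le> e * s" using near x x0 by simp
        \<comment> \<open>The first term is the radial displacement within the shell, the second the
          displacement along the surface; only the latter is multiplied by the large radius.\<close>
        have eq: "x - x0 = (t x - t x0) *\<^sub>R p x + t x0 *\<^sub>R (p x - p x0)"
          using pt(2)[OF x(1)] pt(2)[OF x0(1)] by (simp add: algebra_simps)
        have tt: "\<bar>t x - t x0\<bar> \<le> \<delta>" using pt(3,4)[OF x(1)] pt(3,4)[OF x0(1)] by linarith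
        have t0: "0 \<le> t x0" "t x0 \<le> 3 * r ^ (d + 1)"
          using pt(3,4)[OF x0(1)] T \<delta>(2) rp[of "d + 1"] by linarith+
        have Dp: "norm (p x) \<le> D" using D pt(1) x by blast
        have "norm (x - x0) \<le> \<bar>t x - t x0\<bar> * norm (p x) + t x0 * norm (p x - p x0)"
          unfolding eq by (rule order_trans[OF norm_triangle_ineq]) (use t0 in simp)
        also have "\<dots> \<le> \<delta> * D + 3 * r ^ (d + 1) * (e * s)"
          by (intro add_mono mult_mono tt Dp t0 ps) (use \<delta> r in auto)
        also have "3 * r ^ (d + 1) * (e * s) = 3 * e * (r ^ (d + 1) * s)" by (simp only: mult_ac)
        also have "\<delta> * D + 3 * e * (r ^ (d + 1) * s) \<le> r * (D + 3 * e)"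
          unfolding rs using mult_right_mono[OF \<delta>(3) D0] by (simp add: algebra_simps)
        also have "\<dots> \<le> r * (C / 2)" using C r by (intro mult_left_mono) auto
        finally have n1: "1 / ?a * norm (x - x0) \<le> 1 / 2" using C r by (simp add: field_simps)
        have pu: "\<bar>p x \<bullet> u q\<bar> \<le> D" using Cauchy_Schwarz_ineq2[of "p x" "u q"] nu Dp by simp
        have "\<bar>(p x - p x0) \<bullet> u q\<bar> \<le> L * (norm (p x - p x0))\<^sup>2"
          unfolding uq using L(2) pt(1) x x0 by blast
        also have "\<dots> \<le> L * (e * s)\<^sup>2" using ps L(1) by (intro mult_left_mono power_mono) auto
        finally have pp: "\<bar>(p x - p x0) \<bullet> u q\<bar> \<le> L * (e * s)\<^sup>2" .
        have "\<bar>(x - x0) \<bullet> u q\<bar> \<le> \<bar>t x - t x0\<bar> * \<bar>p x \<bullet> u q\<bar> + t x0 * \<bar>(p x - p x0) \<bullet> u q\<bar>"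
          unfolding eq inner_add_left inner_scaleR_left
          by (rule order_trans[OF abs_triangle_ineq]) (use t0 in \<open>simp add: abs_mult\<close>)
        also have "\<dots> \<le> \<delta> * D + 3 * r ^ (d + 1) * (L * (e * s)\<^sup>2)"
          by (intro add_mono mult_mono tt pu t0 pp) (use \<delta> r in auto)
        also have "3 * r ^ (d + 1) * (L * (e * s)\<^sup>2) = 3 * L * e\<^sup>2 * (r ^ (d + 1) * s\<^sup>2)"
          by (simp only: power_mult_distrib mult_ac)
        also have "\<delta> * D + 3 * L * e\<^sup>2 * (r ^ (d + 1) * s\<^sup>2) \<le> \<delta> * (D + 6 * L * e\<^sup>2)"
          unfolding rs2 using \<delta> L(1) by (simp add: algebra_simps)
        also have "\<dots> \<le> \<delta> * (C / 2)" using C \<delta> by (intro mult_left_mono) auto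
        finally have n2: "1 / ?b * \<bar>(x - x0) \<bullet> u q\<bar> \<le> 1 / 2" using C \<delta> by (simp add: field_simps)
        show ?thesis
        proof -
          have "0 < 1 / ?a" "0 < 1 / ?b" using ab by simp_all
          from norm_stretch_le[OF nu this, of "x - x0"] n1 n2 show ?thesis by linarith
        qed
      qed
      then have sub: "(\<lambda>x. x - x0) ` {x\<in>X. g x = q} \<subseteq> {z\<in>integer_lattice. norm (stretch (u q) (1 / ?a) (1 / ?b) z) \<le> 1}"
        using X(2) x0(1) integer_lattice_diff by blast
      have fin: "finite {z\<in>integer_lattice. norm (stretch (u q) (1 / ?a) (1 / ?b) z) \<le> 1}"
      proof (rule finite_imageD)
        show "finite (stretch (u q) (1 / ?a) (1 / ?b) ` {z\<in>integer_lattice. norm (stretch (u q) (1 / ?a) (1 / ?b) z) \<le> 1})"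
          by (rule finite_subset[OF _ finite_stretch_lattice[OF nu, of "1 / ?a" "1 / ?b" 1]]) (use ab in auto)
        show "inj_on (stretch (u q) (1 / ?a) (1 / ?b)) {z\<in>integer_lattice. norm (stretch (u q) (1 / ?a) (1 / ?b) z) \<le> 1}"
          by (rule inj_on_inverseI[of _ "stretch (u q) (1 / (1 / ?a)) (1 / (1 / ?b))"])
             (use stretch_inverse[OF nu, of "1 / ?a" "1 / ?b"] C r \<delta> in auto)
      qed
      have "card {x\<in>X. g x = q} = card ((\<lambda>x. x - x0) ` {x\<in>X. g x = q})"
        by (simp add: card_image inj_on_def)
      also have "\<dots> \<le> card {z\<in>integer_lattice. norm (stretch (u q) (1 / ?a) (1 / ?b) z) \<le> 1}"
        by (rule card_mono[OF fin sub])
      also have "real \<dots> \<le> (4 * 2 ^ d) ^ d * (5 * real d) ^ d * (4 * (real d)\<^sup>2) ^ d * (?a ^ (d - 1) * ?b) *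
          real (card {k\<in>integer_lattice. norm (stretch (u q) ?a ?b k) \<le> 1})"
        unfolding d_def by (rule box_duality[OF nu ab])
      \<comment> \<open>Here the powers of \<open>r\<close> cancel, the volume of a cap being of
        order one.\<close>
      also have "?a ^ (d - 1) * ?b = C ^ Suc (d - 1)"
        using r by (simp add: \<delta>_def power_mult_distrib)
      also have "Suc (d - 1) = d" using d1 by simp
      finally show ?thesis by (simp add: K1_def \<delta>_def)
    qed
    have "real (card X) = (\<Sum>q\<in>Q. real (card {x\<in>X. g x = q}))"
      using sum.image_gen[OF X(1), of "\<lambda>_. 1::real" g] by (simp add: Q_def)
    also have "\<dots> \<le> (\<Sum>q\<in>Q. K1 * real (card {k\<in>integer_lattice. norm (stretch (u q) ?a (C / r ^ (d - 1)) k) \<le> 1}))"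
      by (intro sum_mono fibre)
    also have "\<dots> = K1 * (\<Sum>q\<in>Q. real (card {k\<in>integer_lattice. norm (stretch (u q) ?a (C / r ^ (d - 1)) k) \<le> 1}))"
      by (simp add: sum_distrib_left)
    also have "\<dots> \<le> K1 * (K2 * r ^ (d * (d - 1)))"
      unfolding K2_def d_def
      by (intro mult_left_mono sum_dual_boxes_le r C(1) finQ) (use u K1 in \<open>auto simp: d_def\<close>)
    finally show "real (card X) \<le> K1 * K2 * r ^ (d * (d - 1))" by (simp add: mult.assoc)
  qed
qed

section \<open>The Gauss map\<close>

lemma C_class_Suc_imp: "C_class (Suc m) f \<Longrightarrow> C_class m f"
proof (induction m arbitrary: f)
  case 0
  then show ?case
    by (auto simp: continuous_on_eq_continuous_at intro!: differentiable_imp_continuous_within)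
next
  case (Suc m)
  from Suc.prems have "\<forall>x. f differentiable at x"
    "\<forall>b\<in>Basis. C_class (Suc m) (\<lambda>x. frechet_derivative f (at x) b)"
    unfolding C_class.simps(2)[of "Suc m"] by blast+
  then show ?case using Suc.IH unfolding C_class.simps(2)[of m] by blast
qed

lemma C_class_mono:
  assumes "C_class n f" "m \<le> n"
  shows "C_class m f"
  using assms(2,1) by (induction rule: inc_induct) (auto intro: C_class_Suc_imp simp del: C_class.simps)

lemma frechet_derivative_Basis_sum:
  fixes f :: "'a::euclidean_space \<Rightarrow> real"
  assumes "f differentiable at x"
  shows "frechet_derivative f (at x) w = (\<Sum>b\<in>Basis. (w \<bullet> b) * frechet_derivative f (at x) b)"
proof -
  have lin: "linear (frechet_derivative f (at x))" by (rule linear_frechet_derivative[OF assms])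
  have "frechet_derivative f (at x) w = frechet_derivative f (at x) (\<Sum>b\<in>Basis. (w \<bullet> b) *\<^sub>R b)"
    by (simp add: euclidean_representation)
  also have "\<dots> = (\<Sum>b\<in>Basis. (w \<bullet> b) * frechet_derivative f (at x) b)"
    by (simp add: linear_sum[OF lin] linear_scale[OF lin])
  finally show ?thesis .
qed

text \<open>The mean value inequality is applied to \<open>f\<close> minus its differential at
  \<open>p\<close>, on a ball where the differential varies by at most \<open>\<epsilon>\<close>.
  Both points are free, which differentiability at \<open>p\<close> alone would not give.\<close>

lemma C1_strictly_differentiable:
  fixes f :: "'a::euclidean_space \<Rightarrow> real"
  assumes f: "C_class (Suc 0) f" and "0 < \<epsilon>"
  obtains \<rho> where "0 < \<rho>"
    "\<And>a b. a \<in> ball p \<rho> \<Longrightarrow> b \<in> ball p \<rho> \<Longrightarrow>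
      \<bar>f a - f b - frechet_derivative f (at p) (a - b)\<bar> \<le> \<epsilon> * norm (a - b)"
proof -
  let ?D = "\<lambda>x. frechet_derivative f (at x)"
  have df: "f differentiable at x" and cont: "b \<in> Basis \<Longrightarrow> continuous_on UNIV (\<lambda>x. ?D x b)" for x b
    using f by auto
  have "\<exists>\<rho>>0. \<forall>x\<in>ball p \<rho>. \<bar>?D x b - ?D p b\<bar> \<le> \<epsilon> / DIM('a)" if b: "b \<in> Basis" for b
  proof -
    have "isCont (\<lambda>x. ?D x b) p" using cont[OF b] by (simp add: continuous_on_eq_continuous_at)
    moreover have "\<epsilon> / DIM('a) > 0" using assms(2) by simp
    ultimately obtain \<rho> where "\<rho> > 0" "\<forall>x. dist x p < \<rho> \<longrightarrow> dist (?D x b) (?D p b) < \<epsilon> / DIM('a)"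
      unfolding continuous_at_eps_delta by (metis dist_norm)
    then show ?thesis by (intro exI[of _ \<rho>]) (auto simp: dist_commute dist_real_def less_imp_le)
  qed
  then have "\<forall>b\<in>Basis. \<exists>\<rho>>0. \<forall>x\<in>ball p \<rho>. \<bar>?D x b - ?D p b\<bar> \<le> \<epsilon> / DIM('a)" by blast
  then obtain R where R: "\<forall>b\<in>Basis. R b > 0 \<and> (\<forall>x\<in>ball p (R b). \<bar>?D x b - ?D p b\<bar> \<le> \<epsilon> / DIM('a))"
    by (rule bchoice[THEN exE])
  define \<rho> where "\<rho> = Min (R ` Basis)"
  have \<rho>0: "\<rho> > 0" using R by (simp add: \<rho>_def)
  have \<rho>: "\<rho> \<le> R b" if "b \<in> Basis" for b using that by (simp add: \<rho>_def)
  have key: "norm ((\<lambda>x. f x - ?D p x) a - (\<lambda>x. f x - ?D p x) b) \<le> \<epsilon> * norm (a - b)"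
    if ab: "a \<in> ball p \<rho>" "b \<in> ball p \<rho>" for a b
  proof (rule differentiable_bound[where S = "ball p \<rho>" and f' = "\<lambda>x v. ?D x v - ?D p v"])
    fix x assume x: "x \<in> ball p \<rho>"
    have "(f has_derivative ?D x) (at x)" using df frechet_derivative_works by blast
    moreover have "(?D p has_derivative ?D p) (at x)"
      by (intro linear_imp_has_derivative linear_frechet_derivative df)
    ultimately show "((\<lambda>x. f x - ?D p x) has_derivative (\<lambda>v. ?D x v - ?D p v)) (at x within ball p \<rho>)"
      by (rule has_derivative_at_withinI[OF has_derivative_diff])
    show "onorm (\<lambda>v. ?D x v - ?D p v) \<le> \<epsilon>"
    proof (rule onorm_le)
      fix v
      have "?D x v - ?D p v = (\<Sum>b\<in>Basis. (v \<bullet> b) * (?D x b - ?D p b))"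
        unfolding frechet_derivative_Basis_sum[OF df, where w = v]
        by (simp add: sum_subtractf right_diff_distrib)
      also have "\<bar>\<dots>\<bar> \<le> (\<Sum>b\<in>(Basis::'a set). norm v * (\<epsilon> / DIM('a)))"
      proof (rule order_trans[OF sum_abs sum_mono])
        fix b :: 'a assume b: "b \<in> Basis"
        have "\<bar>?D x b - ?D p b\<bar> \<le> \<epsilon> / DIM('a)" using R \<rho>[OF b] b x by auto
        then show "\<bar>(v \<bullet> b) * (?D x b - ?D p b)\<bar> \<le> norm v * (\<epsilon> / DIM('a))"
          unfolding abs_mult using Basis_le_norm[OF b, of v] by (intro mult_mono) auto
      qed
      also have "\<dots> = \<epsilon> * norm v" by simp
      finally show "norm (?D x v - ?D p v) \<le> \<epsilon> * norm v" by simp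
    qed
  qed (use ab in auto)
  show thesis
  proof (rule that[OF \<rho>0])
    fix a b assume "a \<in> ball p \<rho>" "b \<in> ball p \<rho>"
    from key[OF this] show "\<bar>f a - f b - ?D p (a - b)\<bar> \<le> \<epsilon> * norm (a - b)"
      by (simp add: linear_diff[OF linear_frechet_derivative[OF df]] algebra_simps)
  qed
qed

text \<open>An upward normal of the graph of \<open>g\<close> over the hyperplane orthogonal to \<open>e\<close>,
  normalised by having \<open>e\<close>-component one.\<close>

definition chart_normal :: "'a::euclidean_space \<Rightarrow> ('a \<Rightarrow> real) \<Rightarrow> 'a \<Rightarrow> 'a" where
  "chart_normal e g x = e - (\<Sum>b\<in>Basis. frechet_derivative g (at (orth_proj e x)) b *\<^sub>R orth_proj e b)"

lemma orth_proj_self_adjoint: "orth_proj e x \<bullet> y = x \<bullet> orth_proj e y"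
  by (simp add: orth_proj_def inner_diff_left inner_diff_right inner_commute)

lemma chart_normal_inner:
  assumes "g differentiable at (orth_proj e x)"
  shows "chart_normal e g x \<bullet> w = e \<bullet> w - frechet_derivative g (at (orth_proj e x)) (orth_proj e w)"
  unfolding frechet_derivative_Basis_sum[OF assms, of "orth_proj e w"]
  by (simp add: chart_normal_def inner_diff_left inner_sum_left orth_proj_self_adjoint[of e _ w]
      inner_commute[of _ "orth_proj e w"] mult.commute)

lemma chart_normal_inner_self:
  assumes "g differentiable at (orth_proj e x)" "norm e = 1"
  shows "chart_normal e g x \<bullet> e = 1"
proof -
  have "orth_proj e e = 0" using assms(2) by (simp add: orth_proj_def dot_square_norm)
  then show ?thesis
    using assms(2) linear_0[OF linear_frechet_derivative[OF assms(1)]]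
    by (simp add: chart_normal_inner[OF assms(1)] dot_square_norm)
qed

lemma one_le_norm_chart_normal:
  assumes "g differentiable at (orth_proj e x)" "norm e = 1"
  shows "1 \<le> norm (chart_normal e g x)"
  using chart_normal_inner_self[OF assms] norm_cauchy_schwarz[of "chart_normal e g x" e] assms(2) by simp

text \<open>The coefficients of \<open>chart_normal\<close> are first derivatives of a C^2 function,
  hence strictly differentiable. One \<open>D\<close> serves every \<open>\<epsilon>\<close>; only
  the radius depends on it.\<close>

lemma chart_normal_strictly_differentiable:
  fixes g :: "'a::euclidean_space \<Rightarrow> real"
  assumes g: "C_class (Suc (Suc 0)) g" and e: "norm e = 1"
  obtains D where "linear D"
    "\<And>\<epsilon>. 0 < \<epsilon> \<Longrightarrow> \<exists>\<rho>>0. \<forall>a\<in>ball p \<rho>. \<forall>b\<in>ball p \<rho>.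
      norm (chart_normal e g a - chart_normal e g b - D (a - b)) \<le> \<epsilon> * norm (a - b)"
proof -
  let ?P = "orth_proj e"
  let ?h = "\<lambda>b x. frechet_derivative g (at x) b"
  let ?H = "\<lambda>b. frechet_derivative (?h b) (at (?P p))"
  have h: "C_class (Suc 0) (?h b)" if "b \<in> Basis" for b using g that unfolding C_class.simps(2)[of "Suc 0"] by blast
  have lin: "linear (?H b)" if "b \<in> Basis" for b
    using h[OF that] by (intro linear_frechet_derivative) simp
  \<comment> \<open>Up to sign and projections this is the Hessian of \<open>g\<close> at the foot
    point of \<open>p\<close>.\<close>
  define D where "D v = - (\<Sum>b\<in>Basis. ?H b (?P v) *\<^sub>R ?P b)" for v
  have "linear D"
    by (rule linearI)
       (simp_all add: D_def linear_add[OF linear_orth_proj] linear_scale[OF linear_orth_proj] linear_add[OF lin] linear_scale[OF lin]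
         scaleR_add_left sum.distrib scaleR_sum_right)
  moreover have "\<exists>\<rho>>0. \<forall>a\<in>ball p \<rho>. \<forall>b\<in>ball p \<rho>.
      norm (chart_normal e g a - chart_normal e g b - D (a - b)) \<le> \<epsilon> * norm (a - b)" if \<epsilon>: "0 < \<epsilon>" for \<epsilon>
  proof -
    have "\<exists>\<rho>. \<rho> > 0 \<and> (\<forall>x\<in>ball (?P p) \<rho>. \<forall>y\<in>ball (?P p) \<rho>. \<bar>?h b x - ?h b y - ?H b (x - y)\<bar> \<le> \<epsilon> / DIM('a) * norm (x - y))"
      if b: "b \<in> Basis" for b
    proof -
      have "0 < \<epsilon> / DIM('a)" using \<epsilon> by simp
      from C1_strictly_differentiable[OF h[OF b] this, of "?P p"] show ?thesis by metis
    qed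
    then have "\<forall>b\<in>Basis. \<exists>\<rho>. \<rho> > 0 \<and> (\<forall>x\<in>ball (?P p) \<rho>. \<forall>y\<in>ball (?P p) \<rho>. \<bar>?h b x - ?h b y - ?H b (x - y)\<bar> \<le> \<epsilon> / DIM('a) * norm (x - y))" by blast
    then obtain R where R: "\<forall>b\<in>Basis. R b > 0 \<and> (\<forall>x\<in>ball (?P p) (R b). \<forall>y\<in>ball (?P p) (R b). \<bar>?h b x - ?h b y - ?H b (x - y)\<bar> \<le> \<epsilon> / DIM('a) * norm (x - y))"
      by (rule bchoice[THEN exE])
    define \<rho> where "\<rho> = Min (R ` Basis)"
    have \<rho>0: "\<rho> > 0" using R by (simp add: \<rho>_def)
    have \<rho>: "\<rho> \<le> R b" if "b \<in> Basis" for b using that by (simp add: \<rho>_def)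
    show ?thesis
    proof (intro exI[of _ \<rho>] conjI \<rho>0 ballI)
      fix a c assume ac: "a \<in> ball p \<rho>" "c \<in> ball p \<rho>"
      have le: "norm (?P x - ?P y) \<le> norm (x - y)" for x y
        using norm_orth_proj_le[OF e, of "x - y"] by (simp add: linear_diff[OF linear_orth_proj])
      have eq: "chart_normal e g a - chart_normal e g c - D (a - c)
         = - (\<Sum>b\<in>Basis. (?h b (?P a) - ?h b (?P c) - ?H b (?P (a - c))) *\<^sub>R ?P b)"
        by (simp add: chart_normal_def D_def scaleR_diff_left sum_subtractf)
      have "norm (chart_normal e g a - chart_normal e g c - D (a - c)) \<le> (\<Sum>b\<in>(Basis::'a set). \<epsilon> / DIM('a) * norm (a - c))"
        unfolding eq norm_minus_cancel
      proof (rule sum_norm_le)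
        fix b :: 'a assume b: "b \<in> Basis"
        have "?P a \<in> ball (?P p) (R b)" "?P c \<in> ball (?P p) (R b)"
          using ac \<rho>[OF b] le[of p a] le[of p c] by (auto simp: dist_norm)
        then have "\<bar>?h b (?P a) - ?h b (?P c) - ?H b (?P a - ?P c)\<bar> \<le> \<epsilon> / DIM('a) * norm (?P a - ?P c)"
          using R b by blast
        also have "\<dots> \<le> \<epsilon> / DIM('a) * norm (a - c)" using le \<epsilon> by (intro mult_left_mono) auto
        finally have "\<bar>?h b (?P a) - ?h b (?P c) - ?H b (?P (a - c))\<bar> \<le> \<epsilon> / DIM('a) * norm (a - c)"
          by (simp add: linear_diff[OF linear_orth_proj])
        moreover have "norm (?P b) \<le> 1" using norm_orth_proj_le[OF e, of b] b by simp
        ultimately show "norm ((?h b (?P a) - ?h b (?P c) - ?H b (?P (a - c))) *\<^sub>R ?P b) \<le> \<epsilon> / DIM('a) * norm (a - c)"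
          using mult_mono[of "\<bar>?h b (?P a) - ?h b (?P c) - ?H b (?P (a - c))\<bar>" "\<epsilon> / DIM('a) * norm (a - c)" "norm (?P b)" 1] \<epsilon>
          by simp
      qed
      also have "\<dots> = \<epsilon> * norm (a - c)" by simp
      finally show "norm (chart_normal e g a - chart_normal e g c - D (a - c)) \<le> \<epsilon> * norm (a - c)" .
    qed
  qed
  ultimately show thesis by (rule that)
qed

text \<open>The line through the foot point of \<open>q\<close> in direction \<open>w\<close> is
  lifted to the graph. Such curves realise every tangential direction, for the first-order condition
  at a support point and for the chain rule along the surface.\<close>

lemma chart_curve:
  fixes g :: "'a::euclidean_space \<Rightarrow> real"
  assumes M: "M \<inter> ball p r = {x \<in> ball p r. x \<bullet> e = g (orth_proj e x)}"
    and e: "norm e = 1" and g: "g differentiable at (orth_proj e q)"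
    and q: "q \<in> M" "q \<in> ball p r" and w: "w \<bullet> e = 0"
  obtains c \<eta> where "c 0 = q" "0 < (\<eta>::real)" "\<And>t. \<bar>t\<bar> < \<eta> \<Longrightarrow> c t \<in> M"
    "(c has_derivative (\<lambda>t. t *\<^sub>R (w + frechet_derivative g (at (orth_proj e q)) w *\<^sub>R e))) (at 0)"
proof -
  let ?P = "orth_proj e" and ?D = "frechet_derivative g (at (orth_proj e q))"
  define c where "c t = ?P q + t *\<^sub>R w + g (?P q + t *\<^sub>R w) *\<^sub>R e" for t
  have qe: "q \<bullet> e = g (?P q)" using M q by blast
  have c0: "c 0 = q" by (simp add: c_def flip: qe orth_proj_decomp)
  have ee: "e \<bullet> e = 1" using e by (simp add: dot_square_norm)
  have dg: "(g has_derivative ?D) (at (?P q + 0 *\<^sub>R w))" using g unfolding frechet_derivative_works by simp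
  have lin: "linear ?D" by (rule linear_frechet_derivative[OF g])
  have "((\<lambda>t. ?P q + t *\<^sub>R w) has_derivative (\<lambda>t. t *\<^sub>R w)) (at 0)"
    by (auto intro!: derivative_eq_intros)
  from has_derivative_compose[OF this dg]
  have "((\<lambda>t. g (?P q + t *\<^sub>R w)) has_derivative (\<lambda>t. t * ?D w)) (at 0)"
    by (simp add: linear_scale[OF lin])
  then have dc: "(c has_derivative (\<lambda>t. t *\<^sub>R (w + ?D w *\<^sub>R e))) (at 0)"
    unfolding c_def[abs_def] by (auto intro!: derivative_eq_intros simp: algebra_simps)
  then have "isCont c 0" by (rule has_derivative_continuous)
  moreover have "open (ball p r)" "c 0 \<in> ball p r" using q c0 by auto
  ultimately have "\<forall>\<^sub>F t in nhds 0. c t \<in> ball p r"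
    using isCont_def tendsto_at_iff_tendsto_nhds topological_tendstoD by blast
  then obtain \<eta> where \<eta>: "\<eta> > 0" "\<And>t. dist t 0 < \<eta> \<Longrightarrow> c t \<in> ball p r"
    unfolding eventually_nhds_metric by blast
  have "c t \<in> M" if t: "\<bar>t\<bar> < \<eta>" for t
  proof -
    have "?P q \<bullet> e = 0" by (rule orth_proj_orth[OF e])
    then have "c t \<bullet> e = g (?P q + t *\<^sub>R w)" "?P (c t) = ?P q + t *\<^sub>R w"
      using w ee by (simp_all add: c_def orth_proj_def inner_add_left inner_diff_left algebra_simps)
    then have "c t \<bullet> e = g (?P (c t))" by (simp only:)
    moreover have "c t \<in> ball p r" using \<eta>(2)[of t] t by simp
    ultimately have "c t \<in> M \<inter> ball p r" unfolding M by blast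
    then show ?thesis by blast
  qed
  then show thesis by (intro that[of c \<eta>] c0 \<eta>(1) dc)
qed

text \<open>At a maximum of \<open>x \<bullet> n\<close> on the surface the derivative along every
  lifted line vanishes, so \<open>n\<close> is orthogonal to the tangent space, as the chart normal
  is.\<close>

lemma support_normal_eq_chart_normal:
  fixes g :: "'a::euclidean_space \<Rightarrow> real"
  assumes M: "M \<inter> ball p r = {x \<in> ball p r. x \<bullet> e = g (orth_proj e x)}"
    and e: "norm e = 1" and g: "g differentiable at (orth_proj e q)"
    and q: "q \<in> M" "q \<in> ball p r" and n: "\<And>x. x \<in> M \<Longrightarrow> x \<bullet> n \<le> q \<bullet> n"
  shows "n = (n \<bullet> e) *\<^sub>R chart_normal e g q"
proof -
  let ?D = "frechet_derivative g (at (orth_proj e q))"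
  have crit: "w \<bullet> n + ?D w * (e \<bullet> n) = 0" if w: "w \<bullet> e = 0" for w
  proof -
    obtain c \<eta> where c: "c 0 = q" "0 < (\<eta>::real)" "\<And>t. \<bar>t\<bar> < \<eta> \<Longrightarrow> c t \<in> M"
      "(c has_derivative (\<lambda>t. t *\<^sub>R (w + ?D w *\<^sub>R e))) (at 0)"
      by (rule chart_curve[OF M e g q w]) blast
    have "((\<lambda>t. c t \<bullet> n) has_derivative (\<lambda>t. (t *\<^sub>R (w + ?D w *\<^sub>R e)) \<bullet> n)) (at 0)"
      by (rule has_derivative_inner_left[OF c(4)])
    then have "((\<lambda>t. c t \<bullet> n) has_real_derivative (w \<bullet> n + ?D w * (e \<bullet> n))) (at 0)"
      unfolding has_field_derivative_def
      by (rule has_derivative_eq_rhs) (auto simp: fun_eq_iff inner_add_left algebra_simps)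
    then show ?thesis
      by (rule DERIV_local_max[OF _ c(2)]) (use c n in auto)
  qed
  \<comment> \<open>\<open>z\<close> is orthogonal to \<open>e\<close>, and its square equals the
    derivative along the lifted line of direction \<open>z\<close>, which vanishes.\<close>
  define z where "z = n - (n \<bullet> e) *\<^sub>R chart_normal e g q"
  have ze: "z \<bullet> e = 0" by (simp add: z_def inner_diff_left chart_normal_inner_self[OF g e])
  then have "orth_proj e z = z" by (simp add: orth_proj_def)
  then have "z \<bullet> z = z \<bullet> n + ?D z * (e \<bullet> n)"
    using ze by (subst (2) z_def)
      (simp add: inner_diff_right inner_commute[of z "chart_normal e g q"] chart_normal_inner[OF g] inner_commute[of e] algebra_simps)
  then have "z = 0" using crit[OF ze] by simp
  then show ?thesis by (simp add: z_def)
qed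

lemma norm_normalised_diff_le:
  fixes x y :: "'a::real_normed_vector"
  assumes "1 \<le> norm x" "1 \<le> norm y"
  shows "norm (x /\<^sub>R norm x - y /\<^sub>R norm y) \<le> 2 * norm (x - y)"
proof -
  have x: "norm x > 0" "norm y > 0" using assms by linarith+
  have eq: "x /\<^sub>R norm x - y /\<^sub>R norm y = (x - y) /\<^sub>R norm x + ((norm y - norm x) / (norm x * norm y)) *\<^sub>R y"
    using x by (simp add: algebra_simps diff_divide_distrib divide_inverse)
  have "norm (x /\<^sub>R norm x - y /\<^sub>R norm y) \<le> norm (x - y) / norm x + \<bar>norm y - norm x\<bar> / norm x"
  proof -
    have "norm ((x - y) /\<^sub>R norm x) = norm (x - y) / norm x" by (simp add: divide_inverse mult.commute)
    moreover have "norm (((norm y - norm x) / (norm x * norm y)) *\<^sub>R y) = \<bar>norm y - norm x\<bar> / norm x"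
      using x by (simp add: abs_mult)
    ultimately show ?thesis unfolding eq using norm_triangle_ineq by metis
  qed
  also have "\<dots> \<le> norm (x - y) / norm x + norm (x - y) / norm x"
    using x norm_triangle_ineq3[of y x] by (intro add_left_mono divide_right_mono) (auto simp: norm_minus_commute)
  also have "\<dots> = 2 * norm (x - y) / norm x" by simp
  also have "\<dots> \<le> 2 * norm (x - y) / 1" using assms by (intro divide_left_mono) auto
  finally show ?thesis by simp
qed

text \<open>Dividing a unit normal \<open>u\<close> by \<open>u \<bullet> e\<close> recovers the
  chart normal, so this is the converse of \<open>norm_normalised_diff_le\<close>; \<open>m\<close>
  bounds the steepness of the graph.\<close>

lemma norm_rescaled_diff_le:
  fixes u v e :: "'a::real_inner"
  assumes uv: "norm v = 1" "norm e = 1" and m: "1 \<le> m * \<bar>u \<bullet> e\<bar>" "1 \<le> m * \<bar>v \<bullet> e\<bar>" "0 \<le> m"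
  shows "norm (u /\<^sub>R (u \<bullet> e) - v /\<^sub>R (v \<bullet> e)) \<le> (m + m\<^sup>2) * norm (u - v)"
proof -
  define \<alpha> \<beta> where "\<alpha> = u \<bullet> e" and "\<beta> = v \<bullet> e"
  have nz: "\<alpha> \<noteq> 0" "\<beta> \<noteq> 0" using m by (auto simp: \<alpha>_def \<beta>_def)
  have inv: "1 / \<bar>\<alpha>\<bar> \<le> m" "1 / \<bar>\<beta>\<bar> \<le> m" using m nz by (auto simp: \<alpha>_def \<beta>_def field_simps)
  have eq: "u /\<^sub>R \<alpha> - v /\<^sub>R \<beta> = (1/\<alpha>) *\<^sub>R (u - v) + ((\<beta> - \<alpha>) * (1 / \<alpha>) * (1 / \<beta>)) *\<^sub>R v"
    using nz by (simp add: algebra_simps divide_inverse)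
  have "\<bar>\<beta> - \<alpha>\<bar> \<le> norm (u - v)"
    using Cauchy_Schwarz_ineq2[of "v - u" e] uv by (simp add: \<alpha>_def \<beta>_def inner_diff_left norm_minus_commute)
  then have "\<bar>\<beta> - \<alpha>\<bar> * (1 / \<bar>\<alpha>\<bar>) * (1 / \<bar>\<beta>\<bar>) \<le> norm (u - v) * m * m"
    using inv m by (intro mult_mono) auto
  moreover have "1 / \<bar>\<alpha>\<bar> * norm (u - v) \<le> m * norm (u - v)" using inv by (intro mult_right_mono) auto
  moreover have "norm (u /\<^sub>R \<alpha> - v /\<^sub>R \<beta>) \<le> 1 / \<bar>\<alpha>\<bar> * norm (u - v) + \<bar>\<beta> - \<alpha>\<bar> * (1 / \<bar>\<alpha>\<bar>) * (1 / \<bar>\<beta>\<bar>)"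
    unfolding eq by (rule order_trans[OF norm_triangle_ineq]) (use uv in \<open>simp add: abs_mult\<close>)
  ultimately show ?thesis by (simp add: \<alpha>_def \<beta>_def algebra_simps power2_eq_square)
qed

section \<open>Supporting hyperplanes of a convex body around the origin\<close>

locale centred_body =
  fixes B :: "'a::euclidean_space set"
  assumes conv: "convex B" and int0: "0 \<in> interior B" and bdd: "bounded B"
begin

lemma support_closure:
  assumes "\<forall>x\<in>B. x \<bullet> n \<le> c" "y \<in> closure B"
  shows "y \<bullet> n \<le> c"
proof -
  have "closure B \<subseteq> {x. n \<bullet> x \<le> c}"
    by (rule closure_minimal) (use assms(1) closed_halfspace_le[of n c] in \<open>auto simp: inner_commute\<close>)
  then show ?thesis using assms(2) by (auto simp: inner_commute)
qed

lemma support_pos: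
  assumes n: "norm n = 1" "\<forall>x\<in>B. x \<bullet> n \<le> c"
  shows "0 < c"
proof -
  obtain \<epsilon> where \<epsilon>: "\<epsilon> > 0" "cball 0 \<epsilon> \<subseteq> B" using int0 by (auto simp: mem_interior_cball)
  have "\<epsilon> *\<^sub>R n \<in> B" using \<epsilon> n by auto
  then have "(\<epsilon> *\<^sub>R n) \<bullet> n \<le> c" using n(2) by blast
  then show ?thesis using \<epsilon> n by (simp add: dot_square_norm)
qed

lemma support_exists:
  assumes p: "p \<in> frontier B"
  shows "\<exists>n. norm n = 1 \<and> (\<forall>x\<in>B. x \<bullet> n \<le> p \<bullet> n)"
proof -
  have "interior B \<noteq> {}" using int0 by blast
  then have "p \<in> closure B" "p \<notin> rel_interior B"
    using p by (auto simp: frontier_def rel_interior_nonempty_interior)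
  then obtain a where a: "a \<noteq> 0" "\<And>y. y \<in> closure B \<Longrightarrow> a \<bullet> p \<le> a \<bullet> y"
    using supporting_hyperplane_relative_frontier[OF conv] by metis
  have "x \<bullet> (- (a /\<^sub>R norm a)) \<le> p \<bullet> (- (a /\<^sub>R norm a))" if "x \<in> B" for x
    using a(2)[of x] that closure_subset a(1) by (auto simp: inner_commute[of _ a] divide_inverse_commute intro: mult_right_mono)
  then show ?thesis using a(1) by (intro exI[of _ "- (a /\<^sub>R norm a)"]) auto
qed

lemma support_imp_frontier:
  assumes n: "norm n = 1" "\<forall>x\<in>B. x \<bullet> n \<le> y \<bullet> n" and y: "y \<in> closure B"
  shows "y \<in> frontier B"
proof -
  have "y \<notin> interior B"
  proof
    assume "y \<in> interior B"
    then obtain \<epsilon> where \<epsilon>: "\<epsilon> > 0" "cball y \<epsilon> \<subseteq> B" by (auto simp: mem_interior_cball)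
    have "y + \<epsilon> *\<^sub>R n \<in> B" using \<epsilon> n by (auto simp: dist_norm)
    then have "(y + \<epsilon> *\<^sub>R n) \<bullet> n \<le> y \<bullet> n" using n(2) by blast
    then show False using \<epsilon> n(1) by (simp add: inner_add_left dot_square_norm)
  qed
  then show ?thesis using y by (simp add: frontier_def)
qed

end

locale smooth_body = centred_body +
  assumes chart: "\<And>p. p \<in> frontier B \<Longrightarrow> \<exists>r>0. \<exists>e g. norm e = 1 \<and> C_class (Suc (Suc 0)) g \<and>
        frontier B \<inter> ball p r = {x \<in> ball p r. x \<bullet> e = g (orth_proj e x)}"
begin

text \<open>Two support normals are unit multiples of the same chart normal, so they agree up to
  sign. The sign is fixed because both have positive product with \<open>p\<close>, the origin being
  interior.\<close>

lemma support_unique: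
  assumes p: "p \<in> frontier B" and n: "norm n = 1" "\<forall>x\<in>B. x \<bullet> n \<le> p \<bullet> n"
    and n': "norm n' = 1" "\<forall>x\<in>B. x \<bullet> n' \<le> p \<bullet> n'"
  shows "n = n'"
proof -
  obtain r e g where r: "r > 0" and e: "norm e = 1" and g: "C_class (Suc (Suc 0)) g"
    and M: "frontier B \<inter> ball p r = {x \<in> ball p r. x \<bullet> e = g (orth_proj e x)}"
    using chart[OF p] by metis
  have dg: "g differentiable at (orth_proj e p)" using g by simp
  let ?N = "chart_normal e g p"
  have cl: "x \<in> closure B" if "x \<in> frontier B" for x using that by (simp add: frontier_def)
  have pr: "p \<in> ball p r" using r by simp
  have 1: "n = (n \<bullet> e) *\<^sub>R ?N" "n' = (n' \<bullet> e) *\<^sub>R ?N"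
    using support_normal_eq_chart_normal[OF M e dg p pr] support_closure[OF n(2) cl] support_closure[OF n'(2) cl] by blast+
  have "\<bar>n \<bullet> e\<bar> * norm ?N = 1" "\<bar>n' \<bullet> e\<bar> * norm ?N = 1"
    using 1 n(1) n'(1) by (metis norm_scaleR)+
  moreover have "norm ?N \<noteq> 0" using one_le_norm_chart_normal[OF dg e] by linarith
  ultimately have 2: "\<bar>n \<bullet> e\<bar> = \<bar>n' \<bullet> e\<bar>" by (metis mult_right_cancel)
  have "0 < (n \<bullet> e) * (p \<bullet> ?N)" "0 < (n' \<bullet> e) * (p \<bullet> ?N)"
    using support_pos[OF n] support_pos[OF n'] 1 by (metis inner_scaleR_right)+
  then have "n \<bullet> e = n' \<bullet> e" using 2 by (auto simp: abs_if zero_less_mult_iff split: if_splits)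
  then show ?thesis using 1 by metis
qed

lemma outer_normal_eqI:
  assumes "p \<in> frontier B" "norm n = 1" "\<forall>x\<in>B. x \<bullet> n \<le> p \<bullet> n"
  shows "outer_normal B p = n"
  unfolding outer_normal_def using support_unique[OF assms(1)] assms by (intro the_equality) blast+

lemma outer_normal:
  assumes "p \<in> frontier B"
  shows "norm (outer_normal B p) = 1" "\<forall>x\<in>B. x \<bullet> outer_normal B p \<le> p \<bullet> outer_normal B p"
    "y \<in> closure B \<Longrightarrow> y \<bullet> outer_normal B p \<le> p \<bullet> outer_normal B p"
proof -
  show 1: "norm (outer_normal B p) = 1" "\<forall>x\<in>B. x \<bullet> outer_normal B p \<le> p \<bullet> outer_normal B p"
    using support_exists[OF assms] outer_normal_eqI[OF assms] by blast+
  then show "y \<in> closure B \<Longrightarrow> y \<bullet> outer_normal B p \<le> p \<bullet> outer_normal B p"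
    using support_closure by blast
qed

lemma outer_normal_frontier_le:
  assumes "p \<in> frontier B" "q \<in> frontier B"
  shows "(q - p) \<bullet> outer_normal B p \<le> 0"
  using outer_normal(3)[OF assms(1), of q] assms(2) by (simp add: inner_diff_left frontier_def)

text \<open>Near \<open>p\<close> the Gauss map is a normalised chart normal \<open>N\<close> with
  constant sign \<open>s\<close>: support values are positive, so \<open>s\<close> is the sign of
  \<open>q \<bullet> N q\<close>, constant near \<open>p\<close> by continuity. Unlike the Gauss
  map, \<open>N\<close> makes sense off the surface and has a full derivative \<open>D\<close> at
  \<open>p\<close>. The last property realises each tangent vector as the velocity of a curve in the
  frontier.\<close>

lemma gauss_chart:
  assumes p: "p \<in> frontier B"
  obtains \<rho> N D s e where "0 < \<rho>" "\<bar>s\<bar> = (1::real)" "norm e = 1" "linear D"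
    "\<And>\<epsilon>. 0 < \<epsilon> \<Longrightarrow> \<exists>\<rho>>0. \<forall>a\<in>ball p \<rho>. \<forall>b\<in>ball p \<rho>. norm (N a - N b - D (a - b)) \<le> \<epsilon> * norm (a - b)"
    "(N has_derivative D) (at p)"
    "\<And>q. N q \<bullet> e = 1" "\<And>q. 1 \<le> norm (N q)"
    "\<And>q. q \<in> frontier B \<Longrightarrow> q \<in> ball p \<rho> \<Longrightarrow> outer_normal B q = s *\<^sub>R (N q /\<^sub>R norm (N q))"
    "\<And>w. w \<bullet> outer_normal B p = 0 \<Longrightarrow> \<exists>c \<eta>. c 0 = p \<and> 0 < (\<eta>::real) \<and> (\<forall>t. \<bar>t\<bar> < \<eta> \<longrightarrow> c t \<in> frontier B) \<and>
        (c has_derivative (\<lambda>t. t *\<^sub>R w)) (at 0)"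
proof -
  obtain r e g where r: "r > 0" and e: "norm e = 1" and g: "C_class (Suc (Suc 0)) g"
    and M: "frontier B \<inter> ball p r = {x \<in> ball p r. x \<bullet> e = g (orth_proj e x)}"
    using chart[OF p] by metis
  have dg: "g differentiable at x" for x using g by simp
  let ?N = "chart_normal e g" and ?\<nu> = "outer_normal B"
  obtain D where D: "linear D"
    and strict: "\<And>\<epsilon>. 0 < \<epsilon> \<Longrightarrow> \<exists>\<rho>>0. \<forall>a\<in>ball p \<rho>. \<forall>b\<in>ball p \<rho>. norm (?N a - ?N b - D (a - b)) \<le> \<epsilon> * norm (a - b)"
    by (rule chart_normal_strictly_differentiable[OF g e]) blast
  have der: "(?N has_derivative D) (at p)"
    unfolding has_derivative_at_alt
  proof (intro conjI allI impI)
    show "bounded_linear D" using D by (simp add: linear_conv_bounded_linear)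
    fix \<epsilon> :: real assume "0 < \<epsilon>"
    from strict[OF this] obtain \<rho> where \<rho>: "\<rho> > 0" "\<forall>a\<in>ball p \<rho>. \<forall>b\<in>ball p \<rho>. norm (?N a - ?N b - D (a - b)) \<le> \<epsilon> * norm (a - b)" by blast
    show "\<exists>d>0. \<forall>y. norm (y - p) < d \<longrightarrow> norm (?N y - ?N p - D (y - p)) \<le> \<epsilon> * norm (y - p)"
    proof (intro exI[of _ \<rho>] conjI allI impI \<rho>(1))
      fix y assume "norm (y - p) < \<rho>"
      then have "y \<in> ball p \<rho>" "p \<in> ball p \<rho>" using \<rho>(1) by (auto simp: dist_norm norm_minus_commute)
      then show "norm (?N y - ?N p - D (y - p)) \<le> \<epsilon> * norm (y - p)" using \<rho>(2) by blast
    qed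
  qed
  have eqN: "?\<nu> q = (?\<nu> q \<bullet> e) *\<^sub>R ?N q" if "q \<in> frontier B" "q \<in> ball p r" for q
    by (rule support_normal_eq_chart_normal[OF M e dg that])
       (use outer_normal(3)[OF that(1)] in \<open>auto simp: frontier_def\<close>)
  have pos: "0 < (?\<nu> q \<bullet> e) * (q \<bullet> ?N q)" if "q \<in> frontier B" "q \<in> ball p r" for q
    using support_pos[OF outer_normal(1,2)[OF that(1)]] eqN[OF that] by (metis inner_scaleR_right)
  define s where "s = sgn (p \<bullet> ?N p)"
  have pN: "p \<bullet> ?N p \<noteq> 0" using pos[of p] p r by auto
  then have s1: "\<bar>s\<bar> = 1" by (simp add: s_def abs_sgn_eq)
  have "isCont ?N p" by (rule has_derivative_continuous[OF der])
  then have "isCont (\<lambda>q. s * (q \<bullet> ?N q)) p" by (intro continuous_intros)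
  moreover have "0 < s * (p \<bullet> ?N p)" using pN by (simp add: s_def sgn_if)
  ultimately have "\<forall>\<^sub>F q in nhds p. 0 < s * (q \<bullet> ?N q)"
    using isCont_def tendsto_at_iff_tendsto_nhds order_tendstoD(1) by blast
  then obtain \<rho> where \<rho>: "\<rho> > 0" "\<And>q. dist q p < \<rho> \<Longrightarrow> 0 < s * (q \<bullet> ?N q)"
    unfolding eventually_nhds_metric by blast
  have main: "?\<nu> q = s *\<^sub>R (?N q /\<^sub>R norm (?N q))" if q: "q \<in> frontier B" "q \<in> ball p (min r \<rho>)" for q
  proof -
    have "q \<in> ball p r" "0 < s * (q \<bullet> ?N q)" using q \<rho>(2)[of q] by (auto simp: dist_commute)
    then have 1: "?\<nu> q = (?\<nu> q \<bullet> e) *\<^sub>R ?N q" "0 < (?\<nu> q \<bullet> e) * (q \<bullet> ?N q)" "0 < s * (q \<bullet> ?N q)"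
      using eqN[OF q(1)] pos[OF q(1)] by auto
    have N0: "norm (?N q) > 0" using one_le_norm_chart_normal[OF dg e, of q] by linarith
    have "\<bar>?\<nu> q \<bullet> e\<bar> * norm (?N q) = 1" using 1(1) outer_normal(1)[OF q(1)] by (metis norm_scaleR)
    then have "\<bar>?\<nu> q \<bullet> e\<bar> = \<bar>s\<bar> / norm (?N q)" using N0 s1 by (simp add: field_simps)
    then have "?\<nu> q \<bullet> e = s / norm (?N q)"
      using 1(2,3) N0 by (auto simp: abs_if zero_less_mult_iff split: if_splits)
    then show ?thesis using 1(1) by (simp add: divide_inverse)
  qed
  have curve: "\<exists>c \<eta>. c 0 = p \<and> 0 < (\<eta>::real) \<and> (\<forall>t. \<bar>t\<bar> < \<eta> \<longrightarrow> c t \<in> frontier B) \<and>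
        (c has_derivative (\<lambda>t. t *\<^sub>R w)) (at 0)" if w: "w \<bullet> ?\<nu> p = 0" for w
  proof -
    have pr: "p \<in> ball p r" using r by simp
    have "(?\<nu> p \<bullet> e) * (w \<bullet> ?N p) = 0" using w eqN[OF p pr] by (metis inner_scaleR_right)
    then have "w \<bullet> ?N p = 0" using pos[OF p pr] by auto
    then have we: "frechet_derivative g (at (orth_proj e p)) (orth_proj e w) = w \<bullet> e"
      using chart_normal_inner[OF dg, of e p w] by (simp add: inner_commute)
    have "orth_proj e w \<bullet> e = 0" by (rule orth_proj_orth[OF e])
    from chart_curve[OF M e dg p pr this]
    obtain c \<eta> where c: "c 0 = p" "0 < (\<eta>::real)" "\<And>t. \<bar>t\<bar> < \<eta> \<Longrightarrow> c t \<in> frontier B"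
      "(c has_derivative (\<lambda>t. t *\<^sub>R (orth_proj e w + frechet_derivative g (at (orth_proj e p)) (orth_proj e w) *\<^sub>R e))) (at 0)"
      by metis
    have "(c has_derivative (\<lambda>t. t *\<^sub>R w)) (at 0)" using c(4) unfolding we orth_proj_decomp[symmetric] .
    then show ?thesis using c by blast
  qed
  show thesis
    by (rule that[of "min r \<rho>" s e D ?N])
       (use r \<rho>(1) s1 e D strict der main curve chart_normal_inner_self[OF dg e] one_le_norm_chart_normal[OF dg e] in auto)
qed

text \<open>This makes the \<open>frechet_derivative\<close> in the curvature a true derivative of
  the Gauss map along the frontier, not an arbitrary value of the choice operator.\<close>

lemma outer_normal_differentiable:
  assumes p: "p \<in> frontier B"
  shows "outer_normal B differentiable (at p within frontier B)"
proof -
  obtain \<rho> N D s e where c: "0 < \<rho>" "(N has_derivative D) (at p)" "\<And>q. 1 \<le> norm (N q)"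
    "\<And>q. q \<in> frontier B \<Longrightarrow> q \<in> ball p \<rho> \<Longrightarrow> outer_normal B q = s *\<^sub>R (N q /\<^sub>R norm (N q))"
    by (rule gauss_chart[OF p]) blast
  have N0: "N p \<noteq> 0" using c(3)[of p] by auto
  have "N differentiable (at p within frontier B)" using c(2) by (meson differentiableI differentiable_at_withinI)
  moreover from this have "(\<lambda>q. norm (N q)) differentiable (at p within frontier B)"
    using differentiable_compose[of norm N p "frontier B"] N0 by (simp add: differentiable_norm_at)
  ultimately have "(\<lambda>q. s *\<^sub>R (N q /\<^sub>R norm (N q))) differentiable (at p within frontier B)"
    using N0 by (intro differentiable_scaleR differentiable_inverse) auto
  then obtain W where "((\<lambda>q. s *\<^sub>R (N q /\<^sub>R norm (N q))) has_derivative W) (at p within frontier B)"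
    unfolding differentiable_def by blast
  from has_derivative_transform_within[OF this c(1) p] have "(outer_normal B has_derivative W) (at p within frontier B)"
    using c(4) by (simp add: dist_commute)
  then show ?thesis unfolding differentiable_def by blast
qed

end

text \<open>The form in which nonvanishing curvature is used: the Weingarten map is injective on
  tangent vectors.\<close>

locale curved_body = smooth_body +
  assumes nondegenerate: "\<And>p w. p \<in> frontier B \<Longrightarrow> w \<bullet> outer_normal B p = 0 \<Longrightarrow>
    frechet_derivative (outer_normal B) (at p within frontier B) w = 0 \<Longrightarrow> w = 0"
begin

text \<open>Nondegeneracy passes from the Weingarten map \<open>W\<close> to the derivative
  \<open>D\<close> of the chart normal. Along a curve in the frontier with velocity
  \<open>w\<close>, \<open>D w = 0\<close> makes the chart normal stationary to first order, hence
  also its normalisation; the chain rule gives the Gauss map the derivative \<open>W w\<close>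
  there, so \<open>W w = 0\<close>.\<close>

lemma chart_derivative_injective:
  assumes p: "p \<in> frontier B" and \<rho>: "0 < \<rho>" and s: "\<bar>s\<bar> = 1"
    and der: "(N has_derivative D) (at p)" and N1: "\<And>q. 1 \<le> norm (N q)"
    and \<nu>: "\<And>q. q \<in> frontier B \<Longrightarrow> q \<in> ball p \<rho> \<Longrightarrow> outer_normal B q = s *\<^sub>R (N q /\<^sub>R norm (N q))"
    and c: "c 0 = p" "0 < (\<eta>::real)" "\<And>t. \<bar>t\<bar> < \<eta> \<Longrightarrow> c t \<in> frontier B"
      "(c has_derivative (\<lambda>t. t *\<^sub>R w)) (at 0)"
    and w: "D w = 0" "w \<bullet> outer_normal B p = 0"
  shows "w = 0"
proof -
  let ?\<nu> = "outer_normal B" and ?F = "frontier B"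
  define W where "W = frechet_derivative ?\<nu> (at p within ?F)"
  have dW: "(?\<nu> has_derivative W) (at p within ?F)"
    unfolding W_def using outer_normal_differentiable[OF p] frechet_derivative_works by blast
  have W: "linear W" "linear D" using dW der has_derivative_linear by blast+
  let ?S = "{-\<eta><..<\<eta>}"
  have S: "open ?S" "0 \<in> ?S" using c(2) by auto
  have cS: "c ` ?S \<subseteq> ?F" using c(3) by (auto simp: abs_less_iff)
  have "(?\<nu> has_derivative W) (at (c 0) within ?F)" using dW c(1) by simp
  \<comment> \<open>The derivative is known only within the frontier, so it is restricted to the
    image of the curve before composing.\<close>
  then have W': "(?\<nu> has_derivative W) (at (c 0) within c ` ?S)" using cS by (rule has_derivative_subset)
  have "(c has_derivative (\<lambda>t. t *\<^sub>R w)) (at 0 within ?S)" using c(4) by (rule has_derivative_at_withinI)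
  from has_derivative_in_compose[OF this W']
  have d1: "((\<lambda>t. ?\<nu> (c t)) has_derivative (\<lambda>t. t *\<^sub>R W w)) (at 0)"
    using at_within_open[OF S(2,1)] by (simp add: linear_scale[OF W(1)])
  have "(N has_derivative D) (at (c 0))" using der c(1) by simp
  from has_derivative_compose[OF c(4) this]
  have dN: "((\<lambda>t. N (c t)) has_derivative (\<lambda>t. 0)) (at 0)"
    by (simp add: linear_scale[OF W(2)] w)
  have "isCont c 0" using c(4) by (rule has_derivative_continuous)
  then have "\<forall>\<^sub>F t in nhds 0. c t \<in> ball p \<rho>"
    using \<rho> c(1) by (metis centre_in_ball isCont_def open_ball tendsto_at_iff_tendsto_nhds topological_tendstoD)
  then obtain \<eta>' where \<eta>': "\<eta>' > 0" "\<And>t. dist t 0 < \<eta>' \<Longrightarrow> c t \<in> ball p \<rho>"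
    unfolding eventually_nhds_metric by blast
  \<comment> \<open>Normalisation is 2-Lipschitz on vectors of norm at least 1, so difference
    quotients of the Gauss map are dominated by those of the chart normal.\<close>
  have d0: "((\<lambda>t. ?\<nu> (c t)) has_derivative (\<lambda>t. 0)) (at 0)"
  proof (rule has_derivativeI_sandwich[where e = "min \<eta> \<eta>'" and H = "\<lambda>t. 2 * (norm (N (c t) - N (c 0) - 0) / norm (t - 0))"])
    show "0 < min \<eta> \<eta>'" using \<eta>' c by simp
    fix t :: real assume t: "dist t 0 < min \<eta> \<eta>'"
    then have q: "c t \<in> ?F" "c t \<in> ball p \<rho>" using c(3)[of t] \<eta>'(2)[of t] by auto
    have "p \<in> ball p \<rho>" using \<rho> by simp
    have "?\<nu> (c t) - ?\<nu> (c 0) = s *\<^sub>R (N (c t) /\<^sub>R norm (N (c t)) - N p /\<^sub>R norm (N p))"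
      using \<nu>[OF q] \<nu>[OF p \<open>p \<in> ball p \<rho>\<close>] c(1) by (simp add: scaleR_diff_right)
    then have "norm (?\<nu> (c t) - ?\<nu> (c 0)) = norm (N (c t) /\<^sub>R norm (N (c t)) - N p /\<^sub>R norm (N p))"
      using s by simp
    also have "\<dots> \<le> 2 * norm (N (c t) - N p)" by (rule norm_normalised_diff_le[OF N1 N1])
    finally show "norm (?\<nu> (c t) - ?\<nu> (c 0) - 0) / norm (t - 0) \<le> 2 * (norm (N (c t) - N (c 0) - 0) / norm (t - 0))"
      using c(1) divide_right_mono[of "norm (?\<nu> (c t) - ?\<nu> (c 0))" _ "norm t"] by simp
  next
    have "(\<lambda>t. norm (N (c t) - N (c 0) - 0) / norm (t - 0)) \<midarrow>0\<rightarrow> 0"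
      using dN unfolding has_derivative_iff_norm by simp
    then show "(\<lambda>t. 2 * (norm (N (c t) - N (c 0) - 0) / norm (t - 0))) \<midarrow>0\<rightarrow> 0"
      by (rule tendsto_mult_right_zero)
  qed simp
  have "(\<lambda>t. t *\<^sub>R W w) = (\<lambda>t. 0)" by (rule has_derivative_unique[OF d1 d0])
  then have "W w = 0" by (metis scaleR_one)
  then show "w = 0" using nondegenerate[OF p w(2)] by (simp add: W_def)
qed

text \<open>\<open>D\<close> is known to be injective only on tangent vectors, and
  \<open>a - b\<close> is merely close to tangent. Pairing \<open>D\<close> with the component along
  the normal at \<open>p\<close> gives an injective map on the whole space; strict differentiability
  replaces \<open>D (a - b)\<close> by \<open>N a - N b\<close>, and convexity makes the normal
  component of \<open>a - b\<close> small.\<close>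

lemma gauss_map_local:
  assumes p: "p \<in> frontier B"
  obtains \<rho> c L where "0 < \<rho>" "0 < c"
    "\<And>a b. a \<in> frontier B \<Longrightarrow> b \<in> frontier B \<Longrightarrow> a \<in> ball p \<rho> \<Longrightarrow> b \<in> ball p \<rho> \<Longrightarrow>
      norm (outer_normal B a - outer_normal B b) \<le> L * norm (a - b)"
    "\<And>a b. a \<in> frontier B \<Longrightarrow> b \<in> frontier B \<Longrightarrow> a \<in> ball p \<rho> \<Longrightarrow> b \<in> ball p \<rho> \<Longrightarrow>
      c * norm (a - b) \<le> norm (outer_normal B a - outer_normal B b)"
proof -
  let ?\<nu> = "outer_normal B" and ?F = "frontier B"
  obtain \<rho> N D s e where \<rho>: "0 < \<rho>" and s: "\<bar>s\<bar> = (1::real)" and e: "norm e = 1" and D: "linear D"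
    and strict: "\<And>\<epsilon>. 0 < \<epsilon> \<Longrightarrow> \<exists>\<rho>>0. \<forall>a\<in>ball p \<rho>. \<forall>b\<in>ball p \<rho>. norm (N a - N b - D (a - b)) \<le> \<epsilon> * norm (a - b)"
    and der: "(N has_derivative D) (at p)"
    and Ne: "\<And>q. N q \<bullet> e = 1" and N1: "\<And>q. 1 \<le> norm (N q)"
    and \<nu>: "\<And>q. q \<in> ?F \<Longrightarrow> q \<in> ball p \<rho> \<Longrightarrow> ?\<nu> q = s *\<^sub>R (N q /\<^sub>R norm (N q))"
    and curve: "\<And>w. w \<bullet> ?\<nu> p = 0 \<Longrightarrow> \<exists>c \<eta>. c 0 = p \<and> 0 < (\<eta>::real) \<and> (\<forall>t. \<bar>t\<bar> < \<eta> \<longrightarrow> c t \<in> ?F) \<and>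
        (c has_derivative (\<lambda>t. t *\<^sub>R w)) (at 0)"
    by (rule gauss_chart[OF p]) blast
  define L where "L x = (D x, x \<bullet> ?\<nu> p)" for x
  have linL: "linear L" unfolding L_def
    by (rule linearI) (auto simp: linear_add[OF D] linear_scale[OF D] inner_add_left)
  have "inj L"
  proof (subst linear_injective_0[OF linL], intro allI impI)
    fix w assume "L w = 0"
    then have w: "D w = 0" "w \<bullet> ?\<nu> p = 0" by (simp_all add: L_def zero_prod_def)
    obtain c \<eta> where c: "c 0 = p" "0 < (\<eta>::real)" "\<And>t. \<bar>t\<bar> < \<eta> \<Longrightarrow> c t \<in> ?F"
      "(c has_derivative (\<lambda>t. t *\<^sub>R w)) (at 0)"
      using curve[OF w(2)] by blast
    show "w = 0" by (rule chart_derivative_injective[OF p \<rho> s der N1 \<nu> c w])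
  qed
  then obtain \<beta> where \<beta>: "\<beta> > 0" "\<And>x. \<beta> * norm x \<le> norm (L x)"
    using linear_inj_bounded_below_pos[OF linL] by metis
  obtain K where K: "\<And>x. norm (D x) \<le> K * norm x" "K > 0"
    using linear_bounded_pos[OF D] by metis
  \<comment> \<open>Two errors of size \<open>\<epsilon> * norm (a - b)\<close>, one from strict
    differentiability and one from the normal component, leave half of
    \<open>\<beta>\<close>.\<close>
  define \<epsilon> where "\<epsilon> = \<beta> / 4"
  have \<epsilon>: "\<epsilon> > 0" using \<beta> by (simp add: \<epsilon>_def)
  obtain \<rho>1 where \<rho>1: "\<rho>1 > 0" "\<And>a b. a \<in> ball p \<rho>1 \<Longrightarrow> b \<in> ball p \<rho>1 \<Longrightarrow> norm (N a - N b - D (a - b)) \<le> \<epsilon> * norm (a - b)"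
    using strict[OF \<epsilon>] by blast
  define \<Lambda> where "\<Lambda> = 2 * (K + \<epsilon>)"
  define m where "m = norm (N p) + 1"
  \<comment> \<open>The first radius keeps \<open>norm (N a)\<close> at most \<open>m\<close>, the
    second keeps the Gauss map within \<open>\<epsilon>\<close> of its value at
    \<open>p\<close>.\<close>
  define \<rho>2 where "\<rho>2 = min (1 / \<Lambda>) (\<epsilon> / \<Lambda>)"
  define \<rho>' where "\<rho>' = min (min \<rho> \<rho>1) \<rho>2"
  have \<Lambda>0: "\<Lambda> > 0" using K \<epsilon> by (simp add: \<Lambda>_def)
  have \<rho>'0: "\<rho>' > 0" using \<rho> \<rho>1 \<epsilon> \<Lambda>0 by (simp add: \<rho>'_def \<rho>2_def)
  have pball: "p \<in> ball p \<rho>'" using \<rho>'0 by simp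
  have sub: "a \<in> ball p \<rho>" "a \<in> ball p \<rho>1" "norm (a - p) \<le> \<rho>2" if "a \<in> ball p \<rho>'" for a
    using that by (auto simp: \<rho>'_def dist_norm norm_minus_commute)
  have NL: "norm (N a - N b) \<le> (K + \<epsilon>) * norm (a - b)" if "a \<in> ball p \<rho>'" "b \<in> ball p \<rho>'" for a b
  proof -
    have "norm (N a - N b) \<le> norm (N a - N b - D (a - b)) + norm (D (a - b))" by norm
    also have "\<dots> \<le> \<epsilon> * norm (a - b) + K * norm (a - b)"
      by (intro add_mono \<rho>1(2) sub K(1) that)
    finally show ?thesis by (simp add: algebra_simps)
  qed
  have upper: "norm (?\<nu> a - ?\<nu> b) \<le> \<Lambda> * norm (a - b)" if F: "a \<in> ?F" "b \<in> ?F" and ab: "a \<in> ball p \<rho>'" "b \<in> ball p \<rho>'" for a b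
  proof -
    have "?\<nu> a - ?\<nu> b = s *\<^sub>R (N a /\<^sub>R norm (N a) - N b /\<^sub>R norm (N b))"
      using \<nu>[OF F(1) sub(1)[OF ab(1)]] \<nu>[OF F(2) sub(1)[OF ab(2)]] by (simp add: scaleR_diff_right)
    then have "norm (?\<nu> a - ?\<nu> b) = norm (N a /\<^sub>R norm (N a) - N b /\<^sub>R norm (N b))" using s by simp
    also have "\<dots> \<le> 2 * norm (N a - N b)" by (rule norm_normalised_diff_le[OF N1 N1])
    also have "\<dots> \<le> \<Lambda> * norm (a - b)" using NL[OF ab] unfolding \<Lambda>_def mult.assoc by linarith
    finally show ?thesis .
  qed
  have \<nu>p: "norm (?\<nu> a - ?\<nu> p) \<le> \<epsilon>" if a: "a \<in> ?F" "a \<in> ball p \<rho>'" for a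
  proof -
    have "norm (?\<nu> a - ?\<nu> p) \<le> \<Lambda> * norm (a - p)" by (rule upper[OF a(1) p a(2) pball])
    also have "\<dots> \<le> \<Lambda> * (\<epsilon> / \<Lambda>)" using sub(3)[OF a(2)] \<Lambda>0 by (intro mult_left_mono) (auto simp: \<rho>2_def)
    finally show ?thesis using \<Lambda>0 by simp
  qed
  have Nm: "norm (N a) \<le> m" if a: "a \<in> ball p \<rho>'" for a
  proof -
    have "norm (N a - N p) \<le> (K + \<epsilon>) * norm (a - p)" by (rule NL[OF a pball])
    also have "\<dots> \<le> \<Lambda> * (1 / \<Lambda>)"
      using sub(3)[OF a] K \<epsilon> by (intro mult_mono) (auto simp: \<rho>2_def \<Lambda>_def)
    finally have "norm (N a - N p) \<le> 1" using \<Lambda>0 by simp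
    then show ?thesis unfolding m_def by norm
  qed
  have m0: "0 < m" by (simp add: m_def add_nonneg_pos)
  have \<nu>e: "?\<nu> a \<bullet> e = s / norm (N a)" if "a \<in> ?F" "a \<in> ball p \<rho>'" for a
    using \<nu>[OF that(1) sub(1)[OF that(2)]] Ne by (simp add: divide_inverse)
  have N\<nu>: "N a = ?\<nu> a /\<^sub>R (?\<nu> a \<bullet> e)" if "a \<in> ?F" "a \<in> ball p \<rho>'" for a
  proof -
    have "norm (N a) \<noteq> 0" "s \<noteq> 0" using N1[of a] s by auto
    then show ?thesis unfolding \<nu>e[OF that] unfolding \<nu>[OF that(1) sub(1)[OF that(2)]] by simp
  qed
  have me: "1 \<le> m * \<bar>?\<nu> a \<bullet> e\<bar>" if "a \<in> ?F" "a \<in> ball p \<rho>'" for a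
  proof -
    have "0 < norm (N a)" using N1[of a] by linarith
    then show ?thesis unfolding \<nu>e[OF that] using Nm[OF that(2)] s by (simp add: abs_divide)
  qed
  have lower: "\<beta> / 2 / (m + m\<^sup>2) * norm (a - b) \<le> norm (?\<nu> a - ?\<nu> b)"
    if F: "a \<in> ?F" "b \<in> ?F" and ab: "a \<in> ball p \<rho>'" "b \<in> ball p \<rho>'" for a b
  proof -
    have 1: "norm (N a - N b) \<le> (m + m\<^sup>2) * norm (?\<nu> a - ?\<nu> b)"
      unfolding N\<nu>[OF F(1) ab(1)] N\<nu>[OF F(2) ab(2)]
      by (rule norm_rescaled_diff_le) (use outer_normal F e me ab m0 in auto)
    \<comment> \<open>The supporting hyperplanes at \<open>b\<close> and at \<open>a\<close> give
      \<open>(a - b) \<bullet> ?\<nu> b \<le> 0\<close> and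
      \<open>(b - a) \<bullet> ?\<nu> a \<le> 0\<close>, so the product with the normal at
      \<open>p\<close> is bounded in both directions by the variation of the Gauss map.\<close>
    have small: "\<bar>(a - b) \<bullet> ?\<nu> p\<bar> \<le> \<epsilon> * norm (a - b)"
    proof -
      have "(a - b) \<bullet> ?\<nu> p = (a - b) \<bullet> ?\<nu> b + (a - b) \<bullet> (?\<nu> p - ?\<nu> b)" by (simp add: inner_diff_right)
      also have "\<dots> \<le> 0 + norm (a - b) * norm (?\<nu> p - ?\<nu> b)"
        by (intro add_mono outer_normal_frontier_le F norm_cauchy_schwarz)
      also have "\<dots> \<le> norm (a - b) * \<epsilon>"
        using \<nu>p[OF F(2) ab(2)] by (simp add: norm_minus_commute mult_left_mono)
      finally have u: "(a - b) \<bullet> ?\<nu> p \<le> norm (a - b) * \<epsilon>" .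
      have "(b - a) \<bullet> ?\<nu> p = (b - a) \<bullet> ?\<nu> a + (b - a) \<bullet> (?\<nu> p - ?\<nu> a)" by (simp add: inner_diff_right)
      also have "\<dots> \<le> 0 + norm (b - a) * norm (?\<nu> p - ?\<nu> a)"
        by (intro add_mono outer_normal_frontier_le F norm_cauchy_schwarz)
      also have "\<dots> \<le> norm (a - b) * \<epsilon>"
        using \<nu>p[OF F(1) ab(1)] by (simp add: norm_minus_commute mult_left_mono)
      finally have "(b - a) \<bullet> ?\<nu> p \<le> norm (a - b) * \<epsilon>" .
      with u show ?thesis by (simp add: inner_diff_left abs_le_iff mult.commute)
    qed
    have "\<beta> * norm (a - b) \<le> norm (L (a - b))" by (rule \<beta>(2))
    also have "\<dots> \<le> norm (D (a - b)) + \<bar>(a - b) \<bullet> ?\<nu> p\<bar>"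
      unfolding L_def norm_Pair using sqrt_sum_squares_le_sum_abs[of "norm (D (a - b))" "norm ((a - b) \<bullet> ?\<nu> p)"] by simp
    also have "norm (D (a - b)) \<le> norm (N a - N b) + \<epsilon> * norm (a - b)"
      using \<rho>1(2)[OF sub(2)[OF ab(1)] sub(2)[OF ab(2)]]
        norm_triangle_ineq4[of "N a - N b" "N a - N b - D (a - b)"] by simp
    finally have "\<beta> * norm (a - b) \<le> norm (N a - N b) + 2 * (\<epsilon> * norm (a - b))" using small by linarith
    then have "\<beta> / 2 * norm (a - b) \<le> norm (N a - N b)" by (simp add: \<epsilon>_def)
    with 1 have "\<beta> / 2 * norm (a - b) \<le> (m + m\<^sup>2) * norm (?\<nu> a - ?\<nu> b)" by linarith
    moreover have "0 < m + m\<^sup>2" using m0 by (simp add: add_pos_pos)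
    ultimately show ?thesis by (simp add: field_simps)
  qed
  have "0 < m + m\<^sup>2" using m0 by (simp add: add_pos_pos)
  then have "0 < \<beta> / 2 / (m + m\<^sup>2)" using \<beta> by simp
  from that[OF \<rho>'0 this upper lower] show thesis by blast
qed

text \<open>Equal normals put \<open>p\<close> and \<open>q\<close> on one supporting hyperplane, so
  the segment between them lies in the frontier with constant normal. Its points close to
  \<open>p\<close> contradict the local lower bound.\<close>

lemma outer_normal_injective:
  assumes p: "p \<in> frontier B" and q: "q \<in> frontier B" and eq: "outer_normal B p = outer_normal B q"
  shows "p = q"
proof (rule ccontr)
  assume ne: "p \<noteq> q"
  let ?\<nu> = "outer_normal B" and ?F = "frontier B"
  obtain \<rho> c where \<rho>: "0 < \<rho>" "0 < c"
    "\<And>a b. a \<in> ?F \<Longrightarrow> b \<in> ?F \<Longrightarrow> a \<in> ball p \<rho> \<Longrightarrow> b \<in> ball p \<rho> \<Longrightarrow> c * norm (a - b) \<le> norm (?\<nu> a - ?\<nu> b)"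
    by (rule gauss_map_local[OF p]) blast
  have cl: "p \<in> closure B" "q \<in> closure B" using p q by (auto simp: frontier_def)
  have pq: "p \<bullet> ?\<nu> p = q \<bullet> ?\<nu> p"
    using outer_normal(3)[OF p cl(2)] outer_normal(3)[OF q cl(1)] eq by simp
  \<comment> \<open>Small enough for the point \<open>x\<close> below to stay within
    \<open>\<rho>\<close> of \<open>p\<close>, and positive, so that \<open>x\<close> differs from
    \<open>p\<close>.\<close>
  define t where "t = min 1 (\<rho> / (2 * norm (q - p)))"
  have t: "0 < t" "t \<le> 1" "t * norm (q - p) < \<rho>"
  proof -
    have n: "norm (q - p) > 0" using ne by simp
    show "0 < t" "t \<le> 1" using \<rho> n by (auto simp: t_def)
    have "t * norm (q - p) \<le> \<rho> / (2 * norm (q - p)) * norm (q - p)" by (intro mult_right_mono) (auto simp: t_def)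
    also have "\<dots> < \<rho>" using n \<rho> by simp
    finally show "t * norm (q - p) < \<rho>" .
  qed
  define x where "x = (1 - t) *\<^sub>R p + t *\<^sub>R q"
  have xp: "x - p = t *\<^sub>R (q - p)" by (simp add: x_def algebra_simps)
  have xcl: "x \<in> closure B"
    using convexD[OF convex_closure[OF conv] cl, of "1 - t" t] t by (simp add: x_def)
  have xn: "x \<bullet> ?\<nu> p = p \<bullet> ?\<nu> p" by (simp add: x_def inner_add_left pq algebra_simps)
  have supp: "norm (?\<nu> p) = 1" "\<forall>y\<in>B. y \<bullet> ?\<nu> p \<le> x \<bullet> ?\<nu> p" using outer_normal(1,2)[OF p] xn by auto
  have xF: "x \<in> ?F" by (rule support_imp_frontier[OF supp xcl])
  have "?\<nu> x = ?\<nu> p" by (rule outer_normal_eqI[OF xF supp])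
  moreover have "x \<in> ball p \<rho>" "p \<in> ball p \<rho>"
    using t \<rho> by (auto simp: dist_norm norm_minus_commute[of p] xp)
  ultimately have "c * norm (x - p) \<le> 0" using \<rho>(3)[OF xF p] by simp
  then have "x = p" using \<rho>(2) by (simp add: mult_le_0_iff)
  then show False using xp t(1) ne by simp
qed

section \<open>Global bounds for the Gauss map by compactness\<close>

lemma frontier_pair_limits:
  assumes F: "\<And>n. a n \<in> frontier B" "\<And>n. b n \<in> frontier B"
  obtains f :: "nat \<Rightarrow> nat" and p q where "strict_mono f" "p \<in> frontier B" "q \<in> frontier B"
    "(a \<circ> f) \<longlonglongrightarrow> p" "(b \<circ> f) \<longlonglongrightarrow> q"
proof -
  have "compact (frontier B \<times> frontier B)" using bdd by (intro compact_Times compact_frontier_bounded)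
  then obtain l f where l: "l \<in> frontier B \<times> frontier B" "strict_mono f" "((\<lambda>n. (a n, b n)) \<circ> f) \<longlonglongrightarrow> l"
    unfolding compact_def using F by (metis (no_types, lifting) SigmaI)
  have "(a \<circ> f) \<longlonglongrightarrow> fst l" "(b \<circ> f) \<longlonglongrightarrow> snd l"
    using tendsto_fst[OF l(3)] tendsto_snd[OF l(3)] by (simp_all add: o_def)
  then show thesis using that l by (metis mem_Times_iff)
qed

lemma eventually_in_ball_subseq:
  assumes "(a \<circ> f) \<longlonglongrightarrow> (p::'b::metric_space)" "0 < \<rho>"
  shows "\<forall>\<^sub>F n in sequentially. a (f n) \<in> ball p \<rho>"
  using tendstoD[OF assms] by (simp add: dist_commute)

text \<open>Pairs violating every constant would have distances tending to 0, since unit normals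
  differ by at most 2. A subsequence of both then converges to one point, against the local bound
  there.\<close>

lemma outer_normal_Lipschitz:
  "\<exists>L\<ge>0. \<forall>a\<in>frontier B. \<forall>b\<in>frontier B. norm (outer_normal B a - outer_normal B b) \<le> L * norm (a - b)"
proof (rule ccontr)
  let ?\<nu> = "outer_normal B" and ?F = "frontier B"
  assume "\<not> ?thesis"
  then have "\<forall>n::nat. \<exists>a b. a \<in> ?F \<and> b \<in> ?F \<and> real n * norm (a - b) < norm (?\<nu> a - ?\<nu> b)"
    by (metis not_le of_nat_0_le_iff)
  then obtain a b where ab: "\<And>n. a n \<in> ?F" "\<And>n. b n \<in> ?F" "\<And>n. real n * norm (a n - b n) < norm (?\<nu> (a n) - ?\<nu> (b n))"
    by metis
  obtain f :: "nat \<Rightarrow> nat" and p q where f: "strict_mono f" and pq: "p \<in> ?F" "q \<in> ?F" "(a \<circ> f) \<longlonglongrightarrow> p" "(b \<circ> f) \<longlonglongrightarrow> q"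
    by (rule frontier_pair_limits[of a b, OF ab(1,2)])
  have small: "norm (a n - b n) \<le> 2 / real n" if "n > 0" for n
  proof -
    have "real n * norm (a n - b n) \<le> 2"
      using ab(3)[of n] norm_triangle_ineq4[of "?\<nu> (a n)" "?\<nu> (b n)"] outer_normal(1)[OF ab(1)] outer_normal(1)[OF ab(2)]
      by (smt (verit))
    then show ?thesis using that by (simp add: field_simps)
  qed
  have "(\<lambda>n. a (f n) - b (f n)) \<longlonglongrightarrow> 0"
  proof (rule Lim_null_comparison)
    show "\<forall>\<^sub>F n in sequentially. norm (a (f n) - b (f n)) \<le> 2 / real (f n)"
      using eventually_gt_at_top[of 0]
    proof eventually_elim
      case (elim n)
      then have "f n > 0" using seq_suble[OF f, of n] by linarith
      then show ?case by (rule small)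
    qed
    show "(\<lambda>n. 2 / real (f n)) \<longlonglongrightarrow> 0"
      by (intro tendsto_divide_0[OF tendsto_const] filterlim_at_top_imp_at_infinity
          filterlim_compose[OF filterlim_real_sequentially filterlim_subseq[OF f]])
  qed
  moreover have "(\<lambda>n. a (f n) - b (f n)) \<longlonglongrightarrow> p - q" using tendsto_diff[OF pq(3,4)] by (simp add: o_def)
  ultimately have "p = q" using LIMSEQ_unique by fastforce
  obtain \<rho> L where \<rho>: "0 < \<rho>"
    "\<And>a b. a \<in> ?F \<Longrightarrow> b \<in> ?F \<Longrightarrow> a \<in> ball p \<rho> \<Longrightarrow> b \<in> ball p \<rho> \<Longrightarrow> norm (?\<nu> a - ?\<nu> b) \<le> L * norm (a - b)"
    by (rule gauss_map_local[OF pq(1)]) blast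
  have "\<forall>\<^sub>F n in sequentially. a (f n) \<in> ball p \<rho> \<and> b (f n) \<in> ball p \<rho> \<and> n > nat \<lceil>L\<rceil>"
    using \<open>p = q\<close> pq(3,4) \<rho>(1)
    by (intro eventually_conj eventually_in_ball_subseq eventually_gt_at_top) auto
  then obtain n where n: "a (f n) \<in> ball p \<rho>" "b (f n) \<in> ball p \<rho>" "n > nat \<lceil>L\<rceil>"
    by (metis (no_types, lifting) eventually_sequentially order_refl)
  have "real (f n) \<ge> L" using n(3) seq_suble[OF f, of n] by linarith
  then have "L * norm (a (f n) - b (f n)) \<le> real (f n) * norm (a (f n) - b (f n))" by (intro mult_right_mono) auto
  then show False using \<rho>(2)[OF ab(1,2) n(1,2)] ab(3)[of "f n"] by linarith
qed

text \<open>For a sequence of counterexamples the differences of normals tend to 0, so by continuity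
  the limits \<open>p\<close> and \<open>q\<close> have equal normals and coincide by injectivity;
  this contradicts the local lower bound at that point.\<close>

lemma outer_normal_expansive:
  "\<exists>c>0. \<forall>a\<in>frontier B. \<forall>b\<in>frontier B. c * norm (a - b) \<le> norm (outer_normal B a - outer_normal B b)"
proof (rule ccontr)
  let ?\<nu> = "outer_normal B" and ?F = "frontier B"
  assume neg: "\<not> ?thesis"
  have "\<exists>a b. a \<in> ?F \<and> b \<in> ?F \<and> norm (?\<nu> a - ?\<nu> b) < inverse (real (Suc n)) * norm (a - b)" for n
    using neg by (metis not_le inverse_positive_iff_positive of_nat_0_less_iff zero_less_Suc)
  then obtain a b where ab: "\<And>n. a n \<in> ?F" "\<And>n. b n \<in> ?F" "\<And>n. norm (?\<nu> (a n) - ?\<nu> (b n)) < inverse (real (Suc n)) * norm (a n - b n)"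
    by metis
  obtain f :: "nat \<Rightarrow> nat" and p q where f: "strict_mono f" and pq: "p \<in> ?F" "q \<in> ?F" "(a \<circ> f) \<longlonglongrightarrow> p" "(b \<circ> f) \<longlonglongrightarrow> q"
    by (rule frontier_pair_limits[of a b, OF ab(1,2)])
  obtain L where L: "\<forall>a\<in>?F. \<forall>b\<in>?F. norm (?\<nu> a - ?\<nu> b) \<le> L * norm (a - b)" using outer_normal_Lipschitz by blast
  have cont: "(\<lambda>n. ?\<nu> (x (f n))) \<longlonglongrightarrow> ?\<nu> y" if x: "\<And>n. x n \<in> ?F" "y \<in> ?F" "(x \<circ> f) \<longlonglongrightarrow> y" for x y
  proof (rule LIM_zero_cancel, rule Lim_null_comparison)
    show "\<forall>\<^sub>F n in sequentially. norm (?\<nu> (x (f n)) - ?\<nu> y) \<le> L * norm (x (f n) - y)" using L x by simp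
    have "(\<lambda>n. norm (x (f n) - y)) \<longlonglongrightarrow> 0" using x(3) by (simp add: o_def LIM_zero tendsto_norm_zero)
    then show "(\<lambda>n. L * norm (x (f n) - y)) \<longlonglongrightarrow> 0" by (rule tendsto_mult_right_zero)
  qed
  have inv0: "(\<lambda>n. inverse (real (Suc (f n)))) \<longlonglongrightarrow> 0"
    using LIMSEQ_subseq_LIMSEQ[OF LIMSEQ_inverse_real_of_nat f] by (simp add: o_def)
  have "(\<lambda>n. ?\<nu> (a (f n)) - ?\<nu> (b (f n))) \<longlonglongrightarrow> 0"
  proof (rule Lim_null_comparison)
    show "\<forall>\<^sub>F n in sequentially. norm (?\<nu> (a (f n)) - ?\<nu> (b (f n))) \<le> inverse (real (Suc (f n))) * norm (a (f n) - b (f n))"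
      using ab(3) by (simp add: less_imp_le)
    have "(\<lambda>n. norm (a (f n) - b (f n))) \<longlonglongrightarrow> norm (p - q)"
      using tendsto_norm[OF tendsto_diff[OF pq(3,4)]] by (simp add: o_def)
    from tendsto_mult[OF inv0 this]
    show "(\<lambda>n. inverse (real (Suc (f n))) * norm (a (f n) - b (f n))) \<longlonglongrightarrow> 0" by simp
  qed
  moreover have "(\<lambda>n. ?\<nu> (a (f n)) - ?\<nu> (b (f n))) \<longlonglongrightarrow> ?\<nu> p - ?\<nu> q"
    by (intro tendsto_diff cont ab pq)
  ultimately have "?\<nu> p = ?\<nu> q" using LIMSEQ_unique by fastforce
  then have "p = q" by (rule outer_normal_injective[OF pq(1,2)])
  obtain \<rho> c where \<rho>: "0 < \<rho>" "0 < c"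
    "\<And>a b. a \<in> ?F \<Longrightarrow> b \<in> ?F \<Longrightarrow> a \<in> ball p \<rho> \<Longrightarrow> b \<in> ball p \<rho> \<Longrightarrow> c * norm (a - b) \<le> norm (?\<nu> a - ?\<nu> b)"
    by (rule gauss_map_local[OF pq(1)]) blast
  have "\<forall>\<^sub>F n in sequentially. a (f n) \<in> ball p \<rho> \<and> b (f n) \<in> ball p \<rho> \<and> inverse (real (Suc (f n))) < c"
    using \<open>p = q\<close> pq(3,4) \<rho>(1,2) order_tendstoD(2)[OF inv0]
    by (intro eventually_conj eventually_in_ball_subseq) auto
  then obtain n where n: "a (f n) \<in> ball p \<rho>" "b (f n) \<in> ball p \<rho>" "inverse (real (Suc (f n))) < c"
    by (metis (no_types, lifting) eventually_sequentially order_refl)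
  have "inverse (real (Suc (f n))) * norm (a (f n) - b (f n)) \<le> c * norm (a (f n) - b (f n))"
    using n(3) by (intro mult_right_mono) auto
  then show False using \<rho>(3)[OF ab(1,2) n(1,2)] ab(3)[of "f n"] by linarith
qed

end

section \<open>Shells of the body norm\<close>

context centred_body
begin

text \<open>\<open>B\<close> need not contain its frontier, so the infimum may fail to be attained.
  Membership is shown for every \<open>s > t\<close>, and excluded for \<open>s < t\<close> because
  shrinking a point of the closure towards the interior point 0 makes it interior.\<close>

lemma body_norm_scaleR_frontier:
  assumes p: "p \<in> frontier B" and t: "0 < t"
  shows "body_norm B (t *\<^sub>R p) = t"
proof -
  let ?S = "{s. s > 0 \<and> t *\<^sub>R p \<in> (\<lambda>y. s *\<^sub>R y) ` B}"
  have pc: "p \<in> closure B" "p \<notin> interior B" using p by (auto simp: frontier_def)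
  have shrink: "l *\<^sub>R x \<in> interior B" if x: "x \<in> closure B" and l: "0 < l" "l < 1" for x l
  proof -
    have "x - (1 - l) *\<^sub>R (x - 0) \<in> interior B"
      by (rule mem_interior_closure_convex_shrink[OF conv int0 x]) (use l in auto)
    then show ?thesis by (simp add: algebra_simps)
  qed
  have up: "s \<in> ?S" if s: "t < s" for s
  proof -
    have "(t / s) *\<^sub>R p \<in> B" using shrink[OF pc(1), of "t / s"] s t interior_subset by auto
    moreover have "t *\<^sub>R p = s *\<^sub>R ((t / s) *\<^sub>R p)" using s t by simp
    ultimately show ?thesis using s t by (intro CollectI conjI image_eqI[of _ _ "(t / s) *\<^sub>R p"]) auto
  qed
  have low: "t \<le> s" if sS: "s \<in> ?S" for s
  proof (rule ccontr)
    assume st: "\<not> t \<le> s"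
    obtain y where y: "y \<in> B" "s > 0" "t *\<^sub>R p = s *\<^sub>R y" using sS by auto
    have "p = (1 / t) *\<^sub>R (t *\<^sub>R p)" using t by simp
    also have "\<dots> = (s / t) *\<^sub>R y" by (simp add: y(3))
    finally have "p = (s / t) *\<^sub>R y" .
    moreover have "(s / t) *\<^sub>R y \<in> interior B"
      using shrink[of y "s / t"] y st t closure_subset by auto
    ultimately show False using pc(2) by simp
  qed
  have "Inf ?S = t"
  proof (rule antisym)
    have bd: "bdd_below ?S" using low by (intro bdd_belowI) blast
    show "Inf ?S \<le> t"
    proof (rule dense_ge)
      fix s assume "t < s"
      from cInf_lower[OF up[OF this] bd] show "Inf ?S \<le> s" .
    qed
    have mem: "t + 1 \<in> ?S" by (rule up) simp
    have "?S \<noteq> {}"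
    proof
      assume "?S = {}"
      with mem have "t + 1 \<in> {}" by (simp only:)
      then show False by (rule emptyE)
    qed
    then show "t \<le> Inf ?S" by (rule cInf_greatest) (rule low)
  qed
  then show ?thesis by (simp add: body_norm_def)
qed

lemma body_norm_zero: "body_norm B 0 = 0"
proof -
  have "{t. t > 0 \<and> 0 \<in> (\<lambda>y. t *\<^sub>R y) ` B} = {0<..}"
    using int0 interior_subset by (force simp: image_iff)
  then show ?thesis by (simp add: body_norm_def)
qed

lemma body_norm_polar:
  assumes "x \<noteq> 0"
  obtains p where "p \<in> frontier B" "x = body_norm B x *\<^sub>R p" "0 < body_norm B x"
proof -
  obtain l where l: "0 < l" "0 + l *\<^sub>R x \<in> frontier B"
    by (rule ray_to_frontier[OF bdd int0 assms]) blast
  define p where "p = l *\<^sub>R x"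
  have p: "p \<in> frontier B" "x = (1 / l) *\<^sub>R p" using l by (simp_all add: p_def)
  have "body_norm B x = 1 / l" using body_norm_scaleR_frontier[OF p(1), of "1 / l"] l p(2) by simp
  then show thesis using that p l by simp
qed

end

text \<open>The shell is cut into at most \<open>\<delta> / h + 1\<close> layers of height
  \<open>h\<close>, and the fullest one bounds the total. The second term comes from
  \<open>r ^ (d - 1) * r ^ (d * (d - 1)) = R ^ (d - 1)\<close>; \<open>\<delta> \<le> R\<close>
  keeps the radius \<open>T\<close> of a layer at most \<open>2 * R\<close>.\<close>

lemma real_card_le_shells:
  fixes r R \<delta> K :: real and g :: "'b \<Rightarrow> real"
  assumes d: "1 \<le> d" and r: "1 \<le> r" "r ^ (d + 1) = R" and \<delta>: "0 \<le> \<delta>" "\<delta> \<le> R" and X: "finite X"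
    and g: "\<And>x. x \<in> X \<Longrightarrow> R \<le> g x \<and> g x \<le> R + \<delta>" and K: "0 \<le> K"
    and thin: "\<And>T X'. r ^ (d + 1) \<le> T \<Longrightarrow> T \<le> 2 * r ^ (d + 1) \<Longrightarrow> X' \<subseteq> X \<Longrightarrow>
      \<forall>x\<in>X'. T \<le> g x \<and> g x \<le> T + 1 / r ^ (d - 1) \<Longrightarrow> real (card X') \<le> K * r ^ (d * (d - 1))"
  shows "real (card X) \<le> K * (r ^ (d * (d - 1)) + R ^ (d - 1) * \<delta>)"
proof -
  define h where "h = 1 / r ^ (d - 1)"
  have h: "0 < h" using r by (simp add: h_def)
  let ?f = "\<lambda>x. \<lfloor>(g x - R) / h\<rfloor>"
  have "\<exists>X'\<subseteq>X. (\<forall>x\<in>X'. \<forall>x'\<in>X'. ?f x = ?f x') \<and> real (card X) \<le> (\<delta> / h + 1) * real (card X')"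
  proof (rule pigeonhole_int[OF X, where a = 0 and b = "\<delta> / h"])
    fix x assume "x \<in> X"
    then have "0 \<le> (g x - R) / h" "(g x - R) / h \<le> \<delta> / h" using g[of x] h by (auto intro: divide_right_mono)
    then show "0 \<le> real_of_int (?f x) \<and> real_of_int (?f x) \<le> \<delta> / h" by (simp; linarith)
  qed (use \<delta> h in auto)
  then obtain X' where X': "X' \<subseteq> X" "\<And>x x'. x \<in> X' \<Longrightarrow> x' \<in> X' \<Longrightarrow> ?f x = ?f x'"
    "real (card X) \<le> (\<delta> / h + 1) * real (card X')" by blast
  have "real (card X') \<le> K * r ^ (d * (d - 1))"
  proof (cases "X' = {}")
    case True
    then show ?thesis using K r by simp
  next
    case False
    then obtain x0 where x0: "x0 \<in> X'" by blast
    define T where "T = R + real_of_int (?f x0) * h"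
    have g0: "0 \<le> (g x0 - R) / h" using g[of x0] x0 X'(1) h by auto
    have fl: "real_of_int (?f x) * h \<le> g x - R" "g x - R \<le> (real_of_int (?f x) + 1) * h" for x
    proof -
      have "real_of_int (?f x) * h \<le> (g x - R) / h * h" "(g x - R) / h * h \<le> (real_of_int (?f x) + 1) * h"
        by (rule mult_right_mono; use h in linarith)+
      then show "real_of_int (?f x) * h \<le> g x - R" "g x - R \<le> (real_of_int (?f x) + 1) * h"
        using h by simp_all
    qed
    show ?thesis
    proof (rule thin[of T, OF _ _ X'(1)])
      have "0 \<le> real_of_int (?f x0) * h" using g0 h by simp
      then show "r ^ (d + 1) \<le> T" using r(2) by (simp add: T_def)
      have "g x0 \<le> R + \<delta>" using g x0 X'(1) by blast
      then show "T \<le> 2 * r ^ (d + 1)" using fl(1)[of x0] \<delta>(2) unfolding T_def r(2) by linarith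
      show "\<forall>x\<in>X'. T \<le> g x \<and> g x \<le> T + 1 / r ^ (d - 1)"
      proof
        fix x assume "x \<in> X'"
        then have eq: "?f x = ?f x0" using X'(2) x0 by blast
        have "real_of_int (?f x0) * h \<le> g x - R" "g x - R \<le> real_of_int (?f x0) * h + h"
          using fl[of x] unfolding eq distrib_right by simp_all
        then show "T \<le> g x \<and> g x \<le> T + 1 / r ^ (d - 1)"
          unfolding T_def h_def[symmetric] by linarith
      qed
    qed
  qed
  then have "real (card X) \<le> (\<delta> / h + 1) * (K * r ^ (d * (d - 1)))"
    using X'(3) \<delta> h by (meson add_nonneg_nonneg divide_nonneg_pos mult_left_mono order_trans zero_le_one)
  also have "\<dots> = K * (r ^ (d * (d - 1)) + (r ^ (d - 1) * r ^ (d * (d - 1))) * \<delta>)"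
    by (simp add: h_def algebra_simps)
  also have "r ^ (d - 1) * r ^ (d * (d - 1)) = R ^ (d - 1)"
    unfolding r(2)[symmetric] power_mult[symmetric] power_add[symmetric] by (simp add: distrib_right)
  finally show ?thesis .
qed

theorem corollary1p2:
  fixes B :: "(real ^ 'n) set" and d :: nat
  assumes "d = CARD('n)" and "d \<ge> 2"
    and "symmetric_convex_body B" and "bounded B"
    and "C_hypersurface (d div 2 + 1) (frontier B)"
    and "\<forall>p\<in>frontier B. gaussian_curvature B p \<noteq> 0"
  shows "\<exists>K::real. \<forall>R \<delta> :: real. 0 < R \<longrightarrow> 0 \<le> \<delta> \<longrightarrow> \<delta> \<le> R \<longrightarrow>
           finite {k \<in> integer_lattice. R \<le> body_norm B k \<and> body_norm B k \<le> R + \<delta>} \<and>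
           real (card {k \<in> integer_lattice. R \<le> body_norm B k \<and> body_norm B k \<le> R + \<delta>})
             \<le> K * max (R powr (real d - 2 + 2 / (real d + 1))) (R ^ (d - 1) * \<delta>)"
proof -
  interpret centred_body B
  proof
    have sc: "convex B" "interior B \<noteq> {}" "\<And>x. x \<in> B \<Longrightarrow> - x \<in> B"
      using assms(3) by (auto simp: symmetric_convex_body_def)
    show "convex B" "bounded B" by fact+
    obtain x where x: "x \<in> interior B" using sc(2) by blast
    \<comment> \<open>By symmetry the interior contains \<open>- x\<close> along with
      \<open>x\<close>, hence their midpoint 0.\<close>
    have "uminus ` B = B" using sc(3) by (force simp: image_iff)
    then have "- x \<in> interior B" using x interior_negations[of B] by auto
    then have "(1/2) *\<^sub>R x + (1/2) *\<^sub>R (- x) \<in> interior B"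
      using x convex_interior[OF sc(1)] by (intro convexD) auto
    then show "0 \<in> interior B" by simp
  qed
  interpret smooth_body B
  proof
    fix p assume "p \<in> frontier B"
    then obtain r e g where "r > 0" "norm e = 1" and g: "C_class (d div 2 + 1) g"
      and "frontier B \<inter> ball p r = {x \<in> ball p r. x \<bullet> e = g (orth_proj e x)}"
      using assms(5) unfolding C_hypersurface_def by blast
    moreover have "C_class (Suc (Suc 0)) g"
    proof (rule C_class_mono[OF g])
      show "Suc (Suc 0) \<le> d div 2 + 1" using assms(2) by simp
    qed
    ultimately show "\<exists>r>0. \<exists>e g. norm e = 1 \<and> C_class (Suc (Suc 0)) g \<and>
        frontier B \<inter> ball p r = {x \<in> ball p r. x \<bullet> e = g (orth_proj e x)}" by blast
  qed
  interpret curved_body B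
  proof
    fix p w assume p: "p \<in> frontier B" and w: "w \<bullet> outer_normal B p = 0"
      "frechet_derivative (outer_normal B) (at p within frontier B) w = 0"
    let ?\<nu> = "outer_normal B p"
    define W where "W = frechet_derivative (outer_normal B) (at p within frontier B)"
    have "(outer_normal B has_derivative W) (at p within frontier B)"
      unfolding W_def using outer_normal_differentiable[OF p] by (simp add: frechet_derivative_works[symmetric])
    then have W: "linear W" by (rule has_derivative_linear)
    let ?M = "\<lambda>x. W (orth_proj ?\<nu> x) + (x \<bullet> ?\<nu>) *\<^sub>R ?\<nu>"
    have M: "linear ?M"
      by (rule linearI)
         (auto simp: linear_add[OF linear_orth_proj] linear_scale[OF linear_orth_proj] linear_add[OF W] linear_scale[OF W] inner_add_left algebra_simps)
    have "det (matrix ?M) \<noteq> 0" using assms(6) p by (auto simp: gaussian_curvature_def Let_def W_def)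
    then have "inj ?M" using det_nz_iff_inj[OF M] by simp
    \<comment> \<open>For a tangent vector the projection is the identity and the added term
      vanishes, so \<open>?M w\<close> is \<open>W w\<close>.\<close>
    moreover have "?M w = 0" using w by (simp add: orth_proj_def W_def)
    ultimately show "w = 0" using linear_injective_0[OF M] by blast
  qed
  let ?F = "frontier B" and ?\<nu> = "outer_normal B" and ?n = "body_norm B"
  obtain c where c: "c > 0" "\<forall>a\<in>?F. \<forall>b\<in>?F. c * norm (a - b) \<le> norm (?\<nu> a - ?\<nu> b)"
    using outer_normal_expansive by blast
  obtain L where L: "L \<ge> 0" "\<forall>a\<in>?F. \<forall>b\<in>?F. norm (?\<nu> a - ?\<nu> b) \<le> L * norm (a - b)"
    using outer_normal_Lipschitz by blast
  obtain D where D: "0 < D" "\<And>p. p \<in> ?F \<Longrightarrow> norm p \<le> D"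
    using bounded_pos[of ?F] compact_imp_bounded[OF compact_frontier_bounded[OF bdd]] by blast
  \<comment> \<open>The supporting hyperplane at \<open>q\<close> gives one sign; the one at
    \<open>p\<close> gives the other up to the variation of the normal, which supplies the second
    factor of the distance.\<close>
  have cap: "\<bar>(p - q) \<bullet> ?\<nu> q\<bar> \<le> L * (norm (p - q))\<^sup>2" if pq: "p \<in> ?F" "q \<in> ?F" for p q
  proof -
    have "(q - p) \<bullet> ?\<nu> q = (q - p) \<bullet> ?\<nu> p + (q - p) \<bullet> (?\<nu> q - ?\<nu> p)" by (simp add: inner_diff_right)
    also have "\<dots> \<le> 0 + norm (q - p) * norm (?\<nu> q - ?\<nu> p)"
      by (intro add_mono outer_normal_frontier_le pq norm_cauchy_schwarz)
    also have "\<dots> \<le> norm (q - p) * (L * norm (q - p))"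
      using L(2) pq by (simp add: mult_left_mono)
    finally have "(q - p) \<bullet> ?\<nu> q \<le> L * (norm (p - q))\<^sup>2"
      by (simp add: power2_eq_square norm_minus_commute mult_ac)
    moreover have "(p - q) \<bullet> ?\<nu> q \<le> 0" by (rule outer_normal_frontier_le[OF pq(2,1)])
    ultimately show ?thesis by (simp add: inner_diff_left)
  qed
  have "\<exists>K\<ge>0. \<forall>r\<ge>1. \<forall>T X. r ^ (d + 1) \<le> T \<longrightarrow> T \<le> 2 * r ^ (d + 1) \<longrightarrow> finite X \<longrightarrow> X \<subseteq> integer_lattice \<longrightarrow>
     (\<forall>x\<in>X. \<exists>p\<in>?F. \<exists>t. x = t *\<^sub>R p \<and> T \<le> t \<and> t \<le> T + 1 / r ^ (d - 1)) \<longrightarrow>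
     real (card X) \<le> K * r ^ (d * (d - 1))"
    unfolding assms(1)
    by (rule card_shell_core[of ?F ?\<nu> D c L]) (use outer_normal(1) D c L(1) cap in \<open>auto simp: less_imp_le\<close>)
  then obtain K where K: "0 \<le> K" "\<And>r T X. 1 \<le> r \<Longrightarrow> r ^ (d + 1) \<le> T \<Longrightarrow> T \<le> 2 * r ^ (d + 1) \<Longrightarrow> finite X \<Longrightarrow> X \<subseteq> integer_lattice \<Longrightarrow>
     \<forall>x\<in>X. \<exists>p\<in>?F. \<exists>t. x = t *\<^sub>R p \<and> T \<le> t \<and> t \<le> T + 1 / r ^ (d - 1) \<Longrightarrow>
     real (card X) \<le> K * r ^ (d * (d - 1))" by blast
  \<comment> \<open>The exponent with \<open>r ^ (d * (d - 1)) = R powr E\<close> when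
    \<open>r ^ (d + 1) = R\<close>.\<close>
  define E where "E = real d - 2 + 2 / (real d + 1)"
  have E: "E * (real d + 1) = real (d * (d - 1))" "0 \<le> E"
    using assms(2) by (simp_all add: E_def field_simps of_nat_diff)
  define N0 where "N0 = real (card {k::real^'n. k \<in> integer_lattice \<and> norm k \<le> 2 * D})"
  \<comment> \<open>The summand \<open>2 * K\<close> handles \<open>1 \<le> R\<close>, where a sum
    of two terms is at most twice their maximum. The other handles \<open>R < 1\<close>: a nonempty
    shell has at most \<open>N0\<close> points and satisfies \<open>1 \<le> 2 * D * R\<close>, so
    \<open>N0\<close> may be multiplied by \<open>(2 * D * R) powr E\<close>.\<close>
  define K' where "K' = 2 * K + N0 * (2 * D) powr E"
  have norm_le: "norm k \<le> D * ?n k" for k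
  proof (cases "k = 0")
    case False
    obtain p where p: "p \<in> ?F" "k = ?n k *\<^sub>R p" "0 < ?n k" by (rule body_norm_polar[OF False])
    have "norm k = ?n k * norm p" using p(2,3) by (metis abs_of_pos norm_scaleR)
    then show ?thesis using D(2)[OF p(1)] p(3) by (simp add: mult.commute)
  qed (simp add: body_norm_zero)
  show ?thesis
  proof (intro exI[of _ K'] allI impI)
    fix R \<delta> :: real assume R: "0 < R" and \<delta>: "0 \<le> \<delta>" "\<delta> \<le> R"
    let ?X = "{k \<in> integer_lattice. R \<le> ?n k \<and> ?n k \<le> R + \<delta>}"
    let ?m = "max (R powr E) (R ^ (d - 1) * \<delta>)"
    have bounded: "norm k \<le> D * (R + \<delta>)" if "k \<in> ?X" for k
    proof -
      have "D * ?n k \<le> D * (R + \<delta>)" using that D(1) by (intro mult_left_mono) auto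
      then show ?thesis using norm_le[of k] by linarith
    qed
    have fin: "finite ?X"
      by (rule finite_subset[OF _ finite_integer_lattice_bounded[of "D * (R + \<delta>)"]]) (use bounded in auto)
    have m0: "0 \<le> ?m" by (simp add: le_max_iff_disj)
    have "real (card ?X) \<le> K' * ?m"
    proof (cases "1 \<le> R")
      case True
      define r where "r = R powr (1 / (real d + 1))"
      have r1: "1 \<le> r" using True by (simp add: r_def ge_one_powr_ge_zero)
      have rpow: "r ^ m = R powr (real m / (real d + 1))" for m
        using R by (simp add: r_def powr_powr flip: powr_realpow)
      have rR: "r ^ (d + 1) = R" unfolding rpow using R by (simp add: add.commute)
      have rE: "r ^ (d * (d - 1)) = R powr E"
      proof -
        have "real (d * (d - 1)) / (real d + 1) = E" unfolding E(1)[symmetric] by simp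
        then show ?thesis unfolding rpow by simp
      qed
      have "real (card ?X) \<le> K * (r ^ (d * (d - 1)) + R ^ (d - 1) * \<delta>)"
      proof (rule real_card_le_shells[where g = ?n])
        show "1 \<le> d" using assms(2) by simp
        fix T X' assume T: "r ^ (d + 1) \<le> T" "T \<le> 2 * r ^ (d + 1)" and X': "X' \<subseteq> ?X"
          "\<forall>x\<in>X'. T \<le> ?n x \<and> ?n x \<le> T + 1 / r ^ (d - 1)"
        show "real (card X') \<le> K * r ^ (d * (d - 1))"
        proof (rule K(2)[OF r1 T])
          show "finite X'" using X'(1) fin finite_subset by blast
          show "X' \<subseteq> integer_lattice" using X'(1) by blast
          show "\<forall>x\<in>X'. \<exists>p\<in>?F. \<exists>t. x = t *\<^sub>R p \<and> T \<le> t \<and> t \<le> T + 1 / r ^ (d - 1)"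
          proof
            fix x assume x: "x \<in> X'"
            then have "x \<noteq> 0" using X'(1) R by (auto simp: body_norm_zero)
            then obtain p where "p \<in> ?F" "x = ?n x *\<^sub>R p" by (rule body_norm_polar)
            then show "\<exists>p\<in>?F. \<exists>t. x = t *\<^sub>R p \<and> T \<le> t \<and> t \<le> T + 1 / r ^ (d - 1)" using X'(2) x by blast
          qed
        qed
      qed (use r1 rR \<delta> fin K(1) in auto)
      also have "\<dots> \<le> K * (?m + ?m)" unfolding rE by (intro mult_left_mono add_mono K(1)) auto
      also have "\<dots> \<le> K' * ?m" using m0 D(1) by (simp add: K'_def distrib_right N0_def)
      finally show ?thesis .
    next
      case False
      show ?thesis
      proof (cases "?X = {}")
        case True
        have "0 \<le> K'" using K(1) by (simp add: K'_def N0_def)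
        then show ?thesis unfolding True using m0 by simp
      next
        case ne: False
        then obtain k where k: "k \<in> ?X" by blast
        \<comment> \<open>A nonzero lattice point has norm at least 1, which bounds \<open>R\<close>
          from below.\<close>
        have "k \<noteq> 0" using k R by (auto simp: body_norm_zero)
        then obtain i where i: "k $ i \<noteq> 0" by (auto simp: vec_eq_iff)
        have "k $ i \<in> \<int>" using k by (simp add: integer_lattice_def)
        then have "1 \<le> \<bar>k $ i\<bar>" using i by (rule Ints_nonzero_abs_ge1)
        then have "1 \<le> norm k" using component_le_norm_cart[of k i] by linarith
        also have "\<dots> \<le> D * (R + \<delta>)" by (rule bounded[OF k])
        also have "\<dots> \<le> D * (R + R)" using \<delta>(2) D(1) by (intro mult_left_mono) auto
        finally have DR: "1 \<le> 2 * D * R" by simp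
        have "?X \<subseteq> {k. k \<in> integer_lattice \<and> norm k \<le> 2 * D}"
        proof
          fix x assume x: "x \<in> ?X"
          have "D * (R + \<delta>) \<le> D * 2" using False \<delta> D(1) by (intro mult_left_mono) auto
          then show "x \<in> {k. k \<in> integer_lattice \<and> norm k \<le> 2 * D}" using bounded[OF x] x by auto
        qed
        then have "real (card ?X) \<le> N0 * 1"
          unfolding N0_def using card_mono[OF finite_integer_lattice_bounded[of "2 * D"]] by simp
        also have "\<dots> \<le> N0 * (2 * D * R) powr E"
          by (intro mult_left_mono ge_one_powr_ge_zero DR E(2)) (simp add: N0_def)
        also have "\<dots> = N0 * (2 * D) powr E * R powr E" using D(1) R by (simp add: powr_mult)
        also have "\<dots> \<le> K' * ?m"
          unfolding K'_def using K(1) by (intro mult_mono) (auto simp: N0_def)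
        finally show ?thesis .
      qed
    qed
    then show "finite ?X \<and> real (card ?X) \<le> K' * max (R powr (real d - 2 + 2 / (real d + 1))) (R ^ (d - 1) * \<delta>)"
      using fin unfolding E_def by blast
  qed
qed

end
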